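(* Let $n\ge2$, let $c_1=2^nn\log(n)$, and let $\delta,\epsilon$ be positive real numbers with $\delta\ge6(n\epsilon+c_1)$. Let $\mathbf{P}=(P_1,\dots,P_n)\colon[q_0,\infty)\to\mathbb{R}^n$ be a rigid $n$-system of mesh $\delta$, attached to a canvas $(\mathbf{a}^{(i)})_{0\le i<s}$, $(k_i)_{0\le i<s}$, $(\ell_i)_{0\le i<s}$ with switch numbers $(q_i)_{0\le i<s}$, and set $q_s=\infty$ if $s<\infty$. Suppose there exists a unit vector $\mathbf{u}\in\mathbb{R}^n$ such that $\|\mathbf{P}(q)-\mathbf{L}_\mathbf{u}(q)\|_\infty\le\epsilon$ for all $q\ge q_0$. Then for each integer $i$ with $0\le i<s$ there exists an $n$-tuple of linearly independent points $(\mathbf{x}^{(i)}_1,\dots,\mathbf{x}^{(i)}_n)$ of $\mathbb{Z}^n$ such that: 1) $\|\mathbf{P}(q)-\Phi_n(L(\mathbf{x}^{(i)}_1,q),\dots,L(\mathbf{x}^{(i)}_n,q))\|_\infty\le\epsilon$ for $q_i\le q<q_{i+1}$; 2) if $i+1<s$, then $(\mathbf{x}^{(i)}_1,\dots,\widehat{\mathbf{x}^{(i)}_{k_i}},\dots,\mathbf{x}^{(i)}_n)=(\mathbf{x}^{(i+1)}_1,\dots,\widehat{\mathbf{x}^{(i+1)}_{\ell_{i+1}}},\dots,\mathbf{x}^{(i+1)}_n)$; 3) if $i\ge1$, then $|\log\|\mathbf{x}^{(i)}_j\|-P_j(q_i)|\le\epsilon$ for $j=1,\dots,n$; 4) if $i+1<s$,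 then $\mathbf{x}^{(i+1)}_{\ell_{i+1}}\in\langle\mathbf{x}^{(i)}_1,\dots,\mathbf{x}^{(i)}_{\ell_{i+1}}\rangle_\mathbb{R}$; 5) $0\le\log|\det(\mathbf{x}^{(i)}_1,\dots,\mathbf{x}^{(i)}_n)|\le n\epsilon+\log(n)$; 6) if $i\ge1$, then $\big|\log\|\mathbf{x}^{(i)}_1\wedge\cdots\wedge\widehat{\mathbf{x}^{(i)}_{k_i}}\wedge\cdots\wedge\mathbf{x}^{(i)}_n\|-\sum_{j\ne k_i}\log\|\mathbf{x}^{(i)}_j\|\big|\le n\epsilon+2c_1$.
   Context: Hats denote omission. $\|\cdot\|$ is the Euclidean norm; $\bigwedge^k\mathbb{R}^n$ carries the Euclidean structure in which $\mathbf{e}_{j_1}\wedge\cdots\wedge\mathbf{e}_{j_k}$ ($j_1<\cdots<j_k$) is orthonormal for any orthonormal basis of $\mathbb{R}^n$. For nonzero $\mathbf{x}\in\mathbb{R}^n$ and $q\ge0$, $L(\mathbf{x},q)=\max\{\log\|\mathbf{x}\|,\,q+\log|\mathbf{x}\cdot\mathbf{u}|\}$. $\Delta_n=\{x\in\mathbb{R}^n:x_1\le\cdots\le x_n\}$ and $\Phi_n\colon\mathbb{R}^n\to\Delta_n$ sorts coordinates increasingly. For $q\ge0$, $\mathcal{C}_\mathbf{u}(e^q)=\{\mathbf{x}:\|\mathbf{x}\|\le1,|\mathbf{x}\cdot\mathbf{u}|\le e^{-q}\}$, $L_{\mathbf{u},j}(q)$ is the smallest $L\ge0$ such that $e^L\mathcal{C}_\mathbf{u}(e^q)$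 contains $j$ linearly independent points of $\mathbb{Z}^n$, and $\mathbf{L}_\mathbf{u}=(L_{\mathbf{u},1},\dots,L_{\mathbf{u},n})$. A canvas with mesh $\delta$ and cardinality $s\in\{1,2,\dots\}\cup\{\infty\}$: points $\mathbf{a}^{(i)}\in\Delta_n$ and integers $k_i,\ell_i$ ($0\le i<s$) with (C1) $a^{(i)}_1<\cdots<a^{(i)}_n$ positive integer multiples of $\delta$; (C2) $1\le k_0\le\ell_0=n$, and $1\le k_i<\ell_i\le n$ for $i\ge1$; (C3) if $i+1<s$: $k_i\le\ell_{i+1}$, $a^{(i)}_{\ell_{i+1}}+\delta\le a^{(i+1)}_{\ell_{i+1}}$, and deleting coordinate $k_i$ of $\mathbf{a}^{(i)}$ gives the same tuple as deleting coordinate $\ell_{i+1}$ of $\mathbf{a}^{(i+1)}$. Its switch numbers are $q_i=a^{(i)}_1+\cdots+a^{(i)}_n$, and the attached rigid $n$-system of mesh $\delta$ is $\mathbf{P}(q)=\Phi_n(a^{(i)}_1,\dots,\widehat{a^{(i)}_{k_i}},\dots,a^{(i)}_n,a^{(i)}_{k_i}+q-q_i)$ for $q_i\le q<q_{i+1}$ (with $q_s=\infty$ if $s<\infty$). *)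

theory Defs
  imports "HOL-Analysis.Analysis" "HOL-Library.Extended_Nat"
begin

text \<open>
  The dimension is \<open>n = CARD('n)\<close> for vectors of type \<open>real^'n\<close>. Tuples indexed by
  \<open>1, \<dots>, n\<close>, of reals (such as points of \<open>\<Delta>\<^sub>n\<close>) or of vectors, are lists of length \<open>n\<close>;
  \<open>coord\<close> and \<open>omit\<close> translate the 1-based indices of the mathematics. With this encoding
  \<open>\<Phi>\<^sub>n\<close> is the library function \<open>sort\<close>.
\<close>

abbreviation coord :: "'a list \<Rightarrow> nat \<Rightarrow> 'a" where
  "coord xs j \<equiv> xs ! (j - 1)"

definition omit :: "nat \<Rightarrow> 'a list \<Rightarrow> 'a list" where
  "omit k xs = take (k - 1) xs @ drop k xs"

text \<open>The maximum norm of the difference of two nonempty tuples of the same length.\<close>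

definition linf_dist :: "real list \<Rightarrow> real list \<Rightarrow> real" where
  "linf_dist xs ys = Max {\<bar>x - y\<bar> |x y. (x, y) \<in> set (zip xs ys)}"


section \<open>Parametric geometry of numbers\<close>

definition integer_points :: "(real^'n) set" where
  "integer_points = {x. \<forall>i. x $ i \<in> \<int>}"

definition lin_indep_tuple :: "(real^'n) list \<Rightarrow> bool" where
  "lin_indep_tuple xs \<longleftrightarrow> distinct xs \<and> independent (set xs)"

text \<open>The convention \<open>log 0 = -\<infinity>\<close> is made explicit, since in HOL \<open>ln 0 = 0\<close>.\<close>

definition L_point :: "real^'n \<Rightarrow> real^'n \<Rightarrow> real \<Rightarrow> real" where
  "L_point u x q =
     (if x \<bullet> u = 0 then ln (norm x) else max (ln (norm x)) (q + ln \<bar>x \<bullet> u\<bar>))"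

text \<open>\<open>conv_body u q\<close> is \<open>\<C>\<^sub>u(e\<^sup>q)\<close>.\<close>

definition conv_body :: "real^'n \<Rightarrow> real \<Rightarrow> (real^'n) set" where
  "conv_body u q = {x. norm x \<le> 1 \<and> \<bar>x \<bullet> u\<bar> \<le> exp (- q)}"

definition L_min :: "real^'n \<Rightarrow> nat \<Rightarrow> real \<Rightarrow> real" where
  "L_min u j q =
     (LEAST L. 0 \<le> L \<and>
        (\<exists>S \<subseteq> (\<lambda>x. exp L *\<^sub>R x) ` conv_body u q \<inter> integer_points. independent S \<and> card S = j))"

definition L_map :: "real^'n \<Rightarrow> real \<Rightarrow> real list" where
  "L_map u q = map (\<lambda>j. L_min u j q) [1..<CARD('n) + 1]"


section \<open>Canvases and rigid systems\<close>

text \<open>Only the values of \<open>a\<close>, \<open>k\<close> and \<open>l\<close> at indices \<open>i < s\<close> are meaningful.\<close>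

definition canvas ::
  "nat \<Rightarrow> real \<Rightarrow> enat \<Rightarrow> (nat \<Rightarrow> real list) \<Rightarrow> (nat \<Rightarrow> nat) \<Rightarrow> (nat \<Rightarrow> nat) \<Rightarrow> bool" where
  "canvas n \<delta> s a k l \<longleftrightarrow>
     1 \<le> s \<and>
     (\<forall>i. enat i < s \<longrightarrow>
        length (a i) = n \<and> sorted_wrt (<) (a i) \<and>
        (\<forall>x \<in> set (a i). \<exists>m::nat. 0 < m \<and> x = real m * \<delta>)) \<and>
     1 \<le> k 0 \<and> k 0 \<le> l 0 \<and> l 0 = n \<and>
     (\<forall>i. 1 \<le> i \<and> enat i < s \<longrightarrow> 1 \<le> k i \<and> k i < l i \<and> l i \<le> n) \<and>
     (\<forall>i. enat (i + 1) < s \<longrightarrow>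
        k i \<le> l (i + 1) \<and>
        coord (a i) (l (i + 1)) + \<delta> \<le> coord (a (i + 1)) (l (i + 1)) \<and>
        omit (k i) (a i) = omit (l (i + 1)) (a (i + 1)))"

definition switch_number :: "(nat \<Rightarrow> real list) \<Rightarrow> nat \<Rightarrow> real" where
  "switch_number a i = sum_list (a i)"

text \<open>The interval \<open>[q\<^sub>i, q\<^sub>i\<^sub>+\<^sub>1)\<close>, where \<open>q\<^sub>s = \<infinity>\<close> if \<open>s < \<infinity>\<close>.\<close>

definition switch_interval :: "enat \<Rightarrow> (nat \<Rightarrow> real list) \<Rightarrow> nat \<Rightarrow> real set" where
  "switch_interval s a i =
     {q. switch_number a i \<le> q \<and> (enat (i + 1) < s \<longrightarrow> q < switch_number a (i + 1))}"

text \<open>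
  The intervals \<open>switch_interval s a i\<close> with \<open>i < s\<close> partition \<open>[q\<^sub>0, \<infinity>)\<close>, so this determines
  \<open>P\<close> there; values below \<open>q\<^sub>0\<close> are irrelevant.
\<close>

definition attached_system ::
  "enat \<Rightarrow> (nat \<Rightarrow> real list) \<Rightarrow> (nat \<Rightarrow> nat) \<Rightarrow> (real \<Rightarrow> real list) \<Rightarrow> bool" where
  "attached_system s a k P \<longleftrightarrow>
     (\<forall>i q. enat i < s \<and> q \<in> switch_interval s a i \<longrightarrow>
        P q = sort (omit (k i) (a i) @ [coord (a i) (k i) + q - switch_number a i]))"


section \<open>Determinants and exterior products\<close>

text \<open>\<open>card {j. j < i}\<close> is the (0-based) rank of the index \<open>i\<close> in the ordered type \<open>'n\<close>.\<close>

definition tuple_det :: "(real^'n::{finite,linorder}) list \<Rightarrow> real" where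
  "tuple_det xs = det (\<chi> i. xs ! card {j. j < i})"

text \<open>
  The exterior algebra of \<open>\<real>\<^sup>n\<close> is realised on \<open>real^('n set)\<close>: the basis vector \<open>axis J 1\<close>
  stands for \<open>e\<^sub>j\<^sub>1 \<and> \<dots> \<and> e\<^sub>j\<^sub>k\<close> where \<open>J = {j\<^sub>1 < \<dots> < j\<^sub>k}\<close>, so these vectors are orthonormal
  and the Euclidean structure is the library one. Its restriction to each \<open>k\<close>-th exterior power
  does not depend on the orthonormal basis of \<open>\<real>\<^sup>n\<close> used, here the standard one.
  The product is the bilinear map with \<open>e\<^sub>I \<and> e\<^sub>J = wedge_sign I J e\<^bsub>I \<union> J\<^esub>\<close> if \<open>I \<inter> J = {}\<close>
  and \<open>e\<^sub>I \<and> e\<^sub>J = 0\<close> otherwise.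
\<close>

definition wedge_sign :: "'n::linorder set \<Rightarrow> 'n set \<Rightarrow> real" where
  "wedge_sign I J = (-1) ^ card {(i, j). i \<in> I \<and> j \<in> J \<and> j < i}"

definition wedge ::
  "real^('n::{finite,linorder} set) \<Rightarrow> real^('n set) \<Rightarrow> real^('n set)" where
  "wedge \<alpha> \<beta> = (\<chi> K. \<Sum>I \<in> Pow K. wedge_sign I (K - I) * \<alpha> $ I * \<beta> $ (K - I))"

definition ext_vec :: "real^'n::{finite,linorder} \<Rightarrow> real^('n set)" where
  "ext_vec x = (\<Sum>j \<in> UNIV. x $ j *\<^sub>R axis {j} 1)"

definition wedge_list :: "(real^'n::{finite,linorder}) list \<Rightarrow> real^('n set)" where
  "wedge_list xs = foldr (\<lambda>x \<omega>. wedge (ext_vec x) \<omega>) xs (axis {} 1)"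

lemma ext_vec_axis: "ext_vec (axis j 1) = axis {j} 1"
proof -
  have "ext_vec (axis j 1) = (\<Sum>i \<in> UNIV. if i = j then axis {j} 1 else 0)"
    unfolding ext_vec_def by (rule sum.cong) (auto simp: axis_def)
  then show ?thesis by simp
qed

lemma wedge_axis:
  "wedge (axis I 1) (axis J 1) =
     (if I \<inter> J = {} then wedge_sign I J *\<^sub>R axis (I \<union> J) 1 else 0)"
proof -
  have "wedge (axis I 1) (axis J 1) $ K =
      (if I \<inter> J = {} then wedge_sign I J *\<^sub>R axis (I \<union> J) 1 else 0) $ K" for K
  proof -
    have "wedge (axis I 1) (axis J 1) $ K =
        (\<Sum>I' \<in> Pow K. if I' = I then (if K - I = J then wedge_sign I J else 0) else 0)"
      unfolding wedge_def vec_lambda_beta by (rule sum.cong[OF refl]) (simp add: axis_def)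
    also have "\<dots> = (if I \<subseteq> K \<and> K - I = J then wedge_sign I J else 0)"
      by (subst sum.delta) auto
    finally have 1: "wedge (axis I 1) (axis J 1) $ K =
        (if I \<subseteq> K \<and> K - I = J then wedge_sign I J else 0)" .
    have "I \<subseteq> K \<and> K - I = J \<longleftrightarrow> I \<inter> J = {} \<and> K = I \<union> J" by auto
    then show ?thesis unfolding 1 \<open>(_ \<and> _) \<longleftrightarrow> _\<close> by (simp add: axis_def)
  qed
  then show ?thesis by (simp add: vec_eq_iff)
qed

lemma wedge_list_axis:
  fixes js :: "'n::{finite,linorder} list"
  assumes "sorted_wrt (<) js"
  shows "wedge_list (map (\<lambda>j. axis j 1) js) = axis (set js) 1"
  using assms
proof (induction js)
  case Nil
  then show ?case by (simp add: wedge_list_def)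
next
  case (Cons j js)
  have "{(i, i'). i \<in> {j} \<and> i' \<in> set js \<and> i' < i} = {}"
    using Cons.prems by auto
  then have "wedge_sign {j} (set js) = 1"
    unfolding wedge_sign_def by (simp only:) simp
  moreover have "j \<notin> set js" using Cons.prems by auto
  moreover have "wedge_list (map (\<lambda>j. axis j 1) (j # js)) = wedge (axis {j} 1) (axis (set js) 1)"
    using Cons by (simp add: wedge_list_def ext_vec_axis)
  ultimately show ?case by (simp add: wedge_axis)
qed

end

theory Submission
  imports Defs "HOL-Combinatorics.List_Permutation"
begin

text \<open>
  For a height \<open>v\<close> occurring in \<open>a\<^sup>(\<^sup>i\<^sup>)\<close> call an integer point good at stage \<open>i\<close> if its trajectory is at
  most \<open>v + \<epsilon>\<close> at time \<open>q\<^sub>i\<close> and it is not in the span of the integer points whose trajectories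
  are then below \<open>v - \<delta>/2\<close>. The key fact is that, as long as the coordinate \<open>v\<close> is not the one
  being moved, a point that is good at stage \<open>i + 1\<close> was already good at stage \<open>i\<close>. Hence the finite
  sets of good points decrease along the life of \<open>v\<close>, and a point in their intersection, which
  depends only on that life, serves for all its stages.

  The key fact needs that the span of the points below level \<open>v\<close> changes when the moving
  coordinate crosses \<open>v\<close>. Here no form of Minkowski's second theorem is required: its role is
  played by the hypothesis, since \<open>P\<^sub>1 + \<dots> + P\<^sub>n\<close> is the time and integer determinants are at least
  one in absolute value. One completes systems realizing the minima before and after the crossing
  by points realizing minima at the crossing, and compares determinants in which
  rows are projected orthogonally to \<open>u\<close>.
\<close>

section \<open>Determinants and projection along a unit vector\<close>

text \<open>Trajectories never decrease, so a bound at a later time holds earlier; the only obstacle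
  to the key fact is that the span below a level may be larger at the earlier time. A dimension
  count excludes this while the moving coordinate stays on one side of the level; only the crossing
  needs arithmetic. A height may survive infinitely many stages, or an unbounded last one, so there
  is no final moment at which to choose its point: nested finite sets replace such a choice.

  All determinant bounds come from one expansion: a determinant is the sum over \<open>j\<close> of
  \<open>v j \<bullet> u\<close> times the determinant with row \<open>j\<close> replaced by
  \<open>u\<close>. By Hadamard's inequality each term is at most the exponential of the sum of the
  heights minus the time. On the canvas the heights sum to the time, which bounds determinants from
  above; terms of rows still low at a later time become negligible. The threshold 1/2 serves because
  \<open>det F\<close> and \<open>1 - det F\<close> cannot both be smaller than it in absolute
  value.\<close>

definition alternating_form :: "(('n::finite \<Rightarrow> 'v::real_vector) \<Rightarrow> real) \<Rightarrow> bool" where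
  "alternating_form g \<longleftrightarrow> (\<forall>v i. linear (\<lambda>x. g (v(i := x)))) \<and>
     (\<forall>v i j. i \<noteq> j \<longrightarrow> v i = v j \<longrightarrow> g v = 0)"

lemma alternating_formD:
  assumes "alternating_form g"
  shows "linear (\<lambda>x. g (v(i := x)))" "i \<noteq> j \<Longrightarrow> v i = v j \<Longrightarrow> g v = 0"
  using assms unfolding alternating_form_def by blast+

lemma alternating_form_upd_span:
  assumes g: "alternating_form g" and x: "x \<in> span (v ` (- {i}))"
  shows "g (v(i := x)) = 0"
proof (rule linear_eq_0_on_span[OF alternating_formD(1)[OF g] _ x])
  fix y assume "y \<in> v ` (- {i})"
  then obtain j where "j \<noteq> i" "y = v j" by auto
  then show "g (v(i := y)) = 0"
    using alternating_formD(2)[OF g, of i j "v(i := y)"] by auto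
qed

lemma alternating_form_add_span:
  assumes g: "alternating_form g" and x: "x \<in> span (v ` (- {i}))"
  shows "g (v(i := y + x)) = g (v(i := y))"
  using linear_add[OF alternating_formD(1)[OF g], of v i y x] alternating_form_upd_span[OF g x]
  by simp

lemma alternating_form_transpose:
  assumes g: "alternating_form g" and ij: "i \<noteq> j"
  shows "g (v \<circ> Transposition.transpose i j) = - g v"
proof -
  define h where "h x y = g (v(i := x, j := y))" for x y
  have add1: "h (x + x') y = h x y + h x' y" for x x' y
    unfolding h_def fun_upd_twist[OF ij]
    using linear_add[OF alternating_formD(1)[OF g], of "v(j := y)" i x x'] by simp
  have add2: "h x (y + y') = h x y + h x y'" for x y y'
    unfolding h_def
    using linear_add[OF alternating_formD(1)[OF g], of "v(i := x)" j y y'] by simp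
  have diag: "h x x = 0" for x
    unfolding h_def using ij alternating_formD(2)[OF g ij] by simp
  have "h (v j) (v i) = - h (v i) (v j)"
    using diag[of "v i + v j"] add1[of "v i" "v j" "v i + v j"] add2[of "v i" "v i" "v j"]
      add2[of "v j" "v i" "v j"] diag[of "v i"] diag[of "v j"] by linarith
  moreover have "v \<circ> Transposition.transpose i j = v(i := v j, j := v i)"
    using ij by (auto simp: fun_eq_iff Transposition.transpose_def)
  ultimately show ?thesis unfolding h_def by simp
qed

text \<open>Multilinearity reduces every tuple to one of standard basis vectors. A repetition gives
  0, and otherwise the tuple is a permutation of the standard one, reached by transpositions that
  only change the sign.\<close>

lemma alternating_form_eq_0I:
  fixes g :: "('n::finite \<Rightarrow> real^'n) \<Rightarrow> real"
  assumes g: "alternating_form g" and ax: "g (\<lambda>i. axis i 1) = 0"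
  shows "g v = 0"
proof -
  have perm: "g ((\<lambda>i. axis i 1) \<circ> p) = 0" if "p permutes UNIV" for p
    using finite[of UNIV] that
  proof (induction p rule: permutes_rev_induct)
    case id
    then show ?case using ax by simp
  next
    case (swap i j p)
    have "g (((\<lambda>i. axis i 1) \<circ> p) \<circ> Transposition.transpose i j) = - g ((\<lambda>i. axis i 1) \<circ> p)"
      by (rule alternating_form_transpose[OF g swap(3)])
    then show ?case using swap by (simp only: comp_assoc minus_zero)
  qed
  \<comment> \<open>Induction on the set \<open>S\<close> of rows that are not yet known to be basis
    vectors.\<close>
  have "\<forall>i. i \<notin> S \<longrightarrow> v i \<in> range (\<lambda>j. axis j 1) \<Longrightarrow> g v = 0" if "finite S" for S v
    using that
  proof (induction S arbitrary: v rule: finite_induct)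
    case empty
    then have "\<forall>i. \<exists>j. v i = axis j 1" by auto
    then obtain p where "\<forall>i. v i = axis (p i) 1" by metis
    then have p: "v = (\<lambda>i. axis i 1) \<circ> p" by (auto simp: fun_eq_iff)
    show ?case
    proof (cases "inj p")
      case True
      then have "p permutes UNIV"
        by (intro inj_imp_permutes) auto
      then show ?thesis unfolding p by (rule perm)
    next
      case False
      then obtain i j where "i \<noteq> j" "p i = p j" by (auto simp: inj_def)
      then show ?thesis
        using alternating_formD(2)[OF g, of i j v] unfolding p by (simp add: comp_def)
    qed
  next
    case (insert i S)
    have "v i \<in> span (range (\<lambda>j. axis j 1))"
    proof -
      have "v i = (\<Sum>j\<in>UNIV. v i $ j *\<^sub>R axis j 1)"
        using basis_expansion[of "v i"] by (simp add: scalar_mult_eq_scaleR)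
      also have "\<dots> \<in> span (range (\<lambda>j. axis j 1))"
        by (intro span_sum span_scale span_base) auto
      finally show ?thesis .
    qed
    then have "g (v(i := v i)) = 0"
    proof (rule linear_eq_0_on_span[OF alternating_formD(1)[OF g], rotated])
      fix y :: "real^'n" assume "y \<in> range (\<lambda>j. axis j 1)"
      then show "g (v(i := y)) = 0" using insert by auto
    qed
    then show ?case by simp
  qed
  from this[OF finite[of UNIV], of v] show ?thesis by simp
qed

definition det_rows :: "('n::finite \<Rightarrow> real^'n) \<Rightarrow> real" where
  "det_rows v = det (\<chi> i. v i)"

lemma alternating_form_det_rows: "alternating_form det_rows"
  unfolding alternating_form_def
proof (intro conjI allI impI)
  fix v :: "'n \<Rightarrow> real^'n" and i
  show "linear (\<lambda>x. det_rows (v(i := x)))"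
  proof (rule linearI)
    fix x y :: "real^'n" and c
    show "det_rows (v(i := x + y)) = det_rows (v(i := x)) + det_rows (v(i := y))"
      using det_row_add[of i "\<lambda>_. x" "\<lambda>_. y" v] by (simp add: det_rows_def fun_upd_def)
    show "det_rows (v(i := c *\<^sub>R x)) = c *\<^sub>R det_rows (v(i := x))"
      using det_row_mul[of i c "\<lambda>_. x" v] by (simp add: det_rows_def fun_upd_def scalar_mult_eq_scaleR cong: if_cong)
  qed
next
  fix v :: "'n \<Rightarrow> real^'n" and i j
  assume "i \<noteq> j" "v i = v j"
  then show "det_rows v = 0"
    using det_identical_rows[of i j "\<chi> i. v i"] by (simp add: det_rows_def row_def vec_lambda_eta)
qed

lemmas det_rows_linear = alternating_formD(1)[OF alternating_form_det_rows]

text \<open>The difference of the two sides is alternating and vanishes on the standard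
  basis.\<close>

lemma alternating_form_eq_det_rows:
  fixes g :: "('n::finite \<Rightarrow> real^'n) \<Rightarrow> real"
  assumes g: "alternating_form g"
  shows "g v = det_rows v * g (\<lambda>i. axis i 1)"
proof -
  define h where "h v = g v - det_rows v * g (\<lambda>i. axis i 1)" for v
  have "alternating_form h"
    unfolding alternating_form_def
  proof (intro conjI allI impI)
    fix v :: "'n \<Rightarrow> real^'n" and i
    show "linear (\<lambda>x. h (v(i := x)))"
      unfolding h_def
      by (intro linear_compose_sub alternating_formD(1)[OF g])
        (rule linearI, simp_all only: linear_add[OF det_rows_linear]
          linear_scale[OF det_rows_linear], simp_all add: algebra_simps)
  next
    fix v :: "'n \<Rightarrow> real^'n" and i j
    assume "i \<noteq> j" "v i = v j"
    then show "h v = 0"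
      unfolding h_def using alternating_formD(2)[OF g] alternating_formD(2)[OF alternating_form_det_rows]
      by (metis diff_0_right mult_zero_left)
  qed
  moreover have "h (\<lambda>i. axis i 1) = 0"
  proof -
    have "(\<chi> i. axis i 1) = (mat 1 :: real^'n^'n)"
      by (auto simp: vec_eq_iff mat_def axis_def)
    then show ?thesis by (simp add: h_def det_rows_def)
  qed
  ultimately have "h v = 0" by (rule alternating_form_eq_0I)
  then show ?thesis by (simp add: h_def)
qed

text \<open>Gram-Schmidt without normalization, one row at a time: subtracting from a row its
  component in the span of the rows already treated keeps the determinant and does not lengthen the
  row. \<open>S\<close> is the set of rows made orthogonal so far.\<close>

lemma hadamard_partial:
  fixes v :: "'n::finite \<Rightarrow> real^'n"
  shows "\<exists>w. det_rows w = det_rows v \<and> (\<forall>i. norm (w i) \<le> norm (v i)) \<and> (\<forall>i. i \<notin> S \<longrightarrow> w i = v i) \<and>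
     (\<forall>i\<in>S. \<forall>j\<in>S. i \<noteq> j \<longrightarrow> w i \<bullet> w j = 0)"
proof -
  have "finite S" by simp
  then show ?thesis
  proof (induction S rule: finite_induct)
    case empty
    then show ?case by (intro exI[of _ v]) auto
  next
    case (insert i S)
    then obtain w where w: "det_rows w = det_rows v" "\<forall>i. norm (w i) \<le> norm (v i)"
      "\<forall>i. i \<notin> S \<longrightarrow> w i = v i" "\<forall>i\<in>S. \<forall>j\<in>S. i \<noteq> j \<longrightarrow> w i \<bullet> w j = 0"
      by blast
    obtain y z where y: "y \<in> span (w ` S)" and z: "\<And>x. x \<in> span (w ` S) \<Longrightarrow> orthogonal z x"
      and yz: "w i = y + z"
      using orthogonal_subspace_decomp_exists[of "w ` S" "w i"] by metis
    have y': "y \<in> span (w ` (- {i}))"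
      using y insert.hyps span_mono[of "w ` S" "w ` (- {i})"] by blast
    have "det_rows (w(i := z)) = det_rows (w(i := z + y))"
      using alternating_form_add_span[OF alternating_form_det_rows y', of z] by simp
    also have "w(i := z + y) = w" using yz by (auto simp: add.commute)
    also have "det_rows w = det_rows v" by (rule w(1))
    finally have 1: "det_rows (w(i := z)) = det_rows v" .
    have "(norm (w i))\<^sup>2 = (norm z)\<^sup>2 + (norm y)\<^sup>2"
      using z[OF y] norm_add_Pythagorean[of z y] by (simp add: yz add.commute)
    then have "norm z \<le> norm (w i)" by (metis le_add_same_cancel1 norm_ge_zero power2_le_imp_le zero_le_power2)
    then have 2: "\<forall>j. norm ((w(i := z)) j) \<le> norm (v j)"
      using w(2) by (auto intro: order_trans)
    have 3: "z \<bullet> w j = 0" "w j \<bullet> z = 0" if "j \<in> S" for j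
      using z[of "w j"] that span_base[of "w j" "w ` S"] by (auto simp: orthogonal_def inner_commute)
    have "\<forall>j. j \<notin> insert i S \<longrightarrow> (w(i := z)) j = v j"
      "\<forall>j\<in>insert i S. \<forall>k\<in>insert i S. j \<noteq> k \<longrightarrow> (w(i := z)) j \<bullet> (w(i := z)) k = 0"
      using 3 w(3,4) insert.hyps by auto
    with 1 2 show ?case by blast
  qed
qed

text \<open>For orthogonal rows the Gram matrix is diagonal, with the squared lengths on the
  diagonal.\<close>

lemma hadamard:
  fixes v :: "'n::finite \<Rightarrow> real^'n"
  shows "\<bar>det_rows v\<bar> \<le> (\<Prod>i\<in>UNIV. norm (v i))"
proof -
  obtain w where w: "det_rows w = det_rows v" "\<forall>i. norm (w i) \<le> norm (v i)"
    "\<forall>i j. i \<noteq> j \<longrightarrow> w i \<bullet> w j = 0"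
    using hadamard_partial[of v UNIV] by auto
  define M where "M = (\<chi> i. w i)"
  have entry: "(M ** transpose M) $ i $ j = w i \<bullet> w j" for i j
    by (simp add: M_def matrix_matrix_mult_def transpose_def inner_vec_def)
  have "(det M)\<^sup>2 = det (M ** transpose M)"
    by (simp add: det_mul power2_eq_square)
  also have "\<dots> = (\<Prod>i\<in>UNIV. (M ** transpose M) $ i $ i)"
    by (rule det_diagonal) (simp add: entry w(3))
  also have "\<dots> = (\<Prod>i\<in>UNIV. norm (w i))\<^sup>2"
    by (simp add: entry power2_norm_eq_inner[symmetric] prod_power_distrib[symmetric])
  finally have "\<bar>det M\<bar> = \<bar>\<Prod>i\<in>UNIV. norm (w i)\<bar>"
    by (simp only: power2_eq_iff abs_eq_iff)
  also have "\<dots> = (\<Prod>i\<in>UNIV. norm (w i))"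
    by (simp add: prod_nonneg)
  also have "\<dots> \<le> (\<Prod>i\<in>UNIV. norm (v i))"
    using w(2) by (intro prod_mono) auto
  finally show ?thesis using w(1) by (simp add: M_def det_rows_def)
qed

section \<open>Projection orthogonal to a unit vector and expansion along it\<close>

definition perp :: "'a::real_inner \<Rightarrow> 'a \<Rightarrow> 'a" where
  "perp u x = x - (x \<bullet> u) *\<^sub>R u"

lemma perp_inner: "norm u = 1 \<Longrightarrow> perp u x \<bullet> u = 0"
  by (simp add: perp_def inner_diff_left dot_square_norm)

lemma linear_perp: "linear (perp u)"
  unfolding perp_def by (rule linearI) (auto simp: inner_add_left algebra_simps)

text \<open>Once \<open>u\<close> is itself a row, multiples of \<open>u\<close> may be subtracted
  from every other row.\<close>

lemma det_rows_perp_upd: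
  fixes v :: "'n::finite \<Rightarrow> real^'n"
  shows "det_rows ((\<lambda>i. if i \<in> S then v i else perp u (v i))(j := u)) = det_rows (v(j := u))"
proof -
  define w where "w T = (\<lambda>i. if i \<in> T then perp u (v i) else v i)(j := u)" for T
  have key: "finite T \<Longrightarrow> det_rows (w T) = det_rows (v(j := u))" for T :: "'n set"
  proof (induction T rule: finite_induct)
    case empty
    then show ?case by (simp add: w_def)
  next
    case (insert i T)
    show ?case
    proof (cases "i = j")
      case True
      then have "w (insert i T) = w T" by (auto simp: w_def fun_eq_iff)
      then show ?thesis using insert by simp
    next
      case False
      have "(w T) j = u" by (simp add: w_def)
      then have *: "- ((v i \<bullet> u) *\<^sub>R u) \<in> span (w T ` (- {i}))"
        using False by (intro span_neg span_scale span_base) auto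
      have "w (insert i T) = (w T)(i := v i + - ((v i \<bullet> u) *\<^sub>R u))"
        using False by (auto simp: w_def fun_eq_iff perp_def)
      then have "det_rows (w (insert i T)) = det_rows ((w T)(i := v i))"
        using alternating_form_add_span[OF alternating_form_det_rows *, of "v i"] by simp
      also have "(w T)(i := v i) = w T"
        using False insert.hyps by (auto simp: w_def fun_eq_iff)
      finally show ?thesis using insert.IH by simp
    qed
  qed
  have eq: "(\<lambda>i. if i \<in> S then v i else perp u (v i)) =
      (\<lambda>i. if i \<in> - S then perp u (v i) else v i)" by auto
  show ?thesis unfolding eq by (rule key[unfolded w_def, OF finite])
qed

text \<open>Rows are restored one at a time: the missing part of row \<open>j\<close> is
  \<open>(v j \<bullet> u) *\<^sub>R u\<close>, and it contributes exactly the term of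
  \<open>j\<close>. For \<open>S = UNIV\<close> this is the expansion of the determinant along
  \<open>u\<close>; for smaller \<open>S\<close> the partial sum is the determinant with the other
  rows projected.\<close>

lemma det_rows_perp:
  fixes v :: "'n::finite \<Rightarrow> real^'n"
  assumes u: "norm u = 1"
  shows "det_rows (\<lambda>i. if i \<in> S then v i else perp u (v i)) =
    (\<Sum>j\<in>S. (v j \<bullet> u) * det_rows (v(j := u)))"
proof -
  have "finite S" by simp
  then show ?thesis
  proof (induction S rule: finite_induct)
    case empty
    \<comment> \<open>With all rows orthogonal to the nonzero vector \<open>u\<close> the matrix is
      singular.\<close>
    have "(\<chi> i. perp u (v i)) *v u = 0"
      using perp_inner[OF u] by (simp add: vec_eq_iff matrix_vector_mult_def inner_vec_def)
    moreover have "u \<noteq> 0" using u by auto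
    ultimately have "\<not> invertible (\<chi> i. perp u (v i))"
      using matrix_left_invertible_ker invertible_left_inverse by blast
    then show ?case by (simp add: invertible_det_nz det_rows_def)
  next
    case (insert j S)
    define w where "w = (\<lambda>i. if i \<in> S then v i else perp u (v i))"
    have j: "w(j := perp u (v j)) = w" using insert.hyps by (auto simp: w_def)
    have "(\<lambda>i. if i \<in> insert j S then v i else perp u (v i)) = w(j := perp u (v j) + (v j \<bullet> u) *\<^sub>R u)"
      by (auto simp: fun_eq_iff w_def perp_def)
    then have "det_rows (\<lambda>i. if i \<in> insert j S then v i else perp u (v i)) =
        det_rows (w(j := perp u (v j))) + (v j \<bullet> u) * det_rows (w(j := u))"
      by (simp only: linear_add[OF det_rows_linear] linear_scale[OF det_rows_linear]) simp
    also have "det_rows (w(j := u)) = det_rows (v(j := u))"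
      unfolding w_def by (rule det_rows_perp_upd)
    also have "w(j := perp u (v j)) = w" by (rule j)
    also have "det_rows w = (\<Sum>j\<in>S. (v j \<bullet> u) * det_rows (v(j := u)))"
      using insert.IH unfolding w_def .
    finally show ?case using insert.hyps by (simp del: fun_upd_apply)
  qed
qed

lemma det_rows_upd_le:
  fixes v :: "'n::finite \<Rightarrow> real^'n"
  assumes "norm u = 1"
  shows "\<bar>det_rows (v(j := u))\<bar> \<le> (\<Prod>i\<in>-{j}. norm (v i))"
proof -
  have "\<bar>det_rows (v(j := u))\<bar> \<le> (\<Prod>i\<in>UNIV. norm ((v(j := u)) i))"
    by (rule hadamard)
  also have "\<dots> = (\<Prod>i\<in>-{j}. norm (v i))"
  proof -
    have "(\<Prod>i\<in>UNIV. norm ((v(j := u)) i)) = norm u * (\<Prod>i\<in>-{j}. norm ((v(j := u)) i))"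
      by (simp only: prod.remove[OF finite UNIV_I, of _ j] Compl_eq_Diff_UNIV fun_upd_same)
    also have "(\<Prod>i\<in>-{j}. norm ((v(j := u)) i)) = (\<Prod>i\<in>-{j}. norm (v i))"
      by (rule prod.cong) auto
    finally show ?thesis using assms by simp
  qed
  finally show ?thesis .
qed

text \<open>Only row \<open>j\<close> has to be nearly orthogonal to \<open>u\<close>; the other
  rows enter through their norms, by Hadamard's inequality.\<close>

lemma det_rows_term_le:
  fixes v :: "'n::finite \<Rightarrow> real^'n"
  assumes u: "norm u = 1" and nv: "\<And>i. norm (v i) \<le> exp (\<alpha> i)"
    and ju: "\<bar>v j \<bullet> u\<bar> \<le> exp (\<alpha> j - t)"
  shows "\<bar>(v j \<bullet> u) * det_rows (v(j := u))\<bar> \<le> exp ((\<Sum>i\<in>UNIV. \<alpha> i) - t)"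
proof -
  have "\<bar>det_rows (v(j := u))\<bar> \<le> (\<Prod>i\<in>-{j}. norm (v i))"
    by (rule det_rows_upd_le[OF u])
  also have "\<dots> \<le> (\<Prod>i\<in>-{j}. exp (\<alpha> i))"
    using nv by (intro prod_mono) auto
  also have "\<dots> = exp (\<Sum>i\<in>-{j}. \<alpha> i)" by (simp add: exp_sum)
  finally have "\<bar>(v j \<bullet> u) * det_rows (v(j := u))\<bar> \<le> exp (\<alpha> j - t) * exp (\<Sum>i\<in>-{j}. \<alpha> i)"
    unfolding abs_mult by (rule mult_mono[OF ju]) auto
  also have "\<dots> = exp ((\<Sum>i\<in>UNIV. \<alpha> i) - t)"
  proof -
    have "(\<Sum>i\<in>UNIV. \<alpha> i) = \<alpha> j + (\<Sum>i\<in>-{j}. \<alpha> i)"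
      by (simp only: sum.remove[OF finite UNIV_I, of _ j] Compl_eq_Diff_UNIV)
    then have "\<alpha> j - t + (\<Sum>i\<in>-{j}. \<alpha> i) = (\<Sum>i\<in>UNIV. \<alpha> i) - t" by linarith
    then show ?thesis by (simp only: mult_exp_exp)
  qed
  finally show ?thesis .
qed

lemma det_rows_linear_image:
  fixes v :: "'n::finite \<Rightarrow> real^'n"
  assumes "linear F"
  shows "det_rows (\<lambda>i. F (v i)) = det (matrix F) * det_rows v"
proof -
  have "((\<chi> i. v i) ** transpose (matrix F)) $ i $ j = (matrix F *v v i) $ j" for i j
    by (simp only: matrix_matrix_mult_def transpose_def matrix_vector_mult_def vec_lambda_beta)
      (rule sum.cong, simp_all)
  moreover have "matrix F *v x = F x" for x
    using matrix_vector_mul(2)[OF assms] by (rule fun_cong)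
  ultimately have "(\<chi> i. F (v i)) = (\<chi> i. v i) ** transpose (matrix F)"
    by (simp only: vec_eq_iff vec_lambda_beta simp_thms)
  then show ?thesis by (simp add: det_rows_def det_mul)
qed

lemma det_rows_integer:
  fixes v :: "'n::finite \<Rightarrow> real^'n"
  assumes int: "\<And>i. v i \<in> integer_points" and sp: "span (range v) = UNIV"
  shows "1 \<le> \<bar>det_rows v\<bar>"
proof -
  have "det_rows v \<in> \<int>"
    unfolding det_rows_def det_def using int by (auto simp: integer_points_def intro!: Ints_sum Ints_mult Ints_prod)
  moreover have "rows (\<chi> i. v i) = range v"
    unfolding rows_def row_def by (simp add: vec_lambda_eta full_SetCompr_eq)
  then have "invertible (\<chi> i. v i)"
    using sp matrix_left_invertible_span_rows[of "\<chi> i. v i"] by (simp add: invertible_left_inverse)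
  then have "det_rows v \<noteq> 0" by (simp add: invertible_det_nz det_rows_def)
  ultimately show ?thesis by (rule Ints_nonzero_abs_ge1)
qed

lemma sum_abs_less_half:
  fixes f :: "'n::finite \<Rightarrow> real"
  assumes "\<And>j. j \<in> S \<Longrightarrow> \<bar>f j\<bar> \<le> b" and "0 \<le> b" and "real CARD('n) * b < 1 / 2"
  shows "\<bar>\<Sum>j\<in>S. f j\<bar> < 1 / 2"
proof -
  have "\<bar>\<Sum>j\<in>S. f j\<bar> \<le> (\<Sum>j\<in>S. \<bar>f j\<bar>)" by (rule sum_abs)
  also have "\<dots> \<le> real (card S) * b" using assms(1) by (rule sum_bounded_above)
  also have "\<dots> \<le> real CARD('n) * b"
    using assms(2) by (intro mult_right_mono) (auto simp: card_mono)
  finally show ?thesis using assms(3) by simp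
qed

text \<open>The two ratios \<open>det (\<pi> w, y) / det (w, y)\<close> and \<open>det (\<pi> z, y) / det (z, y)\<close> both equal the
  determinant of the linear map that is \<open>\<pi>\<close> on the common span of the two systems and the
  identity on the \<open>y\<close>s, but the bounds force the first below \<open>1/2\<close> and the second above.\<close>

lemma no_common_span:
  fixes w z y :: "'n::finite \<Rightarrow> real^'n" and \<alpha> \<beta> \<gamma> :: "'n \<Rightarrow> real"
  assumes u: "norm u = 1"
    and int: "\<And>i. w i \<in> integer_points" "\<And>i. z i \<in> integer_points" "\<And>i. y i \<in> integer_points"
    and eq: "span (w ` S) = span (z ` S)"
    and full: "span (w ` S \<union> y ` (- S)) = UNIV"
    and ind: "independent (w ` S \<union> y ` (- S))" "w ` S \<inter> y ` (- S) = {}"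
    and w: "\<And>i. i \<in> S \<Longrightarrow> norm (w i) \<le> exp (\<alpha> i)"
    and z: "\<And>i. i \<in> S \<Longrightarrow> norm (z i) \<le> exp (\<beta> i)" "\<And>i. i \<in> S \<Longrightarrow> \<bar>z i \<bullet> u\<bar> \<le> exp (\<beta> i - t)"
    and y: "\<And>i. i \<notin> S \<Longrightarrow> norm (y i) \<le> exp (\<gamma> i)" "\<And>i. i \<notin> S \<Longrightarrow> \<bar>y i \<bullet> u\<bar> \<le> exp (\<gamma> i - t0)"
    and b: "(\<Sum>i\<in>S. \<alpha> i) + (\<Sum>i\<in>-S. \<gamma> i) - t0 \<le> - e" "(\<Sum>i\<in>S. \<beta> i) + (\<Sum>i\<in>-S. \<gamma> i) - t \<le> - e"
    and e: "real CARD('n) * exp (- e) < 1 / 2"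
  shows False
proof -
  define A where "A i = (if i \<in> S then w i else y i)" for i
  define B where "B i = (if i \<in> S then z i else y i)" for i
  define F0 where "F0 x = (if x \<in> w ` S then perp u x else x)" for x
  obtain F where F: "linear F" "\<forall>x\<in>w ` S \<union> y ` (- S). F x = F0 x"
    using linear_independent_extend[OF ind(1), of F0] by blast
  have Fw: "F x = perp u x" if "x \<in> span (w ` S)" for x
    using F(2) by (intro linear_eq_on_span[OF F(1) linear_perp _ that]) (simp add: F0_def)
  have Fy: "F (y i) = y i" if "i \<notin> S" for i
    using F(2) that ind(2) by (auto simp: F0_def)
  have split: "range f = f ` S \<union> f ` (- S)" for f :: "'n \<Rightarrow> real^'n" by auto
  have "A ` S = w ` S" "A ` (- S) = y ` (- S)" "B ` S = z ` S" "B ` (- S) = y ` (- S)"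
    by (rule image_cong; simp add: A_def B_def)+
  then have rA: "range A = w ` S \<union> y ` (- S)" and rB: "range B = z ` S \<union> y ` (- S)"
    by (simp_all only: split)
  have spA: "span (range A) = UNIV" using full by (simp add: rA)
  have "w ` S \<union> y ` (- S) \<subseteq> span (range B)"
  proof -
    have "w ` S \<subseteq> span (z ` S)" using span_superset[of "w ` S"] by (simp only: eq)
    then show ?thesis
      unfolding rB using span_superset[of "z ` S \<union> y ` (- S)"] span_mono[of "z ` S" "z ` S \<union> y ` (- S)"]
      by blast
  qed
  then have spB: "span (range B) = UNIV"
    using full span_minimal[of "w ` S \<union> y ` (- S)" "span (range B)"] by (auto simp: subspace_span)
  have dA: "1 \<le> \<bar>det_rows A\<bar>" by (rule det_rows_integer[OF _ spA]) (auto simp: A_def int)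
  have dB: "1 \<le> \<bar>det_rows B\<bar>" by (rule det_rows_integer[OF _ spB]) (auto simp: B_def int)
  have FA: "(\<lambda>i. F (A i)) = (\<lambda>i. if i \<in> - S then A i else perp u (A i))"
    using Fw Fy by (auto simp: A_def span_base fun_eq_iff)
  have zs: "z i \<in> span (w ` S)" if "i \<in> S" for i
    using that unfolding eq by (auto intro: span_base)
  have FB: "(\<lambda>i. F (B i)) = (\<lambda>i. if i \<in> - S then B i else perp u (B i))"
    using Fw Fy zs by (auto simp: B_def fun_eq_iff)
  have "det (matrix F) * det_rows A = (\<Sum>j\<in>-S. (A j \<bullet> u) * det_rows (A(j := u)))"
    using det_rows_linear_image[OF F(1), of A] det_rows_perp[OF u, of "- S" A] unfolding FA by simp
  \<comment> \<open>These \<open>j\<close> carry rows of \<open>y\<close>, so the rows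
    \<open>w\<close> contribute their norms only.\<close>
  moreover have "\<bar>\<Sum>j\<in>-S. (A j \<bullet> u) * det_rows (A(j := u))\<bar> < 1 / 2"
  proof (rule sum_abs_less_half[OF _ _ e])
    fix j assume "j \<in> - S"
    then have "\<bar>(A j \<bullet> u) * det_rows (A(j := u))\<bar> \<le>
        exp ((\<Sum>i\<in>UNIV. if i \<in> S then \<alpha> i else \<gamma> i) - t0)"
      using w y by (intro det_rows_term_le[OF u]) (auto simp: A_def)
    also have "(\<Sum>i\<in>UNIV. if i \<in> S then \<alpha> i else \<gamma> i) = (\<Sum>i\<in>S. \<alpha> i) + (\<Sum>i\<in>-S. \<gamma> i)"
      by (simp add: sum.If_cases)
    also have "exp (\<dots> - t0) \<le> exp (- e)" using b(1) by simp
    finally show "\<bar>(A j \<bullet> u) * det_rows (A(j := u))\<bar> \<le> exp (- e)" .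
  qed simp
  ultimately have 1: "\<bar>det (matrix F)\<bar> < 1 / 2"
    using dA mult_left_mono[of 1 "\<bar>det_rows A\<bar>" "\<bar>det (matrix F)\<bar>"] by (simp add: abs_mult)
  \<comment> \<open>In the full expansion of \<open>det_rows B\<close> the part over
    \<open>- S\<close> is \<open>det (matrix F) * det_rows B\<close>, so the part over
    \<open>S\<close> measures \<open>1 - det (matrix F)\<close>.\<close>
  have "det_rows B = (\<Sum>j\<in>UNIV. (B j \<bullet> u) * det_rows (B(j := u)))"
    using det_rows_perp[OF u, of UNIV B] by simp
  also have "\<dots> = (\<Sum>j\<in>S. (B j \<bullet> u) * det_rows (B(j := u))) +
      (\<Sum>j\<in>-S. (B j \<bullet> u) * det_rows (B(j := u)))"
    by (simp only: sum.subset_diff[OF subset_UNIV finite, of _ S] Compl_eq_Diff_UNIV)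
  also have "(\<Sum>j\<in>-S. (B j \<bullet> u) * det_rows (B(j := u))) = det (matrix F) * det_rows B"
    using det_rows_linear_image[OF F(1), of B] det_rows_perp[OF u, of "- S" B] unfolding FB
    by linarith
  finally have "(1 - det (matrix F)) * det_rows B = (\<Sum>j\<in>S. (B j \<bullet> u) * det_rows (B(j := u)))"
    unfolding left_diff_distrib mult_1_left by linarith
  moreover have "\<bar>\<Sum>j\<in>S. (B j \<bullet> u) * det_rows (B(j := u))\<bar> < 1 / 2"
  proof (rule sum_abs_less_half[OF _ _ e])
    fix j assume "j \<in> S"
    then have "\<bar>(B j \<bullet> u) * det_rows (B(j := u))\<bar> \<le>
        exp ((\<Sum>i\<in>UNIV. if i \<in> S then \<beta> i else \<gamma> i) - t)"
      using z y by (intro det_rows_term_le[OF u]) (auto simp: B_def)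
    also have "(\<Sum>i\<in>UNIV. if i \<in> S then \<beta> i else \<gamma> i) = (\<Sum>i\<in>S. \<beta> i) + (\<Sum>i\<in>-S. \<gamma> i)"
      by (simp add: sum.If_cases)
    also have "exp (\<dots> - t) \<le> exp (- e)" using b(2) by simp
    finally show "\<bar>(B j \<bullet> u) * det_rows (B(j := u))\<bar> \<le> exp (- e)" .
  qed simp
  ultimately have "\<bar>(1 - det (matrix F)) * det_rows B\<bar> < 1 / 2" by (simp only:)
  then have "\<bar>1 - det (matrix F)\<bar> < 1 / 2"
    using dB mult_left_mono[of 1 "\<bar>det_rows B\<bar>" "\<bar>1 - det (matrix F)\<bar>"]
    unfolding abs_mult by simp
  with 1 show False by linarith
qed


section \<open>Exterior products\<close>

lemma wedge_add_right: "wedge \<alpha> (\<beta> + \<gamma>) = wedge \<alpha> \<beta> + wedge \<alpha> \<gamma>"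
  by (simp add: wedge_def vec_eq_iff algebra_simps sum.distrib)

lemma wedge_scale_right: "wedge \<alpha> (c *\<^sub>R \<beta>) = c *\<^sub>R wedge \<alpha> \<beta>"
  by (simp add: wedge_def vec_eq_iff sum_distrib_left algebra_simps)

lemma wedge_add_left: "wedge (\<alpha> + \<beta>) \<gamma> = wedge \<alpha> \<gamma> + wedge \<beta> \<gamma>"
  by (simp add: wedge_def vec_eq_iff algebra_simps sum.distrib)

lemma wedge_scale_left: "wedge (c *\<^sub>R \<alpha>) \<gamma> = c *\<^sub>R wedge \<alpha> \<gamma>"
  by (simp add: wedge_def vec_eq_iff sum_distrib_left algebra_simps)

lemma linear_wedge_right: "linear (wedge \<alpha>)"
  by (rule linearI) (rule wedge_add_right wedge_scale_right)+

lemma ext_vec_nth: "ext_vec x $ I = (\<Sum>j\<in>UNIV. if I = {j} then x $ j else 0)"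
proof -
  have "ext_vec x $ I = (\<Sum>j\<in>UNIV. x $ j * axis {j} 1 $ I)"
    by (simp add: ext_vec_def)
  also have "\<dots> = (\<Sum>j\<in>UNIV. if I = {j} then x $ j else 0)"
    by (rule sum.cong) (auto simp: axis_def)
  finally show ?thesis .
qed

lemma ext_vec_singleton: "ext_vec x $ {j} = x $ j"
  by (simp add: ext_vec_nth)

lemma ext_vec_add: "ext_vec (x + y) = ext_vec x + ext_vec y"
  by (simp add: ext_vec_def scaleR_add_left sum.distrib)

lemma ext_vec_scale: "ext_vec (c *\<^sub>R x) = c *\<^sub>R ext_vec x"
  by (simp add: ext_vec_def scaleR_right.sum)

text \<open>For \<open>j\<close> in \<open>K\<close>, the sign in the product of the basis vectors
  of \<open>{j}\<close> and \<open>K - {j}\<close>, the same as that of a face in the simplicial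
  boundary.\<close>

definition vertex_sign :: "'n::linorder \<Rightarrow> 'n set \<Rightarrow> real" where
  "vertex_sign j K = (-1) ^ card {i \<in> K. i < j}"

lemma wedge_ext_vec_nth:
  "wedge (ext_vec x) \<beta> $ K = (\<Sum>j\<in>K. vertex_sign j K * x $ j * \<beta> $ (K - {j}))"
proof -
  have "wedge (ext_vec x) \<beta> $ K =
      (\<Sum>I\<in>Pow K. wedge_sign I (K - I) * ext_vec x $ I * \<beta> $ (K - I))"
    by (simp add: wedge_def)
  also have "\<dots> = (\<Sum>I\<in>(\<lambda>j. {j}) ` K. wedge_sign I (K - I) * ext_vec x $ I * \<beta> $ (K - I))"
  proof (rule sum.mono_neutral_right)
    show "\<forall>I\<in>Pow K - (\<lambda>j. {j}) ` K. wedge_sign I (K - I) * ext_vec x $ I * \<beta> $ (K - I) = 0"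
    proof
      fix I assume "I \<in> Pow K - (\<lambda>j. {j}) ` K"
      then have "I \<noteq> {j}" for j by auto
      then have "ext_vec x $ I = 0" by (simp add: ext_vec_nth)
      then show "wedge_sign I (K - I) * ext_vec x $ I * \<beta> $ (K - I) = 0" by simp
    qed
  qed auto
  also have "\<dots> = (\<Sum>j\<in>K. wedge_sign {j} (K - {j}) * x $ j * \<beta> $ (K - {j}))"
    by (subst sum.reindex) (auto simp: ext_vec_singleton)
  also have "\<dots> = (\<Sum>j\<in>K. vertex_sign j K * x $ j * \<beta> $ (K - {j}))"
  proof (rule sum.cong[OF refl])
    fix j
    have "{(i, i'). i \<in> {j} \<and> i' \<in> K - {j} \<and> i' < i} = Pair j ` {i \<in> K. i < j}" by auto
    then have "wedge_sign {j} (K - {j}) = vertex_sign j K"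
      unfolding wedge_sign_def vertex_sign_def by (simp add: card_image inj_on_def)
    then show "wedge_sign {j} (K - {j}) * x $ j * \<beta> $ (K - {j}) = vertex_sign j K * x $ j * \<beta> $ (K - {j})"
      by simp
  qed
  finally show ?thesis .
qed

text \<open>Removing the smaller element lowers the rank of the larger by one, while removing the
  larger leaves the rank of the smaller unchanged.\<close>

lemma vertex_sign_swap:
  fixes i j :: "'n::{finite,linorder}"
  assumes "i \<in> K" "j \<in> K" "i < j"
  shows "vertex_sign j K * vertex_sign i (K - {j}) = - (vertex_sign i K * vertex_sign j (K - {i}))"
proof -
  have "{m \<in> K - {j}. m < i} = {m \<in> K. m < i}" using assms by auto
  moreover have "{m \<in> K. m < j} = insert i {m \<in> K - {i}. m < j}" using assms by auto
  then have "card {m \<in> K. m < j} = Suc (card {m \<in> K - {i}. m < j})" by simp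
  ultimately show ?thesis unfolding vertex_sign_def by simp
qed

text \<open>Each coefficient is a sum over ordered pairs of distinct elements of \<open>K\<close>,
  and exchanging the two elements reverses the sign of a term, so the sum equals its own
  negative.\<close>

lemma wedge_ext_vec_self: "wedge (ext_vec x) (wedge (ext_vec x) \<beta>) = 0"
proof -
  have "wedge (ext_vec x) (wedge (ext_vec x) \<beta>) $ K = 0" for K
  proof -
    define f where "f j i = vertex_sign j K * vertex_sign i (K - {j}) * (x $ j * x $ i) * \<beta> $ (K - {i, j})"
      for i j
    have anti: "f j i = - f i j" if "i \<in> K" "j \<in> K" "i \<noteq> j" for i j
    proof (cases "i < j")
      case True
      then show ?thesis
        unfolding f_def using vertex_sign_swap[OF that(1,2) True]
        by (simp add: insert_commute mult.commute)
    next
      case False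
      then have "j < i" using that by auto
      then show ?thesis
        unfolding f_def using vertex_sign_swap[OF that(2,1)]
        by (simp add: insert_commute mult.commute)
    qed
    define S where "S = (\<Sum>(j, i) \<in> (SIGMA j:K. K - {j}). f j i)"
    have *: "K - {j} - {i} = K - {i, j}" for i j by auto
    have "wedge (ext_vec x) (wedge (ext_vec x) \<beta>) $ K = (\<Sum>j\<in>K. \<Sum>i\<in>K - {j}. f j i)"
      by (simp add: wedge_ext_vec_nth sum_distrib_left f_def mult.assoc * mult.left_commute)
    also have "\<dots> = S" unfolding S_def by (subst sum.Sigma) auto
    also have "S = (\<Sum>(j, i) \<in> (SIGMA j:K. K - {j}). - f j i)"
      unfolding S_def
      by (rule sum.reindex_bij_witness[of _ prod.swap prod.swap]) (auto, metis anti minus_minus)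
    then have "S = - S" unfolding S_def by (simp add: case_prod_unfold sum_negf)
    then have "S = 0" by simp
    finally show ?thesis .
  qed
  then show ?thesis by (simp add: vec_eq_iff)
qed

lemma wedge_ext_vec_commute:
  "wedge (ext_vec x) (wedge (ext_vec y) \<beta>) = - wedge (ext_vec y) (wedge (ext_vec x) \<beta>)"
proof -
  have "wedge (ext_vec (x + y)) (wedge (ext_vec (x + y)) \<beta>) = 0" by (rule wedge_ext_vec_self)
  then have "wedge (ext_vec x) (wedge (ext_vec y) \<beta>) + wedge (ext_vec y) (wedge (ext_vec x) \<beta>) = 0"
    by (simp add: ext_vec_add wedge_add_left wedge_add_right wedge_ext_vec_self add.commute)
  then show ?thesis by (simp add: eq_neg_iff_add_eq_0)
qed

lemma wedge_list_Cons: "wedge_list (x # xs) = wedge (ext_vec x) (wedge_list xs)"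
  by (simp add: wedge_list_def)

lemma wedge_list_mem: "x \<in> set xs \<Longrightarrow> wedge (ext_vec x) (wedge_list xs) = 0"
proof (induction xs)
  case (Cons y ys)
  show ?case
  proof (cases "y = x")
    case True
    then show ?thesis by (simp add: wedge_list_Cons wedge_ext_vec_self)
  next
    case False
    then show ?thesis
      using Cons linear_0[OF linear_wedge_right]
      by (simp add: wedge_list_Cons wedge_ext_vec_commute[of x])
  qed
qed simp

lemma wedge_list_not_distinct: "\<not> distinct xs \<Longrightarrow> wedge_list xs = 0"
  by (induction xs) (auto simp: wedge_list_Cons wedge_list_mem linear_0[OF linear_wedge_right])

lemma wedge_list_move: "wedge_list (xs @ y # ys) = (- 1) ^ length xs *\<^sub>R wedge_list (y # xs @ ys)"
proof (induction xs)
  case (Cons x xs)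
  have "wedge_list ((x # xs) @ y # ys) =
      (- 1) ^ length xs *\<^sub>R wedge (ext_vec x) (wedge (ext_vec y) (wedge_list (xs @ ys)))"
    using Cons by (simp add: wedge_list_Cons wedge_scale_right)
  then show ?case by (simp add: wedge_list_Cons wedge_ext_vec_commute[of x])
qed simp

lemma linear_wedge_list_upd:
  "linear (\<lambda>x. wedge_list (xs[k := x]))" if "k < length xs"
  using that
proof (induction xs arbitrary: k)
  case (Cons y ys)
  show ?case
  proof (cases k)
    case 0
    show ?thesis unfolding 0
      by (rule linearI) (simp_all add: wedge_list_Cons ext_vec_add ext_vec_scale wedge_add_left wedge_scale_left)
  next
    case (Suc m)
    then have "linear (\<lambda>x. wedge_list (ys[m := x]))" using Cons by simp
    from linear_compose[OF this linear_wedge_right] show ?thesis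
      unfolding Suc by (simp add: wedge_list_Cons comp_def)
  qed
qed simp

section \<open>Ranks of indices: from rows indexed by the type to list positions\<close>

definition pos :: "'n::{finite,linorder} \<Rightarrow> nat" where
  "pos i = card {j. j < i}"

lemma pos_less: "pos i < pos j" if "i < j"
  unfolding pos_def using that by (intro psubset_card_mono) auto

lemma bij_betw_pos: "bij_betw (pos :: 'n::{finite,linorder} \<Rightarrow> nat) UNIV {..<CARD('n)}"
proof -
  have inj: "inj (pos :: 'n \<Rightarrow> nat)"
    by (rule injI) (metis pos_less less_irrefl linorder_cases)
  have "pos i < CARD('n)" for i :: 'n
    unfolding pos_def by (rule psubset_card_mono) auto
  then have "range (pos :: 'n \<Rightarrow> nat) \<subseteq> {..<CARD('n)}" by auto
  moreover have "card (range (pos :: 'n \<Rightarrow> nat)) = CARD('n)" using inj by (rule card_image)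
  ultimately have "range (pos :: 'n \<Rightarrow> nat) = {..<CARD('n)}"
    by (simp add: card_subset_eq)
  with inj show ?thesis by (simp add: bij_betw_def)
qed

lemma pos_lt_CARD: "pos (i :: 'n::{finite,linorder}) < CARD('n)"
  using bij_betw_pos by (auto simp: bij_betw_def)

definition at_pos :: "nat \<Rightarrow> 'n::{finite,linorder}" where
  "at_pos = inv_into UNIV pos"

lemma at_pos_pos [simp]: "at_pos (pos i) = (i :: 'n::{finite,linorder})"
  using bij_betw_pos unfolding at_pos_def by (metis bij_betw_inv_into_left UNIV_I)

lemma pos_at_pos [simp]: "m < CARD('n) \<Longrightarrow> pos (at_pos m :: 'n::{finite,linorder}) = m"
  using bij_betw_pos unfolding at_pos_def by (metis bij_betw_inv_into_right lessThan_iff)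

lemma tuple_det_eq: "tuple_det xs = det_rows (\<lambda>i. xs ! pos i)"
  by (simp add: tuple_det_def det_rows_def pos_def)

text \<open>As a function of the entries the top coefficient is an alternating form, hence a
  multiple of the determinant; the standard basis shows that the factor is 1.\<close>

lemma wedge_list_top:
  fixes xs :: "(real^'n::{finite,linorder}) list"
  assumes len: "length xs = CARD('n)"
  shows "\<bar>wedge_list xs $ UNIV\<bar> = \<bar>tuple_det xs\<bar>"
proof -
  define tup where "tup v = map (\<lambda>m. v (at_pos m)) [0..<CARD('n)]" for v :: "'n \<Rightarrow> (real, 'n) vec"
  define g where "g v = wedge_list (tup v) $ UNIV" for v :: "'n \<Rightarrow> (real, 'n) vec"
  have upd: "tup (v(i := x)) = (tup v)[pos i := x]" for v i x
    unfolding tup_def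
    by (rule nth_equalityI) (auto simp: nth_list_update pos_lt_CARD)
  have "alternating_form g"
    unfolding alternating_form_def
  proof (intro conjI allI impI)
    fix v :: "'n \<Rightarrow> (real, 'n) vec" and i :: 'n
    have "linear (\<lambda>x. wedge_list ((tup v)[pos i := x]))"
      by (rule linear_wedge_list_upd) (simp add: tup_def pos_lt_CARD)
    from linear_add[OF this] linear_scale[OF this] show "linear (\<lambda>x. g (v(i := x)))"
      unfolding g_def upd by (intro linearI) simp_all
  next
    fix v :: "'n \<Rightarrow> (real, 'n) vec" and i j :: 'n
    assume ij: "i \<noteq> j" "v i = v j"
    have "pos i \<noteq> pos j" using ij(1) by (metis at_pos_pos)
    moreover have "tup v ! pos i = tup v ! pos j"
      using ij(2) pos_lt_CARD[of i] pos_lt_CARD[of j] by (simp add: tup_def)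
    ultimately have "\<not> distinct (tup v)"
      using nth_eq_iff_index_eq[of "tup v" "pos i" "pos j"] pos_lt_CARD[of i] pos_lt_CARD[of j]
      by (auto simp: tup_def)
    then show "g v = 0" by (simp add: g_def wedge_list_not_distinct)
  qed
  from alternating_form_eq_det_rows[OF this]
  have g: "g v = det_rows v * g (\<lambda>i. axis i 1)" for v .
  define js where "js = map (at_pos :: nat \<Rightarrow> 'n) [0..<CARD('n)]"
  have "sorted_wrt (<) js"
    unfolding js_def sorted_wrt_map
  proof (rule sorted_wrt_mono_rel[OF _ sorted_wrt_upt])
    fix m m' assume "m \<in> set [0..<CARD('n)]" "m' \<in> set [0..<CARD('n)]" "m < m'"
    then have "pos (at_pos m :: 'n) < pos (at_pos m' :: 'n)" by simp
    then show "(at_pos m :: 'n) < at_pos m'"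
      using pos_less[of "at_pos m' :: 'n" "at_pos m"] by (cases "at_pos m :: 'n" "at_pos m' :: 'n" rule: linorder_cases) auto
  qed
  moreover have "tup (\<lambda>i. axis i 1) = map (\<lambda>j. axis j 1) js" by (simp add: tup_def js_def)
  moreover have "set js = UNIV"
  proof -
    have "i \<in> set js" for i
    proof -
      have "at_pos (pos i) \<in> set js"
        unfolding js_def set_map using pos_lt_CARD[of i] by (intro imageI) simp
      then show ?thesis by simp
    qed
    then show ?thesis by auto
  qed
  ultimately have "g (\<lambda>i. axis i 1) = 1"
    using wedge_list_axis[of js] by (simp add: g_def)
  moreover have "tup (\<lambda>i. xs ! pos i) = xs"
    using len unfolding tup_def by (intro nth_equalityI) auto
  ultimately show ?thesis using g[of "\<lambda>i. xs ! pos i"] by (simp add: g_def tuple_det_eq)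
qed

text \<open>Moving \<open>y\<close> to the front costs a sign. The top coefficient is then the inner
  product of \<open>y\<close> with the Hodge dual of the product of the other vectors, whose entries
  are up to sign some of its coefficients; Cauchy-Schwarz applies.\<close>

lemma wedge_list_top_upd:
  fixes xs :: "(real^'n::{finite,linorder}) list"
  assumes len: "length xs = CARD('n)" and k: "k < CARD('n)"
  shows "\<bar>tuple_det (xs[k := y])\<bar> \<le> norm y * norm (wedge_list (take k xs @ drop (Suc k) xs))"
proof -
  define ys where "ys = take k xs @ drop (Suc k) xs"
  have "xs[k := y] = take k xs @ y # drop (Suc k) xs"
    using len k by (simp add: upd_conv_take_nth_drop)
  then have "wedge_list (xs[k := y]) = (- 1) ^ k *\<^sub>R wedge (ext_vec y) (wedge_list ys)"
    using len k wedge_list_move[of "take k xs" y "drop (Suc k) xs"] by (simp add: ys_def wedge_list_Cons)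
  then have "\<bar>tuple_det (xs[k := y])\<bar> = \<bar>wedge (ext_vec y) (wedge_list ys) $ UNIV\<bar>"
    using wedge_list_top[of "xs[k := y]"] len by (simp add: abs_mult power_abs)
  also have "wedge (ext_vec y) (wedge_list ys) $ UNIV =
      (\<Sum>j\<in>UNIV. y $ j * (vertex_sign j UNIV * wedge_list ys $ (UNIV - {j})))"
    by (simp add: wedge_ext_vec_nth algebra_simps)
  also have "\<dots> = y \<bullet> (\<chi> j. vertex_sign j UNIV * wedge_list ys $ (UNIV - {j}))"
    by (simp add: inner_vec_def)
  also have "\<bar>\<dots>\<bar> \<le> norm y * norm (\<chi> j. vertex_sign j UNIV * wedge_list ys $ (UNIV - {j}))"
    by (rule Cauchy_Schwarz_ineq2)
  also have "norm (\<chi> j. vertex_sign j UNIV * wedge_list ys $ (UNIV - {j})) \<le> norm (wedge_list ys)"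
  proof -
    have "(\<Sum>j\<in>UNIV. (vertex_sign j UNIV * wedge_list ys $ (UNIV - {j}))\<^sup>2) =
        (\<Sum>j\<in>UNIV. (wedge_list ys $ (UNIV - {j}))\<^sup>2)"
      by (simp add: vertex_sign_def power_mult_distrib flip: power_mult)
    also have "\<dots> = (\<Sum>K\<in>(\<lambda>j::'n. UNIV - {j}) ` UNIV. (wedge_list ys $ K)\<^sup>2)"
      by (subst sum.reindex) (auto intro!: inj_onI)
    also have "\<dots> \<le> (\<Sum>K\<in>UNIV. (wedge_list ys $ K)\<^sup>2)"
      by (rule sum_mono2) auto
    finally show ?thesis by (simp add: norm_vec_def L2_set_def)
  qed
  finally show ?thesis unfolding ys_def by (simp add: mult_left_mono)
qed

text \<open>Cauchy-Schwarz in each coefficient; a given coefficient of \<beta> is then counted at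
  most once for each of the \<open>n\<close> indices \<open>j\<close>. The resulting crude factor is
  later absorbed by \<open>c1\<close>.\<close>

lemma norm_wedge_ext_vec_le:
  fixes x :: "real^'n::{finite,linorder}"
  shows "norm (wedge (ext_vec x) \<beta>) \<le> sqrt (real CARD('n)) * norm x * norm \<beta>"
proof -
  have *: "(wedge (ext_vec x) \<beta> $ K)\<^sup>2 \<le> (norm x)\<^sup>2 * (\<Sum>j\<in>UNIV. if j \<in> K then (\<beta> $ (K - {j}))\<^sup>2 else 0)" for K
  proof -
    define b where "b = (\<chi> j. if j \<in> K then vertex_sign j K * \<beta> $ (K - {j}) else 0)"
    have "wedge (ext_vec x) \<beta> $ K = (\<Sum>j\<in>UNIV. if j \<in> K then vertex_sign j K * x $ j * \<beta> $ (K - {j}) else 0)"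
      by (simp add: wedge_ext_vec_nth sum.If_cases)
    also have "\<dots> = x \<bullet> b"
      unfolding inner_vec_def b_def by (rule sum.cong) auto
    finally have "(wedge (ext_vec x) \<beta> $ K)\<^sup>2 \<le> (x \<bullet> x) * (b \<bullet> b)"
      using Cauchy_Schwarz_ineq by metis
    also have "b \<bullet> b = (\<Sum>j\<in>UNIV. if j \<in> K then (\<beta> $ (K - {j}))\<^sup>2 else 0)"
      unfolding inner_vec_def b_def
      by (rule sum.cong) (auto simp: vertex_sign_def power2_eq_square simp flip: power_mult_distrib)
    finally show ?thesis by (simp add: power2_norm_eq_inner)
  qed
  \<comment> \<open>For fixed \<open>j\<close>, removing \<open>j\<close> is injective on the sets
    that contain it.\<close>
  have swap: "(\<Sum>K\<in>UNIV. if j \<in> K then (\<beta> $ (K - {j}))\<^sup>2 else 0) \<le> (\<Sum>K\<in>UNIV. (\<beta> $ K)\<^sup>2)" for j :: 'n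
  proof -
    have "(\<Sum>K\<in>UNIV. if j \<in> K then (\<beta> $ (K - {j}))\<^sup>2 else 0) = (\<Sum>K\<in>{K. j \<in> K}. (\<beta> $ (K - {j}))\<^sup>2)"
      by (simp add: sum.If_cases)
    also have "\<dots> = (\<Sum>K\<in>(\<lambda>K. K - {j}) ` {K. j \<in> K}. (\<beta> $ K)\<^sup>2)"
      by (subst sum.reindex) (auto intro!: inj_onI)
    also have "\<dots> \<le> (\<Sum>K\<in>UNIV. (\<beta> $ K)\<^sup>2)" by (rule sum_mono2) auto
    finally show ?thesis .
  qed
  have "(norm (wedge (ext_vec x) \<beta>))\<^sup>2 = (\<Sum>K\<in>UNIV. (wedge (ext_vec x) \<beta> $ K)\<^sup>2)"
    by (simp add: norm_vec_def L2_set_def sum_nonneg)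
  also have "\<dots> \<le> (\<Sum>K\<in>UNIV. (norm x)\<^sup>2 * (\<Sum>j\<in>UNIV. if j \<in> K then (\<beta> $ (K - {j}))\<^sup>2 else 0))"
    by (rule sum_mono) (rule *)
  also have "\<dots> = (norm x)\<^sup>2 * (\<Sum>j\<in>UNIV. \<Sum>K\<in>UNIV. if j \<in> K then (\<beta> $ (K - {j}))\<^sup>2 else 0)"
    unfolding sum_distrib_left[symmetric] by (subst sum.swap) (rule refl)
  also have "\<dots> \<le> (norm x)\<^sup>2 * (\<Sum>j\<in>(UNIV :: 'n set). \<Sum>K\<in>UNIV. (\<beta> $ K)\<^sup>2)"
    by (intro mult_left_mono sum_mono swap) auto
  also have "\<dots> = (norm x)\<^sup>2 * (real CARD('n) * (norm \<beta>)\<^sup>2)"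
    by (simp add: norm_vec_def L2_set_def sum_nonneg)
  also have "\<dots> = (sqrt (real CARD('n)) * norm x * norm \<beta>)\<^sup>2"
    by (simp add: power_mult_distrib)
  finally show ?thesis by (rule power2_le_imp_le) auto
qed

lemma norm_wedge_list_le:
  fixes xs :: "(real^'n::{finite,linorder}) list"
  shows "norm (wedge_list xs) \<le> sqrt (real CARD('n)) ^ length xs * prod_list (map norm xs)"
proof (induction xs)
  case Nil
  then show ?case by (simp add: wedge_list_def)
next
  case (Cons x xs)
  have "norm (wedge_list (x # xs)) \<le> sqrt (real CARD('n)) * norm x * norm (wedge_list xs)"
    unfolding wedge_list_Cons by (rule norm_wedge_ext_vec_le)
  also have "\<dots> \<le> sqrt (real CARD('n)) * norm x * (sqrt (real CARD('n)) ^ length xs * prod_list (map norm xs))"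
    using Cons by (intro mult_left_mono) auto
  finally show ?case by (simp add: mult_ac)
qed


section \<open>Successive minima\<close>

lemma L_point_le_iff:
  assumes "x \<noteq> 0"
  shows "L_point u x q \<le> c \<longleftrightarrow> norm x \<le> exp c \<and> \<bar>x \<bullet> u\<bar> \<le> exp (c - q)"
proof -
  have "ln (norm x) \<le> c \<longleftrightarrow> norm x \<le> exp c"
    using assms by (metis exp_le_cancel_iff exp_ln zero_less_norm_iff)
  moreover have "q + ln \<bar>x \<bullet> u\<bar> \<le> c \<longleftrightarrow> \<bar>x \<bullet> u\<bar> \<le> exp (c - q)" if "x \<bullet> u \<noteq> 0"
  proof -
    have "\<bar>x \<bullet> u\<bar> \<le> exp (c - q) \<longleftrightarrow> ln \<bar>x \<bullet> u\<bar> \<le> c - q"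
      using that by (metis exp_le_cancel_iff exp_ln zero_less_abs_iff)
    then show ?thesis by linarith
  qed
  ultimately show ?thesis by (auto simp: L_point_def)
qed

lemma ln_norm_le_L_point: "ln (norm x) \<le> L_point u x q"
  by (simp add: L_point_def)

lemma norm_le_exp_L_point: "norm x \<le> exp c" if "L_point u x q \<le> c"
  using that L_point_le_iff[of x u q c] by (cases "x = 0") auto

lemma inner_le_exp_L_point: "\<bar>x \<bullet> u\<bar> \<le> exp (c - q)" if "L_point u x q \<le> c"
  using that L_point_le_iff[of x u q c] by (cases "x = 0") auto

lemma L_point_mono: "q \<le> q' \<Longrightarrow> L_point u x q \<le> L_point u x q'"
  by (auto simp: L_point_def)

lemma L_point_slope: "q \<le> q' \<Longrightarrow> L_point u x q' \<le> L_point u x q + (q' - q)"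
  by (auto simp: L_point_def)

text \<open>Strictly above \<open>ln (norm x)\<close> the trajectory is on its branch of slope one
  and never leaves it. The next lemma follows this branch back until it meets
  \<open>ln (norm x)\<close>.\<close>

lemma L_point_rising:
  "ln (norm x) < L_point u x q \<Longrightarrow> q \<le> q' \<Longrightarrow> L_point u x q' = L_point u x q + (q' - q)"
  by (auto simp: L_point_def split: if_splits)

lemma L_point_before_rising:
  "ln (norm x) < L_point u x q' \<Longrightarrow> q \<le> q' \<Longrightarrow>
    L_point u x q = max (ln (norm x)) (L_point u x q' - (q' - q))"
  by (auto simp: L_point_def split: if_splits)

lemma integer_points_0: "0 \<in> integer_points"
  by (simp add: integer_points_def)

lemma integer_points_norm_ge_1:
  assumes "x \<in> integer_points" "x \<noteq> 0"
  shows "1 \<le> norm x"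
proof -
  obtain i where "x $ i \<noteq> 0" using assms(2) by (auto simp: vec_eq_iff)
  then have "1 \<le> \<bar>x $ i\<bar>"
    using assms(1) by (intro Ints_nonzero_abs_ge1) (auto simp: integer_points_def)
  also have "\<dots> \<le> norm x" by (rule component_le_norm_cart)
  finally show ?thesis .
qed

text \<open>The zero vector is covered as well, since \<open>ln 0 = 0\<close> gives it the constant
  trajectory 0.\<close>

lemma L_point_nonneg: "x \<in> integer_points \<Longrightarrow> 0 \<le> L_point u x q"
  using integer_points_norm_ge_1[of x] ln_norm_le_L_point[of x u q]
  by (cases "x = 0") (auto simp: L_point_def intro: order_trans[OF ln_ge_zero])

lemma finite_integer_points_norm_le: "finite {x :: real^'n. x \<in> integer_points \<and> norm x \<le> r}"
proof -
  define A where "A = {z :: real. z \<in> \<int> \<and> \<bar>z\<bar> \<le> r}"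
  have "A \<subseteq> of_int ` {- \<lceil>r\<rceil>..\<lceil>r\<rceil>}"
  proof
    fix z assume "z \<in> A"
    then obtain m :: int where m: "z = of_int m" "\<bar>z\<bar> \<le> r" by (auto simp: A_def elim: Ints_cases)
    then have "\<bar>m\<bar> \<le> \<lceil>r\<rceil>" by linarith
    then show "z \<in> of_int ` {- \<lceil>r\<rceil>..\<lceil>r\<rceil>}" unfolding m(1) by (intro imageI) (simp add: abs_le_iff)
  qed
  then have "finite A" using finite_subset by blast
  then have "finite (vec_lambda ` (UNIV \<rightarrow>\<^sub>E A) :: (real^'n) set)"
    by (intro finite_imageI finite_PiE) auto
  moreover have "{x :: real^'n. x \<in> integer_points \<and> norm x \<le> r} \<subseteq> vec_lambda ` (UNIV \<rightarrow>\<^sub>E A)"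
  proof
    fix x :: "real^'n" assume "x \<in> {x. x \<in> integer_points \<and> norm x \<le> r}"
    then have "x $ i \<in> A" for i
      using component_le_norm_cart[of x i] by (auto simp: A_def integer_points_def intro: order_trans)
    then have "vec_nth x \<in> UNIV \<rightarrow>\<^sub>E A" by auto
    then show "x \<in> vec_lambda ` (UNIV \<rightarrow>\<^sub>E A)" by (metis image_eqI vec_nth_inverse)
  qed
  ultimately show ?thesis by (rule finite_subset[rotated])
qed

lemma finite_L_point_le: "finite {x \<in> integer_points. L_point u x q \<le> c}"
  by (rule finite_subset[OF _ finite_integer_points_norm_le[of "exp c"]])
    (auto intro: norm_le_exp_L_point)

lemma mem_scaled_conv_body:
  "x \<in> (\<lambda>x. exp c *\<^sub>R x) ` conv_body u q \<longleftrightarrow> norm x \<le> exp c \<and> \<bar>x \<bullet> u\<bar> \<le> exp (c - q)"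
proof -
  have "x \<in> (\<lambda>x. exp c *\<^sub>R x) ` conv_body u q \<longleftrightarrow> exp (- c) *\<^sub>R x \<in> conv_body u q"
  proof
    assume "exp (- c) *\<^sub>R x \<in> conv_body u q"
    then show "x \<in> (\<lambda>x. exp c *\<^sub>R x) ` conv_body u q"
      by (rule rev_image_eqI) (simp flip: exp_add)
  qed (auto simp flip: exp_add)
  also have "\<dots> \<longleftrightarrow> norm x \<le> exp c \<and> \<bar>x \<bullet> u\<bar> \<le> exp (c - q)"
    by (simp add: conv_body_def abs_mult exp_minus exp_diff field_simps)
  finally show ?thesis .
qed

definition short_system :: "real^'n \<Rightarrow> nat \<Rightarrow> real \<Rightarrow> real \<Rightarrow> bool" where
  "short_system u j q c \<longleftrightarrow>
     (\<exists>S \<subseteq> integer_points. independent S \<and> card S = j \<and> (\<forall>x\<in>S. L_point u x q \<le> c))"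

text \<open>The sign condition on \<open>c\<close> follows from a single point of the nonempty set
  \<open>S\<close>, trajectories of integer points being nonnegative. Independence excludes the zero
  vector, so the scaled body can be described by \<open>L_point\<close>.\<close>

lemma L_min_eq_Least:
  assumes "1 \<le> j"
  shows "L_min u j q = (LEAST c. short_system u j q c)"
proof -
  have "0 \<le> c \<and> (\<exists>S \<subseteq> (\<lambda>x. exp c *\<^sub>R x) ` conv_body u q \<inter> integer_points. independent S \<and> card S = j)
      \<longleftrightarrow> short_system u j q c" (is "?l \<longleftrightarrow> ?r") for c
  proof
    assume ?l
    then obtain S where S: "S \<subseteq> (\<lambda>x. exp c *\<^sub>R x) ` conv_body u q \<inter> integer_points"
      "independent S" "card S = j" by blast
    have "L_point u x q \<le> c" if "x \<in> S" for x
    proof -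
      have "x \<noteq> 0" using that S(2) dependent_zero by blast
      then show ?thesis
        using that S(1) mem_scaled_conv_body[of x c u q] L_point_le_iff by blast
    qed
    then show ?r using S by (auto simp: short_system_def)
  next
    assume ?r
    then obtain S where S: "S \<subseteq> integer_points" "independent S" "card S = j"
      "\<forall>x\<in>S. L_point u x q \<le> c" by (auto simp: short_system_def)
    have "S \<noteq> {}" using S(3) assms by auto
    then obtain x where "x \<in> S" by blast
    then have "0 \<le> c" using S(1,4) L_point_nonneg order_trans by blast
    moreover have "S \<subseteq> (\<lambda>x. exp c *\<^sub>R x) ` conv_body u q"
    proof
      fix x assume "x \<in> S"
      then have "L_point u x q \<le> c" using S(4) by blast
      then show "x \<in> (\<lambda>x. exp c *\<^sub>R x) ` conv_body u q"
        unfolding mem_scaled_conv_body using norm_le_exp_L_point inner_le_exp_L_point by blast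
    qed
    ultimately show ?l using S by blast
  qed
  then show ?thesis by (simp add: L_min_def)
qed

lemma axis_integer_points: "axis i 1 \<in> integer_points"
  by (auto simp: integer_points_def axis_def)

text \<open>Some system of coordinate vectors \<open>S0\<close> exists, and only finitely many
  integer systems are at least as short as it, so a shortest one exists. A system is measured by its
  highest trajectory \<open>h\<close>.\<close>

lemma L_min_Least_ex:
  fixes u :: "real^'n"
  assumes j: "1 \<le> j" "j \<le> CARD('n)"
  shows "\<exists>c. short_system u j q c \<and> (\<forall>c'. short_system u j q c' \<longrightarrow> c \<le> c')"
proof -
  have "(Basis :: (real^'n) set) \<subseteq> integer_points"
    by (auto simp: Basis_vec_def axis_integer_points)
  moreover obtain S0 where S0: "S0 \<subseteq> (Basis :: (real^'n) set)" "card S0 = j"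
    using obtain_subset_with_card_n[of j "Basis :: (real^'n) set"] j(2) by auto
  ultimately have S0i: "S0 \<subseteq> integer_points" "independent S0"
    using independent_Basis independent_mono by blast+
  have fin: "finite S \<and> S \<noteq> {}" if "card S = j" for S :: "(real^'n) set"
    using that j(1) card.infinite by force
  define h where "h S = Max ((\<lambda>x. L_point u x q) ` S)" for S
  have h: "h S \<le> c \<longleftrightarrow> (\<forall>x\<in>S. L_point u x q \<le> c)" if "card S = j" for S c
    unfolding h_def using fin[OF that] by simp
  define F where "F = {S. S \<subseteq> integer_points \<and> independent S \<and> card S = j \<and> h S \<le> h S0}"
  have "F \<subseteq> Pow {x \<in> integer_points. L_point u x q \<le> h S0}"
    using h unfolding F_def by blast
  then have "finite F" using finite_L_point_le finite_subset by blast
  moreover have "S0 \<in> F" using S0 S0i by (simp add: F_def)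
  ultimately obtain S where S: "S \<in> F" "\<forall>S'\<in>F. h S \<le> h S'"
    using ex_min_if_finite[of "h ` F"] by (metis (mono_tags, lifting) empty_iff finite_imageI imageE image_eqI image_is_empty not_le)
  have "short_system u j q (h S)"
    unfolding short_system_def using S(1) h[of S "h S"] by (auto simp: F_def)
  moreover have "h S \<le> c'" if c': "short_system u j q c'" for c'
  proof -
    obtain S' where S': "S' \<subseteq> integer_points" "independent S'" "card S' = j"
      and L: "\<forall>x\<in>S'. L_point u x q \<le> c'"
      using c' by (auto simp: short_system_def)
    have le: "h S' \<le> c'" using h[OF S'(3)] L by simp
    show ?thesis
    proof (cases "h S' \<le> h S0")
      case True
      then show ?thesis using S' S(2) le by (auto simp: F_def intro: order_trans)
    next
      case False
      then show ?thesis using S(1) le by (auto simp: F_def)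
    qed
  qed
  ultimately show ?thesis by blast
qed

lemma short_system_L_min:
  fixes u :: "real^'n"
  assumes "1 \<le> j" "j \<le> CARD('n)"
  shows "short_system u j q (L_min u j q)"
  using L_min_Least_ex[OF assms, of u q] unfolding L_min_eq_Least[OF assms(1)]
  by (metis (mono_tags, lifting) Least_equality)

lemma L_min_le:
  fixes u :: "real^'n"
  assumes "1 \<le> j" "j \<le> CARD('n)" "short_system u j q c"
  shows "L_min u j q \<le> c"
  using L_min_Least_ex[OF assms(1,2), of u q] assms(3) unfolding L_min_eq_Least[OF assms(1)]
  by (metis (mono_tags, lifting) Least_equality)

text \<open>Greedy choice: a system for the next minimum has one element more than the points chosen
  so far, so one of its elements lies outside their span.\<close>

lemma successive_minima_realized:
  fixes u :: "real^'n"
  assumes "m \<le> CARD('n)"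
  shows "\<exists>X. inj_on X {..<m} \<and> independent (X ` {..<m}) \<and>
    (\<forall>i<m. X i \<in> integer_points \<and> L_point u (X i) q \<le> L_min u (Suc i) q)"
  using assms
proof (induction m)
  case 0
  then show ?case by (simp add: independent_empty)
next
  case (Suc m)
  then obtain X where X: "inj_on X {..<m}" "independent (X ` {..<m})"
    "\<forall>i<m. X i \<in> integer_points \<and> L_point u (X i) q \<le> L_min u (Suc i) q" by auto
  obtain S where S: "S \<subseteq> integer_points" "independent S" "card S = Suc m"
    "\<forall>x\<in>S. L_point u x q \<le> L_min u (Suc m) q"
    using short_system_L_min[of "Suc m" u q] Suc.prems by (auto simp: short_system_def)
  have "\<not> S \<subseteq> span (X ` {..<m})"
  proof
    assume "S \<subseteq> span (X ` {..<m})"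
    then have "card S \<le> card (X ` {..<m})"
      using S(2) independent_card_le_dim dim_span_eq_card_independent[OF X(2)] by metis
    also have "\<dots> \<le> m" using card_image_le[of "{..<m}" X] by simp
    finally show False using S(3) by simp
  qed
  then obtain x where x: "x \<in> S" "x \<notin> span (X ` {..<m})" by blast
  define Y where "Y = X(m := x)"
  have im: "Y ` {..<m} = X ` {..<m}" by (auto simp: Y_def)
  have "inj_on Y {..<m}" using X(1) by (auto simp: Y_def inj_on_def)
  then have "inj_on Y {..<Suc m}"
    unfolding lessThan_Suc using x(2) im by (auto simp: Y_def intro: span_base)
  moreover have "independent (Y ` {..<Suc m})"
    unfolding lessThan_Suc image_insert im using x(2) X(2) by (simp add: Y_def independent_insertI)
  moreover have "\<forall>i<Suc m. Y i \<in> integer_points \<and> L_point u (Y i) q \<le> L_min u (Suc i) q"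
    using X(3) S x(1) by (auto simp: Y_def less_Suc_eq)
  ultimately show ?case by blast
qed

lemma sort_nth_le_iff:
  fixes xs :: "'a::linorder list"
  assumes j: "j < length xs"
  shows "sort xs ! j \<le> c \<longleftrightarrow> j < length (filter (\<lambda>x. x \<le> c) xs)"
proof -
  define ys where "ys = sort xs"
  have ys: "sorted ys" "length ys = length xs" by (simp_all add: ys_def)
  have "length (filter (\<lambda>x. x \<le> c) xs) = length (filter (\<lambda>x. x \<le> c) ys)"
    unfolding ys_def by (metis mset_filter mset_sort size_mset)
  also have "\<dots> = card {i. i < length ys \<and> ys ! i \<le> c}" by (rule length_filter_conv_card)
  finally have len: "length (filter (\<lambda>x. x \<le> c) xs) = card {i. i < length ys \<and> ys ! i \<le> c}" .
  show ?thesis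
  proof
    assume "sort xs ! j \<le> c"
    then have "ys ! i \<le> c" if "i \<le> j" for i
      using that j ys sorted_nth_mono[OF ys(1) that] by (auto simp: ys_def intro: order_trans)
    then have "{..j} \<subseteq> {i. i < length ys \<and> ys ! i \<le> c}" using j ys(2) by auto
    then have "card {..j} \<le> card {i. i < length ys \<and> ys ! i \<le> c}" by (intro card_mono) auto
    then show "j < length (filter (\<lambda>x. x \<le> c) xs)" unfolding len by simp
  next
    assume *: "j < length (filter (\<lambda>x. x \<le> c) xs)"
    show "sort xs ! j \<le> c"
    proof (rule ccontr)
      assume "\<not> sort xs ! j \<le> c"
      then have "{i. i < length ys \<and> ys ! i \<le> c} \<subseteq> {..<j}"
        using sorted_nth_mono[OF ys(1)] by (auto simp: ys_def not_le) (meson leD leI le_less_trans)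
      then have "card {i. i < length ys \<and> ys ! i \<le> c} \<le> card {..<j}" by (intro card_mono) auto
      then show False using * unfolding len by simp
    qed
  qed
qed

text \<open>At least \<open>j + 1\<close> of the points have a trajectory at most the entry of index
  \<open>j\<close> of the sorted list, and \<open>j + 1\<close> of these form a system for the
  minimum.\<close>

lemma L_min_le_sort:
  fixes u :: "real^'n"
  assumes xs: "set xs \<subseteq> integer_points" "distinct xs" "independent (set xs)"
    and j: "j < length xs" "length xs \<le> CARD('n)"
  shows "L_min u (Suc j) q \<le> sort (map (\<lambda>x. L_point u x q) xs) ! j"
proof (rule L_min_le)
  define c where "c = sort (map (\<lambda>x. L_point u x q) xs) ! j"
  define S where "S = set (filter (\<lambda>x. L_point u x q \<le> c) xs)"
  have "j < length (filter (\<lambda>y. y \<le> c) (map (\<lambda>x. L_point u x q) xs))"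
    using sort_nth_le_iff[of j "map (\<lambda>x. L_point u x q) xs" c] j by (simp add: c_def)
  then have "Suc j \<le> length (filter (\<lambda>x. L_point u x q \<le> c) xs)"
    by (simp add: filter_map comp_def)
  also have "\<dots> = card S" unfolding S_def using xs(2) by (intro distinct_card[symmetric]) simp
  finally obtain T where "T \<subseteq> S" "card T = Suc j" using obtain_subset_with_card_n by metis
  moreover have "S \<subseteq> set xs" by (auto simp: S_def)
  ultimately show "short_system u (Suc j) q (sort (map (\<lambda>x. L_point u x q) xs) ! j)"
    unfolding short_system_def c_def[symmetric] using xs independent_mono[OF xs(3)]
    by (intro exI[of _ T]) (auto simp: S_def)
qed (use j in auto)

section \<open>Spans of short integer points and their dimensions\<close>

definition level_space :: "real^'n \<Rightarrow> real \<Rightarrow> real \<Rightarrow> (real^'n) set" where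
  "level_space u q c = span {x \<in> integer_points. L_point u x q \<le> c \<and> x \<noteq> 0}"

lemma level_space_base:
  "x \<in> integer_points \<Longrightarrow> L_point u x q \<le> c \<Longrightarrow> x \<in> level_space u q c"
  unfolding level_space_def by (cases "x = 0") (auto intro: span_base span_zero)

lemma subspace_level_space: "subspace (level_space u q c)"
  by (simp add: level_space_def subspace_span)

lemma level_space_mono: "q \<le> q' \<Longrightarrow> c' \<le> c \<Longrightarrow> level_space u q' c' \<subseteq> level_space u q c"
  unfolding level_space_def
  by (intro span_mono) (auto intro: order_trans[OF L_point_mono])

text \<open>The list is left unsorted so that a moving coordinate keeps its slot while it overtakes
  others.\<close>

definition minima_near :: "real^'n \<Rightarrow> real \<Rightarrow> real \<Rightarrow> real list \<Rightarrow> bool" where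
  "minima_near u \<epsilon> t vs \<longleftrightarrow> length vs = CARD('n) \<and>
     (\<forall>j<CARD('n). \<bar>sort vs ! j - L_min u (Suc j) t\<bar> \<le> \<epsilon>)"

text \<open>The permutation that sorts \<open>vs\<close> reindexes the points realizing the minima,
  so that \<open>X i\<close> belongs to the slot \<open>i\<close>.\<close>

lemma minima_near_realized:
  fixes u :: "real^'n"
  assumes near: "minima_near u \<epsilon> t vs"
  obtains X where "inj_on X {..<CARD('n)}" "independent (X ` {..<CARD('n)})"
    "\<And>i. i < CARD('n) \<Longrightarrow> X i \<in> integer_points"
    "\<And>i. i < CARD('n) \<Longrightarrow> L_point u (X i) t \<le> vs ! i + \<epsilon>"
proof -
  let ?n = "CARD('n)"
  have len: "length vs = ?n" using near by (simp add: minima_near_def)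
  obtain X where X: "inj_on X {..<?n}" "independent (X ` {..<?n})"
    "\<forall>i<?n. X i \<in> integer_points \<and> L_point u (X i) t \<le> L_min u (Suc i) t"
    using successive_minima_realized[of ?n u t] by auto
  have "mset vs = mset (sort vs)" by simp
  from permutation_Ex_bij[OF this] obtain f where f: "bij_betw f {..<?n} {..<?n}"
    "\<forall>i<?n. vs ! i = sort vs ! f i"
    using len by auto
  have fi: "f i < ?n" if "i < ?n" for i using f(1) that by (auto simp: bij_betw_def)
  have im: "(X \<circ> f) ` {..<?n} = X ` {..<?n}" 
    unfolding image_comp[symmetric] using f(1) by (simp add: bij_betw_def)
  show thesis
  proof
    show "inj_on (X \<circ> f) {..<?n}" using X(1) f(1) by (intro comp_inj_on) (auto simp: bij_betw_def)
    show "independent ((X \<circ> f) ` {..<?n})" unfolding im by (rule X(2))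
    show "(X \<circ> f) i \<in> integer_points" if "i < ?n" for i using X(3) fi[OF that] by simp
    show "L_point u ((X \<circ> f) i) t \<le> vs ! i + \<epsilon>" if "i < ?n" for i
    proof -
      have "L_point u (X (f i)) t \<le> L_min u (Suc (f i)) t" using X(3) fi[OF that] by simp
      moreover have "\<bar>sort vs ! f i - L_min u (Suc (f i)) t\<bar> \<le> \<epsilon>"
        using near fi[OF that] by (simp add: minima_near_def)
      ultimately show ?thesis using f(2) that by simp
    qed
  qed
qed

text \<open>Points realizing the values below \<open>c\<close> give the lower bound. One more
  dimension would put the next minimum at most at \<open>c\<close> and hence one more value at most
  at \<open>c + \<epsilon>\<close>, which the gap around \<open>c\<close> turns into a value already
  counted.\<close>

lemma dim_level_space:
  fixes u :: "real^'n"
  assumes near: "minima_near u \<epsilon> t vs"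
    and gap: "\<And>i. i < CARD('n) \<Longrightarrow> vs ! i + \<epsilon> \<le> c \<or> c < vs ! i - \<epsilon>"
    and eps: "0 \<le> \<epsilon>"
  shows "dim (level_space u t c) = card {i. i < CARD('n) \<and> vs ! i + \<epsilon> \<le> c}"
proof (rule antisym)
  let ?n = "CARD('n)"
  let ?I = "{i. i < ?n \<and> vs ! i + \<epsilon> \<le> c}"
  have len: "length vs = ?n" using near by (simp add: minima_near_def)
  obtain X where X: "inj_on X {..<?n}" "independent (X ` {..<?n})"
    "\<And>i. i < ?n \<Longrightarrow> X i \<in> integer_points"
    "\<And>i. i < ?n \<Longrightarrow> L_point u (X i) t \<le> vs ! i + \<epsilon>"
    using minima_near_realized[OF near] by blast
  have "X ` ?I \<subseteq> level_space u t c"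
    using X(3,4) by (auto intro!: level_space_base intro: order_trans)
  moreover have "independent (X ` ?I)" by (rule independent_mono[OF X(2)]) auto
  ultimately have "card (X ` ?I) \<le> dim (level_space u t c)"
    by (rule independent_card_le_dim)
  moreover have "card (X ` ?I) = card ?I"
    by (rule card_image) (rule inj_on_subset[OF X(1)], auto)
  ultimately show "card ?I \<le> dim (level_space u t c)" by simp
  show "dim (level_space u t c) \<le> card ?I"
  proof (rule ccontr)
    assume "\<not> dim (level_space u t c) \<le> card ?I"
    then have m: "Suc (card ?I) \<le> dim (level_space u t c)" by simp
    let ?G = "{x \<in> integer_points. L_point u x t \<le> c \<and> x \<noteq> 0}"
    obtain B where B: "B \<subseteq> ?G" "independent B" "?G \<subseteq> span B" "card B = dim ?G"
      by (rule basis_exists[of ?G])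
    have "dim ?G = dim (level_space u t c)" by (simp add: level_space_def)
    then obtain T where T: "T \<subseteq> B" "card T = Suc (card ?I)"
      using obtain_subset_with_card_n[of "Suc (card ?I)" B] m B(4) by auto
    then have "short_system u (Suc (card ?I)) t c"
      unfolding short_system_def using B(1) independent_mono[OF B(2)] by (intro exI[of _ T]) auto
    moreover have n: "card ?I < ?n"
      using m dim_subset_UNIV_cart[of "level_space u t c"] by simp
    ultimately have le: "L_min u (Suc (card ?I)) t \<le> c" by (intro L_min_le) auto
    define d where "d = sort vs ! card ?I"
    have "d \<le> c + \<epsilon>" using le near n by (auto simp: minima_near_def d_def abs_le_iff)
    then have "card ?I < length (filter (\<lambda>x. x \<le> c + \<epsilon>) vs)"
      using sort_nth_le_iff[of "card ?I" vs "c + \<epsilon>"] n len by (simp add: d_def)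
    also have "\<dots> = card {i. i < length vs \<and> vs ! i \<le> c + \<epsilon>}" by (rule length_filter_conv_card)
    also have "{i. i < length vs \<and> vs ! i \<le> c + \<epsilon>} \<subseteq> ?I" using gap len by force
    then have "card {i. i < length vs \<and> vs ! i \<le> c + \<epsilon>} \<le> card ?I" by (intro card_mono) auto
    finally show False by simp
  qed
qed

text \<open>Common elements cancel and the remaining ones, equally many, are compared through
  \<open>c\<close>. This is how the lowest heights are seen to have the least sum.\<close>

lemma sum_le_sum_exchange:
  fixes v :: "'a \<Rightarrow> real"
  assumes "finite X" "finite Y" "card X = card Y"
    and "\<And>i. i \<in> Y \<Longrightarrow> v i \<le> c" and "\<And>i. i \<in> X - Y \<Longrightarrow> c \<le> v i"
  shows "sum v Y \<le> sum v X"
proof -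
  have "card (X - Y) = card (Y - X)"
    using assms(1-3) by (metis card_Diff_subset_Int finite_Int inf_commute)
  have "sum v (Y - X) \<le> real (card (Y - X)) * c" using assms(4) by (intro sum_bounded_above) auto
  also have "\<dots> = real (card (X - Y)) * c" using \<open>card (X - Y) = _\<close> by simp
  also have "\<dots> \<le> sum v (X - Y)" using assms(5) by (intro sum_bounded_below) auto
  finally have "sum v (Y - X) \<le> sum v (X - Y)" .
  moreover have "sum v Y = sum v (Y - X) + sum v (X \<inter> Y)" "sum v X = sum v (X - Y) + sum v (X \<inter> Y)"
    using assms(1,2) by (metis add.commute inf_commute sum.Int_Diff)+
  ultimately show ?thesis by linarith
qed


section \<open>Crossing a level\<close>

lemma sum_pos_reindex:
  fixes f :: "nat \<Rightarrow> real"
  assumes "p \<le> CARD('n::{finite,linorder})"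
  shows "(\<Sum>i\<in>{i::'n. pos i < p}. f (pos i)) = (\<Sum>m<p. f m)"
    and "(\<Sum>i\<in>-{i::'n. pos i < p}. f (pos i)) = (\<Sum>m\<in>{p..<CARD('n)}. f m)"
proof -
  have inj: "inj_on pos A" for A :: "'n set"
    using bij_betw_pos by (auto simp: bij_betw_def intro: inj_on_subset)
  have 1: "pos ` {i::'n. pos i < p} = {..<p}"
  proof
    show "{..<p} \<subseteq> pos ` {i::'n. pos i < p}"
    proof
      fix m assume "m \<in> {..<p}"
      then have "pos (at_pos m :: 'n) = m" using assms by (intro pos_at_pos) auto
      then show "m \<in> pos ` {i::'n. pos i < p}" using \<open>m \<in> {..<p}\<close> by (metis imageI lessThan_iff mem_Collect_eq)
    qed
  qed auto
  have 2: "pos ` (- {i::'n. pos i < p}) = {p..<CARD('n)}"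
  proof
    show "{p..<CARD('n)} \<subseteq> pos ` (- {i::'n. pos i < p})"
    proof
      fix m assume m: "m \<in> {p..<CARD('n)}"
      then have "pos (at_pos m :: 'n) = m" by (intro pos_at_pos) auto
      then show "m \<in> pos ` (- {i::'n. pos i < p})" using m by (intro image_eqI[of _ _ "at_pos m"]) auto
    qed
  qed (auto simp: pos_lt_CARD)
  show "(\<Sum>i\<in>{i::'n. pos i < p}. f (pos i)) = (\<Sum>m<p. f m)"
    unfolding 1[symmetric] by (simp add: sum.reindex[OF inj])
  show "(\<Sum>i\<in>-{i::'n. pos i < p}. f (pos i)) = (\<Sum>m\<in>{p..<CARD('n)}. f m)"
    unfolding 2[symmetric] by (simp add: sum.reindex[OF inj])
qed

lemma pos_image_reindex:
  assumes "p \<le> CARD('n::{finite,linorder})"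
  shows "(\<lambda>i. f (pos i)) ` {i::'n. pos i < p} = f ` {..<p}"
    and "(\<lambda>i. f (pos i)) ` (- {i::'n. pos i < p}) = f ` {p..<CARD('n)}"
proof -
  show "(\<lambda>i. f (pos i)) ` {i::'n. pos i < p} = f ` {..<p}"
  proof
    show "f ` {..<p} \<subseteq> (\<lambda>i. f (pos i)) ` {i::'n. pos i < p}"
    proof (rule image_subsetI)
      fix m assume "m \<in> {..<p}"
      then show "f m \<in> (\<lambda>i. f (pos i)) ` {i::'n. pos i < p}"
        using assms by (intro image_eqI[of _ _ "at_pos m"]) auto
    qed
  qed auto
  show "(\<lambda>i. f (pos i)) ` (- {i::'n. pos i < p}) = f ` {p..<CARD('n)}"
  proof
    show "f ` {p..<CARD('n)} \<subseteq> (\<lambda>i. f (pos i)) ` (- {i::'n. pos i < p})"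
    proof (rule image_subsetI)
      fix m assume "m \<in> {p..<CARD('n)}"
      then show "f m \<in> (\<lambda>i. f (pos i)) ` (- {i::'n. pos i < p})"
        by (intro image_eqI[of _ _ "at_pos m"]) auto
    qed
  qed (auto simp: pos_lt_CARD)
qed

lemma sum_list_list_update:
  fixes xs :: "'a::ab_group_add list"
  assumes "k < length xs"
  shows "sum_list (xs[k := x]) = sum_list xs + x - xs ! k"
  using assms by (induction xs arbitrary: k) (auto simp: nth_Cons' split: nat.splits)

lemma span_independent_eq:
  fixes V :: "'a::euclidean_space set"
  assumes "subspace V" "B \<subseteq> V" "independent B" "dim V = card B"
  shows "span B = V"
  using assms card_ge_dim_independent[of B V] span_minimal[of B V] by auto

text \<open>Otherwise the level space would contain the independent points realizing the slot
  \<open>p\<close> and all lower slots, one more than its dimension.\<close>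

lemma good_point_exists:
  fixes u :: "real^'n::{finite,linorder}"
  assumes near: "minima_near u \<epsilon> t vs" and p: "p < CARD('n)"
    and sep: "\<And>i. i < CARD('n) \<Longrightarrow> i \<noteq> p \<Longrightarrow> \<delta> \<le> \<bar>vs ! i - vs ! p\<bar>"
    and eps: "0 < \<epsilon>" "2 * \<epsilon> < \<delta>"
  shows "\<exists>x. x \<in> integer_points \<and> L_point u x t \<le> vs ! p + \<epsilon> \<and> x \<notin> level_space u t (vs ! p - \<delta> / 2)"
proof (rule ccontr)
  assume *: "\<not> ?thesis"
  let ?I = "{i. i < CARD('n) \<and> vs ! i + \<epsilon> \<le> vs ! p - \<delta> / 2}"
  have "dim (level_space u t (vs ! p - \<delta> / 2)) = card ?I"
  proof (rule dim_level_space[OF near])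
    fix i assume "i < CARD('n)"
    then show "vs ! i + \<epsilon> \<le> vs ! p - \<delta> / 2 \<or> vs ! p - \<delta> / 2 < vs ! i - \<epsilon>"
      using sep[of i] eps by (cases "i = p") (auto simp: abs_if split: if_splits)
  qed (use eps in auto)
  obtain X where X: "inj_on X {..<CARD('n)}" "independent (X ` {..<CARD('n)})"
    "\<And>i. i < CARD('n) \<Longrightarrow> X i \<in> integer_points"
    "\<And>i. i < CARD('n) \<Longrightarrow> L_point u (X i) t \<le> vs ! i + \<epsilon>"
    using minima_near_realized[OF near] by blast
  have "X ` insert p ?I \<subseteq> level_space u t (vs ! p - \<delta> / 2)"
  proof (rule image_subsetI)
    fix i assume i: "i \<in> insert p ?I"
    then have "i < CARD('n)" "vs ! i \<le> vs ! p" using p eps by auto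
    then show "X i \<in> level_space u t (vs ! p - \<delta> / 2)"
      using * X(3)[of i] X(4)[of i] by (meson add_le_cancel_right order_trans)
  qed
  moreover have "independent (X ` insert p ?I)"
    by (rule independent_mono[OF X(2)]) (use p in auto)
  ultimately have "card (X ` insert p ?I) \<le> dim (level_space u t (vs ! p - \<delta> / 2))"
    by (rule independent_card_le_dim)
  moreover have "card (X ` insert p ?I) = card (insert p ?I)"
    by (rule card_image) (rule inj_on_subset[OF X(1)], use p in auto)
  moreover have "card (insert p ?I) = Suc (card ?I)" using eps by simp
  ultimately show False using \<open>dim _ = card ?I\<close> by simp
qed

text \<open>One stage in isolation, with start \<open>a\<close>, moving index \<open>k\<close>
  counted from 0, and times \<open>T\<close>. Convexity of \<open>T\<close> makes the moment of
  crossing available; \<open>small\<close> says that \<open>n\<close> terms of size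
  \<open>exp (n * \<epsilon> - \<delta>)\<close> stay below the threshold 1/2.\<close>

locale segment =
  fixes u :: "real^'n::{finite,linorder}" and \<epsilon> \<delta> :: real and a :: "real list" and k :: nat
    and T :: "real set"
  assumes u: "norm u = 1" and eps: "0 < \<epsilon>" and delta: "12 * \<epsilon> \<le> \<delta>"
    and small: "real CARD('n) * exp (real CARD('n) * \<epsilon> - \<delta>) < 1 / 2"
    and length_a: "length a = CARD('n)"
    and gap: "\<And>i j. i < j \<Longrightarrow> j < CARD('n) \<Longrightarrow> a ! i + \<delta> \<le> a ! j"
    and k: "k < CARD('n)"
    and T_ge: "\<And>t. t \<in> T \<Longrightarrow> sum_list a \<le> t" and T_start: "sum_list a \<in> T"
    and T_convex: "\<And>t t'. t \<in> T \<Longrightarrow> sum_list a \<le> t' \<Longrightarrow> t' \<le> t \<Longrightarrow> t' \<in> T"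
    and near: "\<And>t. t \<in> T \<Longrightarrow> minima_near u \<epsilon> t (a[k := a ! k + t - sum_list a])"
begin

lemma gap_iff: "i < CARD('n) \<Longrightarrow> j < CARD('n) \<Longrightarrow> i \<noteq> j \<Longrightarrow> \<delta> \<le> \<bar>a ! i - a ! j\<bar>"
  using gap[of i j] gap[of j i] by (cases i j rule: linorder_cases) auto

lemma near_start: "minima_near u \<epsilon> (sum_list a) a"
  using near[OF T_start] by simp

text \<open>When the moving coordinate crosses level \<open>a ! p\<close>, the space spanned by the points below
  that level has to change, for otherwise the first \<open>p\<close> minima would grow and then stop
  growing while their covolume is convex in the time.\<close>

lemma level_space_changes:
  assumes p: "p < CARD('n)" and kp: "k < p" and t: "t \<in> T"
    and b: "a ! p + \<delta> \<le> a ! k + t - sum_list a"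
  shows "level_space u (sum_list a) (a ! p - \<delta> / 2) \<noteq> level_space u t (a ! p + \<delta> / 2)"
proof
  let ?n = "CARD('n)"
  define V where "V = level_space u (sum_list a) (a ! p - \<delta> / 2)"
  assume "level_space u (sum_list a) (a ! p - \<delta> / 2) = level_space u t (a ! p + \<delta> / 2)"
  then have V': "V = level_space u t (a ! p + \<delta> / 2)" by (simp add: V_def)
  have subV: "subspace V" by (simp add: V_def subspace_level_space)
  define vt where "vt = a[k := a ! k + t - sum_list a]"
  \<comment> \<open>The moment of crossing: the moving coordinate equals \<open>a ! p\<close>, so
    \<open>v0\<close> has this value in both slots \<open>k\<close> and \<open>p\<close>.\<close>
  define t0 where "t0 = sum_list a + (a ! p - a ! k)"
  define v0 where "v0 = a[k := a ! p]"
  have akp: "a ! k + \<delta> \<le> a ! p" using gap[OF kp p] .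
  have t0T: "t0 \<in> T"
    by (rule T_convex[OF t]) (use akp b eps delta in \<open>auto simp: t0_def\<close>)
  have near0: "minima_near u \<epsilon> t0 v0" using near[OF t0T] by (simp add: t0_def v0_def)
  have neart: "minima_near u \<epsilon> t vt" using near[OF t] by (simp add: vt_def)
  obtain W where W: "inj_on W {..<?n}" "independent (W ` {..<?n})"
    "\<And>i. i < ?n \<Longrightarrow> W i \<in> integer_points"
    "\<And>i. i < ?n \<Longrightarrow> L_point u (W i) (sum_list a) \<le> a ! i + \<epsilon>"
    using minima_near_realized[OF near_start] by blast
  obtain Z where Z: "inj_on Z {..<?n}" "independent (Z ` {..<?n})"
    "\<And>i. i < ?n \<Longrightarrow> Z i \<in> integer_points"
    "\<And>i. i < ?n \<Longrightarrow> L_point u (Z i) t \<le> vt ! i + \<epsilon>"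
    using minima_near_realized[OF neart] by blast
  obtain Y where Y: "inj_on Y {..<?n}" "independent (Y ` {..<?n})"
    "\<And>i. i < ?n \<Longrightarrow> Y i \<in> integer_points"
    "\<And>i. i < ?n \<Longrightarrow> L_point u (Y i) t0 \<le> v0 ! i + \<epsilon>"
    using minima_near_realized[OF near0] by blast
  have dimV: "dim V = p"
  proof -
    have "dim V = card {i. i < ?n \<and> a ! i + \<epsilon> \<le> a ! p - \<delta> / 2}"
      unfolding V_def
    proof (rule dim_level_space[OF near_start])
      fix i assume "i < ?n"
      then show "a ! i + \<epsilon> \<le> a ! p - \<delta> / 2 \<or> a ! p - \<delta> / 2 < a ! i - \<epsilon>"
        using gap_iff[of i p] p eps delta by (cases "i = p") (auto simp: abs_if split: if_splits)
    qed (use eps in auto)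
    also have "{i. i < ?n \<and> a ! i + \<epsilon> \<le> a ! p - \<delta> / 2} = {..<p}"
    proof (intro set_eqI iffI)
      fix i assume "i \<in> {i. i < ?n \<and> a ! i + \<epsilon> \<le> a ! p - \<delta> / 2}"
      then show "i \<in> {..<p}" using gap[of p i] eps delta by (cases i p rule: linorder_cases) auto
    next
      fix i assume "i \<in> {..<p}"
      then show "i \<in> {i. i < ?n \<and> a ! i + \<epsilon> \<le> a ! p - \<delta> / 2}" using gap[of i p] p eps delta by auto
    qed
    finally show ?thesis by simp
  qed
  have spanW: "span (W ` {..<p}) = V"
  proof (rule span_independent_eq[OF subV])
    show "W ` {..<p} \<subseteq> V"
    proof (rule image_subsetI)
      fix i assume i: "i \<in> {..<p}"
      then have "a ! i + \<epsilon> \<le> a ! p - \<delta> / 2" using gap[of i p] p eps delta by auto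
      then show "W i \<in> V"
        unfolding V_def using i p W(3,4)[of i] by (intro level_space_base) auto
    qed
    show "independent (W ` {..<p})" by (rule independent_mono[OF W(2)]) (use p in auto)
    have "inj_on W {..<p}" by (rule inj_on_subset[OF W(1)]) (use p in auto)
    then show "dim V = card (W ` {..<p})" by (simp add: dimV card_image)
  qed
  \<comment> \<open>At time \<open>t\<close> the moving coordinate is above level \<open>p\<close>,
    so the \<open>p\<close> lowest slots are those up to \<open>p\<close> other than
    \<open>k\<close>. The slot \<open>p\<close> takes the place of \<open>k\<close>, and the heights
    become those of \<open>v0\<close>.\<close>
  define \<tau> where "\<tau> i = (if i = k then p else i)" for i
  have tau: "\<tau> i < ?n" "\<tau> i \<noteq> k" "vt ! \<tau> i = v0 ! i" "vt ! \<tau> i \<le> a ! p" if "i < p" for i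
    using that p kp k length_a gap[of i p] eps delta
    by (auto simp: \<tau>_def vt_def v0_def)
  have spanZ: "span ((Z \<circ> \<tau>) ` {..<p}) = V"
  proof (rule span_independent_eq[OF subV])
    show "(Z \<circ> \<tau>) ` {..<p} \<subseteq> V"
    proof (rule image_subsetI)
      fix i assume "i \<in> {..<p}"
      then show "(Z \<circ> \<tau>) i \<in> V"
        unfolding V' using tau[of i] Z(3,4)[of "\<tau> i"] eps delta by (intro level_space_base) auto
    qed
    have sub: "\<tau> ` {..<p} \<subseteq> {..<?n}" using tau by auto
    show "independent ((Z \<circ> \<tau>) ` {..<p})"
      unfolding image_comp[symmetric] by (rule independent_mono[OF Z(2)]) (rule image_mono[OF sub])
    have "inj_on \<tau> {..<p}" by (auto simp: \<tau>_def inj_on_def)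
    then have "inj_on (Z \<circ> \<tau>) {..<p}"
      by (rule comp_inj_on) (rule inj_on_subset[OF Z(1) sub])
    then show "dim V = card ((Z \<circ> \<tau>) ` {..<p})" by (simp add: dimV card_image del: o_apply)
  qed
  \<comment> \<open>The basis of \<open>V\<close> is completed to a basis of the whole space by
    points realizing minima at the crossing.\<close>
  obtain B where B: "W ` {..<p} \<subseteq> B" "B \<subseteq> W ` {..<p} \<union> Y ` {..<?n}" "independent B"
    "W ` {..<p} \<union> Y ` {..<?n} \<subseteq> span B"
  proof (rule maximal_independent_subset_extend[of "W ` {..<p}" "W ` {..<p} \<union> Y ` {..<?n}"])
    show "independent (W ` {..<p})" by (rule independent_mono[OF W(2)]) (use p in auto)
  qed auto
  have spanY: "span (Y ` {..<?n}) = UNIV"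
    by (rule span_independent_eq) (simp_all add: Y card_image)
  have spanB: "span B = UNIV"
    using span_minimal[of "Y ` {..<?n}" "span B"] B(4) spanY by (auto simp: subspace_span)
  have cardB: "card B = ?n"
    using dim_span_eq_card_independent[OF B(3)] unfolding spanB by simp
  define J where "J = {j. j < ?n \<and> Y j \<in> B - W ` {..<p}}"
  have YJ: "Y ` J = B - W ` {..<p}" using B(2) by (auto simp: J_def)
  have cardW: "card (W ` {..<p}) = p"
    using inj_on_subset[OF W(1), of "{..<p}"] p by (simp add: card_image)
  have finB: "finite B" using B(3) by (rule independent_imp_finite)
  have "card J = card (Y ` J)"
    by (rule card_image[symmetric]) (rule inj_on_subset[OF Y(1)], auto simp: J_def)
  also have "\<dots> = ?n - p"
    unfolding YJ using B(1) finB by (simp add: card_Diff_subset finite_subset cardB cardW)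
  finally have cardJ: "card J = ?n - p" .
  have finJ: "finite J" by (simp add: J_def)
  obtain \<sigma> where \<sigma>: "bij_betw \<sigma> {p..<?n} J"
    using finite_same_card_bij[of "{p..<?n}" J] finJ cardJ by auto
  have \<sigma>J: "\<sigma> i < ?n" if "p \<le> i" "i < ?n" for i
  proof -
    have "\<sigma> i \<in> J" using \<sigma> that by (auto simp: bij_betw_def)
    then show ?thesis by (simp add: J_def)
  qed
  define S where "S = {i::'n. pos i < p}"
  define w z y where "w = (\<lambda>i::'n. W (pos i))" and "z = (\<lambda>i::'n. if i \<in> S then Z (\<tau> (pos i)) else 0)"
    and "y = (\<lambda>i::'n. if i \<in> S then 0 else Y (\<sigma> (pos i)))"
  have wS: "w ` S = W ` {..<p}"
    unfolding w_def S_def by (rule pos_image_reindex) (use p in auto)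
  have zS: "z ` S = (Z \<circ> \<tau>) ` {..<p}"
  proof -
    have "z ` S = (\<lambda>i. (Z \<circ> \<tau>) (pos i)) ` S" by (rule image_cong) (auto simp: z_def)
    also have "\<dots> = (Z \<circ> \<tau>) ` {..<p}" unfolding S_def by (rule pos_image_reindex) (use p in auto)
    finally show ?thesis .
  qed
  have yS: "y ` (- S) = B - W ` {..<p}"
  proof -
    have "y ` (- S) = (\<lambda>i. (Y \<circ> \<sigma>) (pos i)) ` (- S)" by (rule image_cong) (auto simp: y_def)
    also have "\<dots> = (Y \<circ> \<sigma>) ` {p..<?n}" unfolding S_def by (rule pos_image_reindex) (use p in auto)
    also have "\<dots> = Y ` J" unfolding image_comp[symmetric] using \<sigma> by (simp add: bij_betw_def)
    finally show ?thesis unfolding YJ .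
  qed
  have un: "w ` S \<union> y ` (- S) = B" unfolding wS yS using B(1) by auto
  \<comment> \<open>\<beta> bounds trajectories at time \<open>t\<close> although it is written with
    \<open>v0\<close>: the slots selected by \<tau> have the same heights in
    \<open>vt\<close>.\<close>
  define \<alpha> \<beta> \<gamma> where "\<alpha> i = a ! pos i + \<epsilon>" and "\<beta> i = v0 ! pos i + \<epsilon>"
    and "\<gamma> i = v0 ! \<sigma> (pos i) + \<epsilon>" for i :: 'n
  have ple: "p \<le> ?n" using p by simp
  have sum\<alpha>: "(\<Sum>i\<in>S. \<alpha> i) = (\<Sum>i<p. a ! i) + real p * \<epsilon>"
    unfolding S_def \<alpha>_def using sum_pos_reindex(1)[OF ple, of "\<lambda>i. a ! i + \<epsilon>"] by (simp add: sum.distrib)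
  have sum\<beta>: "(\<Sum>i\<in>S. \<beta> i) = (\<Sum>i<p. v0 ! i) + real p * \<epsilon>"
    unfolding S_def \<beta>_def using sum_pos_reindex(1)[OF ple, of "\<lambda>i. v0 ! i + \<epsilon>"] by (simp add: sum.distrib)
  have sum\<gamma>: "(\<Sum>i\<in>-S. \<gamma> i) = (\<Sum>j\<in>J. v0 ! j) + real (?n - p) * \<epsilon>"
  proof -
    have "(\<Sum>i\<in>-S. \<gamma> i) = (\<Sum>i\<in>{p..<?n}. v0 ! \<sigma> i + \<epsilon>)"
      unfolding S_def \<gamma>_def using sum_pos_reindex(2)[OF ple, of "\<lambda>i. v0 ! \<sigma> i + \<epsilon>"] .
    also have "\<dots> = (\<Sum>i\<in>{p..<?n}. v0 ! \<sigma> i) + real (?n - p) * \<epsilon>" by (simp add: sum.distrib)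
    also have "(\<Sum>i\<in>{p..<?n}. v0 ! \<sigma> i) = (\<Sum>j\<in>J. v0 ! j)"
      by (rule sum.reindex_bij_betw[OF \<sigma>])
    finally show ?thesis .
  qed
  have v0sum: "(\<Sum>i<?n. v0 ! i) = t0"
  proof -
    have "sum_list v0 = t0"
      using k length_a by (simp add: v0_def t0_def sum_list_list_update)
    then show ?thesis using length_a by (simp add: sum_list_sum_nth v0_def atLeast0LessThan)
  qed
  have v0p: "(\<Sum>i<p. v0 ! i) = (\<Sum>i<p. a ! i) + (a ! p - a ! k)"
  proof -
    have "(\<Sum>i<p. v0 ! i) = v0 ! k + (\<Sum>i\<in>{..<p} - {k}. v0 ! i)"
      using kp by (simp add: sum.remove)
    also have "(\<Sum>i\<in>{..<p} - {k}. v0 ! i) = (\<Sum>i\<in>{..<p} - {k}. a ! i)"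
      by (rule sum.cong) (auto simp: v0_def)
    also have "v0 ! k = a ! p" using k length_a by (simp add: v0_def)
    finally show ?thesis using kp by (simp add: sum.remove[of "{..<p}" k])
  qed
  \<comment> \<open>The indices outside \<open>J\<close> are \<open>p\<close> in number, so their
    heights sum to at least the \<open>p\<close> lowest ones; all heights together sum to
    \<open>t0\<close>.\<close>
  have v0J: "(\<Sum>j\<in>J. v0 ! j) \<le> t0 - (\<Sum>i<p. v0 ! i)"
  proof -
    have "(\<Sum>i<p. v0 ! i) \<le> (\<Sum>j\<in>{..<?n} - J. v0 ! j)"
    proof (rule sum_le_sum_exchange[of _ _ _ "a ! p"])
      have "J \<subseteq> {..<?n}" by (auto simp: J_def)
      then show "card ({..<?n} - J) = card {..<p}" using cardJ finJ p by (simp add: card_Diff_subset)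
      show "v0 ! i \<le> a ! p" if "i \<in> {..<p}" for i
        using tau[of i] that by auto
      show "a ! p \<le> v0 ! i" if "i \<in> {..<?n} - J - {..<p}" for i
        using that kp length_a gap[of p i] eps delta by (cases "i = p") (auto simp: v0_def nth_list_update)
    qed auto
    moreover have "(\<Sum>i<?n. v0 ! i) = (\<Sum>j\<in>{..<?n} - J. v0 ! j) + (\<Sum>j\<in>J. v0 ! j)"
      by (rule sum.subset_diff) (auto simp: J_def)
    ultimately show ?thesis using v0sum by linarith
  qed
  have split: "real p * \<epsilon> + real (?n - p) * \<epsilon> = real ?n * \<epsilon>"
    using p by (simp add: of_nat_diff algebra_simps)
  show False
  proof (rule no_common_span[OF u, of w z y S \<alpha> \<beta> t \<gamma> t0 "\<delta> - real ?n * \<epsilon>"])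
    show "w i \<in> integer_points" for i using W(3) by (simp add: w_def pos_lt_CARD)
    show "z i \<in> integer_points" for i
      using Z(3) tau(1) by (simp add: z_def S_def integer_points_0)
    show "y i \<in> integer_points" for i
      using Y(3) \<sigma>J[of "pos i"] by (simp add: y_def S_def integer_points_0 pos_lt_CARD)
    show "span (w ` S) = span (z ` S)" unfolding wS zS spanW spanZ ..
    show "span (w ` S \<union> y ` (- S)) = UNIV" unfolding un by (rule spanB)
    show "independent (w ` S \<union> y ` (- S))" unfolding un by (rule B(3))
    show "w ` S \<inter> y ` (- S) = {}" unfolding wS yS by auto
    show "norm (w i) \<le> exp (\<alpha> i)" for i
      unfolding w_def \<alpha>_def using W(4)[OF pos_lt_CARD] by (rule norm_le_exp_L_point)
    show "norm (z i) \<le> exp (\<beta> i)" "\<bar>z i \<bullet> u\<bar> \<le> exp (\<beta> i - t)" if "i \<in> S" for i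
    proof -
      have "L_point u (z i) t \<le> \<beta> i"
        using Z(4)[of "\<tau> (pos i)"] tau[of "pos i"] that by (simp add: z_def \<beta>_def S_def)
      then show "norm (z i) \<le> exp (\<beta> i)" "\<bar>z i \<bullet> u\<bar> \<le> exp (\<beta> i - t)"
        by (rule norm_le_exp_L_point, rule inner_le_exp_L_point)
    qed
    show "norm (y i) \<le> exp (\<gamma> i)" "\<bar>y i \<bullet> u\<bar> \<le> exp (\<gamma> i - t0)" if "i \<notin> S" for i
    proof -
      have "L_point u (y i) t0 \<le> \<gamma> i"
        using Y(4)[of "\<sigma> (pos i)"] \<sigma>J[of "pos i"] that by (simp add: y_def \<gamma>_def S_def pos_lt_CARD)
      then show "norm (y i) \<le> exp (\<gamma> i)" "\<bar>y i \<bullet> u\<bar> \<le> exp (\<gamma> i - t0)"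
        by (rule norm_le_exp_L_point, rule inner_le_exp_L_point)
    qed
    \<comment> \<open>The gain is \<open>a ! p - a ! k\<close>, the rise of the moving coordinate
      before the crossing. In the next estimate it is \<open>t - t0\<close>, the rise after it; both
      are at least \<delta>.\<close>
    show "(\<Sum>i\<in>S. \<alpha> i) + (\<Sum>i\<in>-S. \<gamma> i) - t0 \<le> - (\<delta> - real ?n * \<epsilon>)"
      unfolding sum\<alpha> sum\<gamma> using v0J v0p akp split by linarith
    show "(\<Sum>i\<in>S. \<beta> i) + (\<Sum>i\<in>-S. \<gamma> i) - t \<le> - (\<delta> - real ?n * \<epsilon>)"
      unfolding sum\<beta> sum\<gamma> using v0J b split by (simp add: t0_def)
    show "real ?n * exp (- (\<delta> - real ?n * \<epsilon>)) < 1 / 2" using small by simp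
  qed
qed

text \<open>The later space \<open>V3\<close> lies in the earlier one, \<open>V1\<close>. Without a
  crossing their dimensions agree. With one, \<open>V3\<close> has one dimension less than both
  \<open>V1\<close> and \<open>V2\<close>, so if \<open>x\<close> were in \<open>V1\<close>, adding
  \<open>x\<close> to \<open>V3\<close> would give \<open>V1\<close> as well as \<open>V2\<close>,
  against \<open>level_space_changes\<close>.\<close>

lemma not_in_level_space_backwards:
  assumes p: "p < CARD('n)" "p \<noteq> k" and t: "t \<in> T"
    and b: "\<delta> \<le> \<bar>a ! k + t - sum_list a - a ! p\<bar>"
    and x: "x \<in> integer_points" "L_point u x t \<le> a ! p + \<epsilon>"
      "x \<notin> level_space u t (a ! p - \<delta> / 2)"
  shows "x \<notin> level_space u (sum_list a) (a ! p - \<delta> / 2)"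
proof
  let ?n = "CARD('n)"
  assume xV: "x \<in> level_space u (sum_list a) (a ! p - \<delta> / 2)"
  define V1 where "V1 = level_space u (sum_list a) (a ! p - \<delta> / 2)"
  define V2 where "V2 = level_space u t (a ! p + \<delta> / 2)"
  define V3 where "V3 = level_space u t (a ! p - \<delta> / 2)"
  have subs: "subspace V1" "subspace V2" "subspace V3"
    by (simp_all add: V1_def V2_def V3_def subspace_level_space)
  have V31: "V3 \<subseteq> V1" unfolding V1_def V3_def using T_ge[OF t] by (intro level_space_mono) auto
  have V32: "V3 \<subseteq> V2" unfolding V2_def V3_def using eps delta by (intro level_space_mono) auto
  define vt where "vt = a[k := a ! k + t - sum_list a]"
  have neart: "minima_near u \<epsilon> t vt" using near[OF t] by (simp add: vt_def)
  have vt: "vt ! i = (if i = k then a ! k + t - sum_list a else a ! i)" if "i < ?n" for i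
    using that length_a by (simp add: vt_def)
  have low: "a ! i + \<epsilon> \<le> a ! p - \<delta> / 2 \<longleftrightarrow> i < p" "a ! i + \<epsilon> \<le> a ! p + \<delta> / 2 \<longleftrightarrow> i \<le> p" if "i < ?n" for i
    using gap[of i p] gap[of p i] that p eps delta by (cases i p rule: linorder_cases; force)+
  have gaps: "vt ! i + \<epsilon> \<le> a ! p + r * \<delta> / 2 \<or> a ! p + r * \<delta> / 2 < vt ! i - \<epsilon>"
    if "i < ?n" "r = 1 \<or> r = - 1" for i r
    using gap_iff[of i p] that p b eps delta
    by (cases "i = k"; cases "i = p") (auto simp: vt abs_if split: if_splits)
  have "dim V1 = card {i. i < ?n \<and> a ! i + \<epsilon> \<le> a ! p - \<delta> / 2}"
    unfolding V1_def
  proof (rule dim_level_space[OF near_start])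
    fix i assume "i < ?n"
    then show "a ! i + \<epsilon> \<le> a ! p - \<delta> / 2 \<or> a ! p - \<delta> / 2 < a ! i - \<epsilon>"
      using gap_iff[of i p] p eps delta by (cases "i = p") (auto simp: abs_if split: if_splits)
  qed (use eps in auto)
  also have "{i. i < ?n \<and> a ! i + \<epsilon> \<le> a ! p - \<delta> / 2} = {..<p}" using low p by auto
  finally have dim1: "dim V1 = p" by simp
  have dim3: "dim V3 = card {i. i < ?n \<and> vt ! i + \<epsilon> \<le> a ! p - \<delta> / 2}"
    unfolding V3_def by (rule dim_level_space[OF neart]) (use gaps[of _ "- 1"] eps in auto)
  have dim2: "dim V2 = card {i. i < ?n \<and> vt ! i + \<epsilon> \<le> a ! p + \<delta> / 2}"
    unfolding V2_def by (rule dim_level_space[OF neart]) (use gaps[of _ 1] eps in auto)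
  show False
  proof (cases "k < p \<and> a ! p + \<delta> \<le> a ! k + t - sum_list a")
    case False
    have "{i. i < ?n \<and> vt ! i + \<epsilon> \<le> a ! p - \<delta> / 2} = {..<p}"
    proof (intro set_eqI)
      fix i
      have "a ! k + t - sum_list a + \<epsilon> \<le> a ! p - \<delta> / 2 \<longleftrightarrow> k < p"
        using False b p k gap[of p k] T_ge[OF t] eps delta
        by (cases k p rule: linorder_cases) (auto simp: abs_if split: if_splits)
      then show "i \<in> {i. i < ?n \<and> vt ! i + \<epsilon> \<le> a ! p - \<delta> / 2} \<longleftrightarrow> i \<in> {..<p}"
        using low(1)[of i] p by (auto simp: vt split: if_splits)
    qed
    then have "dim V3 = p" using dim3 by simp
    then have "V3 = V1" using V31 subs dim1 by (intro subspace_dim_equal) auto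
    then show False using xV x(3) by (simp add: V1_def V3_def)
  next
    case True
    have "{i. i < ?n \<and> vt ! i + \<epsilon> \<le> a ! p - \<delta> / 2} = {..<p} - {k}"
      using low(1) p True eps delta by (auto simp: vt split: if_splits)
    then have dim3': "dim V3 = p - 1" using dim3 True by simp
    have "{i. i < ?n \<and> vt ! i + \<epsilon> \<le> a ! p + \<delta> / 2} = {..p} - {k}"
      using low(2) p True eps delta by (auto simp: vt split: if_splits)
    then have dim2': "dim V2 = p" using dim2 True by simp
    have "x \<notin> span V3"
      using x(3) subs(3) unfolding V3_def[symmetric] by (simp only: span_eq_iff[THEN iffD2] simp_thms)
    then have dimx: "dim (insert x V3) = p" using dim3' True by (simp add: dim_insert)
    have x2: "x \<in> V2" unfolding V2_def by (rule level_space_base) (use x eps delta in auto)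
    have "span (insert x V3) = V1"
      using span_minimal[of "insert x V3" V1] subs(1) V31 xV dimx dim1
      by (intro subspace_dim_equal) (auto simp: V1_def subspace_span)
    moreover have "span (insert x V3) = V2"
      using span_minimal[of "insert x V3" V2] subs(2) V32 x2 dimx dim2'
      by (intro subspace_dim_equal) (auto simp: subspace_span)
    ultimately show False
      using level_space_changes[OF p(1) _ t] True by (simp add: V1_def V2_def)
  qed
qed

end


section \<open>Canvases\<close>

lemma omit_Suc: "omit (Suc m) xs = take m xs @ drop (Suc m) xs"
  by (simp add: omit_def)

lemma length_omit: "m < length xs \<Longrightarrow> length (omit (Suc m) xs) = length xs - 1"
  by (simp add: omit_Suc)

lemma mset_list_update_omit: "m < length xs \<Longrightarrow> mset (xs[m := x]) = add_mset x (mset (omit (Suc m) xs))"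
  by (simp add: omit_Suc upd_conv_take_nth_drop)

lemma mset_omit: "m < length xs \<Longrightarrow> mset xs = add_mset (xs ! m) (mset (omit (Suc m) xs))"
  using mset_list_update_omit[of m xs "xs ! m"] by simp

lemma map_omit: "map f (omit m xs) = omit m (map f xs)"
  by (simp add: omit_def take_map drop_map)

lemma omit_nth_ge: "m \<le> j \<Longrightarrow> Suc j < length xs \<Longrightarrow> omit (Suc m) xs ! j = xs ! Suc j"
  by (simp add: omit_Suc nth_append min_def)

lemma set_omit:
  assumes "m < length xs" "distinct xs"
  shows "set (omit (Suc m) xs) = {xs ! j |j. j < length xs \<and> j \<noteq> m}"
proof -
  have "distinct (xs ! m # omit (Suc m) xs)"
    using assms mset_omit[OF assms(1)] by (metis mset.simps(2) mset_eq_imp_distinct_iff)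
  moreover have "set xs = insert (xs ! m) (set (omit (Suc m) xs))"
    using mset_omit[OF assms(1)] by (metis set_mset_add_mset_insert set_mset_mset)
  ultimately have "set (omit (Suc m) xs) = set xs - {xs ! m}" by auto
  also have "\<dots> = {xs ! j |j. j < length xs \<and> j \<noteq> m}"
    using assms nth_eq_iff_index_eq[OF assms(2)] by (auto simp: set_conv_nth)
  finally show ?thesis .
qed

lemma sum_list_eq_omit:
  fixes xs :: "'b::ab_group_add list"
  assumes "m < length xs"
  shows "sum_list xs = xs ! m + sum_list (omit (Suc m) xs)"
proof -
  have "sum_list xs = sum_list (take m xs @ xs ! m # drop (Suc m) xs)"
    using id_take_nth_drop[OF assms] by simp
  then show ?thesis by (simp add: omit_Suc algebra_simps)
qed

lemma sum_list_omit:
  fixes f :: "'a \<Rightarrow> 'b::ab_group_add"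
  assumes "m < length xs"
  shows "sum_list (map f (omit (Suc m) xs)) = (\<Sum>j\<in>{1..length xs} - {Suc m}. f (coord xs j))"
proof -
  have "sum_list (map f xs) = (\<Sum>j<length xs. f (xs ! j))"
    by (simp add: sum_list_sum_nth atLeast0LessThan)
  also have "\<dots> = (\<Sum>j\<in>{1..length xs}. f (coord xs j))"
    by (rule sum.reindex_bij_witness[of _ "\<lambda>j. j - 1" Suc]) auto
  also have "\<dots> = f (xs ! m) + (\<Sum>j\<in>{1..length xs} - {Suc m}. f (coord xs j))"
    using assms by (subst sum.remove[of _ "Suc m"]) auto
  also have "sum_list (map f xs) = f (xs ! m) + sum_list (map f (omit (Suc m) xs))"
    using sum_list_eq_omit[of m "map f xs"] assms by (simp add: map_omit)
  finally show ?thesis by simp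
qed

lemma sort_eqI: "mset xs = mset ys \<Longrightarrow> sort xs = sort ys"
  by (metis sorted_list_of_multiset_mset)

lemma linf_dist_le_iff:
  assumes "length xs = length ys" "xs \<noteq> []"
  shows "linf_dist xs ys \<le> e \<longleftrightarrow> (\<forall>j<length xs. \<bar>xs ! j - ys ! j\<bar> \<le> e)"
proof -
  have eq: "{\<bar>x - y\<bar> |x y. (x, y) \<in> set (zip xs ys)} = (\<lambda>j. \<bar>xs ! j - ys ! j\<bar>) ` {..<length xs}"
    using assms(1) by (auto simp: set_zip image_def)
  show ?thesis unfolding linf_dist_def eq using assms(2) by (subst Max_le_iff) auto
qed

lemma sort_nth_le_add:
  fixes xs ys :: "real list"
  assumes len: "length xs = length ys" and le: "\<And>i. i < length xs \<Longrightarrow> xs ! i \<le> ys ! i + e"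
    and j: "j < length xs"
  shows "sort xs ! j \<le> sort ys ! j + e"
proof -
  have "j < length (filter (\<lambda>y. y \<le> sort ys ! j) ys)"
    using sort_nth_le_iff[of j ys "sort ys ! j"] j len by simp
  also have "\<dots> \<le> length (filter (\<lambda>x. x \<le> sort ys ! j + e) xs)"
    unfolding length_filter_conv_card using len le by (intro card_mono) force+
  finally show ?thesis using sort_nth_le_iff[of j xs] j by simp
qed

text \<open>A member of least cardinality equals all later ones.\<close>

lemma nested_finite_nonempty:
  fixes A :: "nat \<Rightarrow> 'a set"
  assumes dec: "\<And>m. A (Suc m) \<subseteq> A m" and fin: "finite (A 0)" and ne: "\<And>m. A m \<noteq> {}"
  shows "\<exists>x. \<forall>m. x \<in> A m"
proof -
  have sub: "A m' \<subseteq> A m" if "m \<le> m'" for m m'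
    using lift_Suc_antimono_le[of A, OF dec that] .
  have fins: "finite (A m)" for m using sub[of 0 m] fin finite_subset by blast
  obtain m where m: "\<And>m'. card (A m) \<le> card (A m')"
    using ex_has_least_nat[of "\<lambda>_. True" 0 "\<lambda>m. card (A m)"] by auto
  obtain x where x: "x \<in> A m" using ne by blast
  have "x \<in> A m'" for m'
  proof (cases "m \<le> m'")
    case True
    then have "A m' = A m" using card_subset_eq[OF fins sub] m[of m'] card_mono[OF fins sub[OF True]] by force
    then show ?thesis using x by simp
  next
    case False
    then show ?thesis using sub[of m' m] x by auto
  qed
  then show ?thesis by blast
qed

section \<open>A canvas whose system follows the minima of \<open>u\<close>\<close>

locale approximated_canvas =
  fixes u :: "real^'n::{finite,linorder}" and c1 \<epsilon> \<delta> :: real and s :: enat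
    and a :: "nat \<Rightarrow> real list" and k l :: "nat \<Rightarrow> nat" and P :: "real \<Rightarrow> real list"
  assumes dim_ge_2: "2 \<le> CARD('n)"
    and c1: "c1 = 2 ^ CARD('n) * real CARD('n) * ln (real CARD('n))"
    and eps: "0 < \<epsilon>" and delta: "6 * (real CARD('n) * \<epsilon> + c1) \<le> \<delta>"
    and canvas: "canvas (CARD('n)) \<delta> s a k l"
    and attached: "attached_system s a k P"
    and u: "norm u = 1"
    and close: "\<forall>t \<ge> switch_number a 0. linf_dist (P t) (L_map u t) \<le> \<epsilon>"
begin

abbreviation "q \<equiv> switch_number a"

text \<open>Unlike \<open>switch_interval\<close> it is closed on the right, because consecutive
  stages are compared at their common end.\<close>

definition times :: "nat \<Rightarrow> real set" where
  "times i = {t. q i \<le> t \<and> (enat (i + 1) < s \<longrightarrow> t \<le> q (i + 1))}"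

lemma c1_ge: "ln (real CARD('n)) \<le> c1" "real CARD('n) * ln (real CARD('n)) \<le> c1"
proof -
  have "1 * ln (real CARD('n)) \<le> real CARD('n) * ln (real CARD('n))"
    using dim_ge_2 by (intro mult_right_mono) auto
  moreover have "1 * (real CARD('n) * ln (real CARD('n))) \<le> 2 ^ CARD('n) * (real CARD('n) * ln (real CARD('n)))"
    using dim_ge_2 by (intro mult_right_mono) auto
  ultimately show "ln (real CARD('n)) \<le> c1" "real CARD('n) * ln (real CARD('n)) \<le> c1"
    unfolding c1 mult.assoc by linarith+
qed

lemma ln_2_le: "ln 2 \<le> ln (real CARD('n))"
  using dim_ge_2 by simp

lemma c1_pos: "0 < c1"
  using c1_ge(1) ln_2_le ln_gt_zero[of "2::real"] by linarith

lemma delta': "6 * (real CARD('n) * \<epsilon>) + 6 * c1 \<le> \<delta>"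
  using delta by (simp only: distrib_left)

lemma delta_12: "12 * \<epsilon> \<le> \<delta>"
proof -
  have "2 * \<epsilon> \<le> real CARD('n) * \<epsilon>" using dim_ge_2 eps by (intro mult_right_mono) auto
  then show ?thesis using delta' c1_pos by linarith
qed

text \<open>Since \<open>c1\<close> is at least \<open>ln n\<close>, the exponent is at most
  \<open>- 3 * ln n\<close>, and the product is at most the inverse square of \<open>n\<close>,
  hence at most 1/4.\<close>

lemma small: "real CARD('n) * exp (real CARD('n) * \<epsilon> - \<delta>) < 1 / 2"
proof -
  have "0 \<le> real CARD('n) * \<epsilon>" using eps by simp
  then have "real CARD('n) * \<epsilon> - \<delta> \<le> - (3 * ln (real CARD('n)))"
    using delta' c1_ge(1) c1_pos by linarith
  then have "exp (real CARD('n) * \<epsilon> - \<delta>) \<le> exp (- (3 * ln (real CARD('n))))" by simp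
  also have "\<dots> = inverse (real CARD('n) ^ 3)"
    using dim_ge_2 exp_of_nat_mult[of 3 "ln (real CARD('n))"] by (simp add: exp_minus)
  finally have "real CARD('n) * exp (real CARD('n) * \<epsilon> - \<delta>) \<le> real CARD('n) * inverse (real CARD('n) ^ 3)"
    by (intro mult_left_mono) auto
  also have "\<dots> = inverse ((real CARD('n))\<^sup>2)"
    using dim_ge_2 by (simp add: field_simps power3_eq_cube power2_eq_square)
  also have "\<dots> \<le> inverse (2\<^sup>2)"
    using dim_ge_2 by (intro le_imp_inverse_le power_mono) auto
  finally show ?thesis by simp
qed

lemma Suc_lt_s: "enat (i + 1) < s \<Longrightarrow> enat i < s"
  by (metis enat_ord_simps(2) le_add1 less_add_one order_less_trans)

lemma length_a: "enat i < s \<Longrightarrow> length (a i) = CARD('n)"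
  using canvas by (simp add: canvas_def)

lemma gap:
  assumes i: "enat i < s" and mj: "m < j" "j < CARD('n)"
  shows "a i ! m + \<delta> \<le> a i ! j"
proof -
  have sorted: "sorted_wrt (<) (a i)" and mult: "\<forall>x \<in> set (a i). \<exists>m::nat. 0 < m \<and> x = real m * \<delta>"
    using canvas i by (auto simp: canvas_def)
  obtain r r' :: nat where r: "a i ! m = real r * \<delta>" "a i ! j = real r' * \<delta>"
    using mult mj length_a[OF i] by (metis nth_mem order_less_trans)
  have "a i ! m < a i ! j"
    using sorted mj length_a[OF i] by (auto simp: sorted_wrt_iff_nth_less)
  then have "r < r'" unfolding r using delta_12 eps by (simp add: mult_less_cancel_right_disj)
  then have "(real r + 1) * \<delta> \<le> real r' * \<delta>"
    using delta_12 eps by (intro mult_right_mono) auto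
  then show ?thesis unfolding r by (simp add: algebra_simps)
qed

lemma delta_pos: "0 < \<delta>"
  using delta_12 eps by linarith

lemma distinct_a: "enat i < s \<Longrightarrow> distinct (a i)"
  using canvas by (auto simp: canvas_def strict_sorted_iff)

lemma sorted_a: "enat i < s \<Longrightarrow> sorted (a i)"
  using canvas by (auto simp: canvas_def strict_sorted_iff)

text \<open>Counterparts of \<open>k\<close> and \<open>l\<close> counted from 0, as
  \<open>!\<close> requires.\<close>

definition K :: "nat \<Rightarrow> nat" where "K i = k i - 1"
definition L :: "nat \<Rightarrow> nat" where "L i = l i - 1"

lemma canvas_start: "1 \<le> k 0" "k 0 \<le> l 0" "l 0 = CARD('n)"
  using canvas by (simp_all add: canvas_def)

lemma canvas_index: "enat i < s \<Longrightarrow> 1 \<le> i \<Longrightarrow> 1 \<le> k i \<and> k i < l i \<and> l i \<le> CARD('n)"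
  using canvas unfolding canvas_def by blast

lemma k_bounds: "enat i < s \<Longrightarrow> 1 \<le> k i \<and> k i \<le> l i \<and> l i \<le> CARD('n)"
  using canvas_start canvas_index[of i] by (cases "i = 0") auto

lemma k_eq: "enat i < s \<Longrightarrow> k i = Suc (K i)" and K_lt: "enat i < s \<Longrightarrow> K i < CARD('n)"
  using k_bounds[of i] by (auto simp: K_def)

lemma l_eq: "enat i < s \<Longrightarrow> l i = Suc (L i)" and L_lt: "enat i < s \<Longrightarrow> L i < CARD('n)"
  using k_bounds[of i] by (auto simp: L_def)

lemma K_less_L: "enat i < s \<Longrightarrow> 1 \<le> i \<Longrightarrow> K i < L i"
  using canvas_index[of i] by (auto simp: K_def L_def)

context
  fixes i assumes i: "enat (i + 1) < s"
begin

lemma K_le_L: "K i \<le> L (i + 1)"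
  using canvas i by (auto simp: canvas_def K_def L_def)

lemma omit_eq: "omit (Suc (K i)) (a i) = omit (Suc (L (i + 1))) (a (i + 1))"
  using canvas i k_eq[OF Suc_lt_s[OF i]] l_eq[OF i] by (auto simp: canvas_def)

lemma jump: "a i ! L (i + 1) + \<delta> \<le> a (i + 1) ! L (i + 1)"
  using canvas i by (auto simp: canvas_def L_def)

text \<open>The other coordinates of the two tuples coincide, so the elapsed time is the rise of the
  moving coordinate from its old height to the newly inserted one.\<close>

lemma q_Suc: "q (i + 1) = q i + a (i + 1) ! L (i + 1) - a i ! K i"
proof -
  have "sum_list (a i) = a i ! K i + sum_list (omit (Suc (K i)) (a i))"
    using K_lt length_a Suc_lt_s[OF i] by (intro sum_list_eq_omit) simp
  moreover have "sum_list (a (i + 1)) = a (i + 1) ! L (i + 1) + sum_list (omit (Suc (L (i + 1))) (a (i + 1)))"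
    using L_lt[OF i] length_a[OF i] by (intro sum_list_eq_omit) simp
  ultimately show ?thesis using omit_eq by (simp add: switch_number_def)
qed

lemma q_Suc_ge: "q i + \<delta> \<le> q (i + 1)"
proof -
  have "a i ! K i \<le> a i ! L (i + 1)"
    using gap[OF Suc_lt_s[OF i], of "K i" "L (i + 1)"] K_le_L L_lt[OF i] delta_pos
    by (cases "K i = L (i + 1)") auto
  then show ?thesis unfolding q_Suc using jump by linarith
qed

text \<open>Above \<open>L (i + 1)\<close>, hence also above \<open>K i\<close>, both omissions
  shift the index by one.\<close>

lemma above_eq: "L (i + 1) < j \<Longrightarrow> j < CARD('n) \<Longrightarrow> a i ! j = a (i + 1) ! j"
  using omit_nth_ge[of "K i" "j - 1" "a i"] omit_nth_ge[of "L (i + 1)" "j - 1" "a (i + 1)"]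
    omit_eq K_le_L length_a[OF i] length_a[OF Suc_lt_s[OF i]] by simp

end

lemma q_0_le: "enat i < s \<Longrightarrow> q 0 \<le> q i"
proof (induction i)
  case (Suc i)
  then show ?case using q_Suc_ge[of i] Suc_lt_s[of i] delta_pos by simp
qed simp

text \<open>The right end belongs to the next stage, but there the moving coordinate has just become
  the inserted height, so both stages give the same multiset.\<close>

lemma P_eq:
  assumes i: "enat i < s" and t: "t \<in> times i"
  shows "P t = sort ((a i)[K i := a i ! K i + t - q i])"
proof (cases "enat (i + 1) < s \<and> t = q (i + 1)")
  case False
  then have "t \<in> switch_interval s a i" using t by (auto simp: times_def switch_interval_def)
  then have "P t = sort (omit (k i) (a i) @ [coord (a i) (k i) + t - q i])"
    using attached i by (auto simp: attached_system_def)
  also have "\<dots> = sort ((a i)[K i := a i ! K i + t - q i])"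
    using mset_list_update_omit[of "K i" "a i"] K_lt[OF i] length_a[OF i]
    by (intro sort_eqI) (simp add: k_eq[OF i])
  finally show ?thesis .
next
  case True
  then have i': "enat (i + 1) < s" and t': "t = q (i + 1)" by auto
  have "t \<in> switch_interval s a (i + 1)"
    using q_Suc_ge[of "i + 1"] delta_pos by (auto simp: t' switch_interval_def)
  then have "P t = sort (omit (k (i + 1)) (a (i + 1)) @ [coord (a (i + 1)) (k (i + 1)) + t - q (i + 1)])"
    using attached i' by (auto simp: attached_system_def)
  also have "\<dots> = sort (a (i + 1))"
    using mset_omit[of "K (i + 1)" "a (i + 1)"] K_lt[OF i'] length_a[OF i']
    by (intro sort_eqI) (simp only: k_eq[OF i'] t' diff_Suc_1 mset_append mset.simps, simp)
  also have "\<dots> = sort ((a i)[K i := a i ! K i + t - q i])"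
  proof (rule sort_eqI)
    have "mset (a (i + 1)) = add_mset (a (i + 1) ! L (i + 1)) (mset (omit (Suc (K i)) (a i)))"
      using mset_omit[of "L (i + 1)" "a (i + 1)"] L_lt[OF i'] length_a[OF i'] omit_eq[OF i'] by simp
    also have "a (i + 1) ! L (i + 1) = a i ! K i + t - q i"
      using q_Suc[OF i'] by (simp add: t')
    finally show "mset (a (i + 1)) = mset ((a i)[K i := a i ! K i + t - q i])"
      using mset_list_update_omit[of "K i" "a i"] K_lt[OF i] length_a[OF i] by simp
  qed
  finally show ?thesis .
qed

lemma near:
  assumes i: "enat i < s" and t: "t \<in> times i"
  shows "minima_near u \<epsilon> t ((a i)[K i := a i ! K i + t - q i])"
proof -
  have "q 0 \<le> t" using q_0_le[OF i] t by (simp add: times_def)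
  then have "linf_dist (P t) (L_map u t) \<le> \<epsilon>" using close by blast
  moreover have "length (P t) = CARD('n)" using P_eq[OF i t] length_a[OF i] by simp
  moreover have "length (L_map u t) = CARD('n)" by (simp add: L_map_def)
  ultimately have "\<forall>j<CARD('n). \<bar>P t ! j - L_map u t ! j\<bar> \<le> \<epsilon>"
    using linf_dist_le_iff[of "P t" "L_map u t" \<epsilon>] by force
  moreover have "L_map u t ! j = L_min u (Suc j) t" if "j < CARD('n)" for j
    using that by (simp add: L_map_def del: upt_Suc)
  ultimately show ?thesis
    using P_eq[OF i t] length_a[OF i] by (simp add: minima_near_def)
qed

lemma segment: "enat i < s \<Longrightarrow> segment u \<epsilon> \<delta> (a i) (K i) (times i)"
  using near[of i] q_Suc_ge[of i] delta_pos small
  by unfold_locales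
    (auto simp: u eps delta_12 length_a gap K_lt times_def switch_number_def[symmetric])

lemma later_time: "enat i < s \<Longrightarrow> \<exists>t \<in> times i. q i + \<delta> \<le> t"
  using q_Suc_ge[of i] delta_pos
  by (intro bexI[of _ "if enat (i + 1) < s then q (i + 1) else q i + \<delta>"]) (auto simp: times_def)

text \<open>The last clause is for the stationary heights of an unbounded last stage: no later stage
  tests them, so the bound is imposed at all later times.\<close>

definition good :: "nat \<Rightarrow> real \<Rightarrow> (real, 'n) vec set" where
  "good i v = {x \<in> integer_points. L_point u x (q i) \<le> v + \<epsilon> \<and>
     x \<notin> level_space u (q i) (v - \<delta> / 2) \<and>
     (\<not> enat (i + 1) < s \<and> v \<in> set (omit (k i) (a i)) \<longrightarrow> (\<forall>t \<ge> q i. L_point u x t \<le> v + \<epsilon>))}"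

lemma finite_good: "finite (good i v)"
  by (rule finite_subset[OF _ finite_L_point_le[of u "q i" "v + \<epsilon>"]]) (auto simp: good_def)

lemma omit_value:
  assumes i: "enat i < s" and v: "v \<in> set (omit (k i) (a i))"
  obtains p where "p < CARD('n)" "p \<noteq> K i" "v = a i ! p"
  using v set_omit[of "K i" "a i"] distinct_a[OF i] K_lt[OF i] length_a[OF i] k_eq[OF i] by auto

text \<open>In general this is \<open>good_point_exists\<close>. In an unbounded last stage, points
  that are good at ever later times are pulled back to its start; they form nested finite sets, and
  a common element satisfies the bound at all times.\<close>

lemma good_nonempty:
  assumes i: "enat i < s" and v: "v \<in> set (a i)"
  shows "good i v \<noteq> {}"
proof (cases "\<not> enat (i + 1) < s \<and> v \<in> set (omit (k i) (a i))")
  case False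
  interpret segment u \<epsilon> \<delta> "a i" "K i" "times i" by (rule segment[OF i])
  obtain p where p: "p < CARD('n)" "v = a i ! p" using v length_a by (auto simp: in_set_conv_nth)
  obtain x where "x \<in> integer_points" "L_point u x (sum_list (a i)) \<le> a i ! p + \<epsilon>"
    "x \<notin> level_space u (sum_list (a i)) (a i ! p - \<delta> / 2)"
    using good_point_exists[OF near_start p(1), of \<delta>] gap_iff[OF _ p(1)] eps delta by auto
  then show ?thesis using False p(2) by (auto simp: good_def switch_number_def)
next
  case True
  interpret segment u \<epsilon> \<delta> "a i" "K i" "times i" by (rule segment[OF i])
  obtain p where p: "p < CARD('n)" "p \<noteq> K i" "v = a i ! p" using omit_value[OF i] True by blast
  \<comment> \<open>From this time on the moving coordinate exceeds \<open>a i ! p\<close> by at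
    least \<delta>.\<close>
  define \<tau> where "\<tau> = q i + \<bar>a i ! p - a i ! K i\<bar> + \<delta>"
  \<comment> \<open>The level space is taken at the start of the stage, not at the time of the
    bound, which makes the sets decrease with \<open>m\<close>.\<close>
  define A where "A m = {x \<in> integer_points. L_point u x (\<tau> + real m) \<le> v + \<epsilon> \<and>
     x \<notin> level_space u (q i) (v - \<delta> / 2)}" for m
  have "\<exists>x. \<forall>m. x \<in> A m"
  proof (rule nested_finite_nonempty)
    show "A (Suc m) \<subseteq> A m" for m
    proof
      fix x assume "x \<in> A (Suc m)"
      moreover have "L_point u x (\<tau> + real m) \<le> L_point u x (\<tau> + real (Suc m))"
        by (rule L_point_mono) simp
      ultimately show "x \<in> A m" by (auto simp: A_def)
    qed
    show "finite (A 0)"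
      by (rule finite_subset[OF _ finite_L_point_le[of u "\<tau> + real 0" "v + \<epsilon>"]]) (auto simp: A_def)
    show "A m \<noteq> {}" for m
    proof -
      define t where "t = \<tau> + real m"
      have t: "t \<in> times i" using True delta_pos by (auto simp: times_def t_def \<tau>_def)
      define b where "b = a i ! K i + t - sum_list (a i)"
      have b: "a i ! p + \<delta> \<le> b" by (simp add: b_def t_def \<tau>_def switch_number_def)
      have nth: "(a i)[K i := b] ! j = (if j = K i then b else a i ! j)" if "j < CARD('n)" for j
        using that length_a by simp
      have "\<exists>x. x \<in> integer_points \<and> L_point u x t \<le> (a i)[K i := b] ! p + \<epsilon> \<and>
          x \<notin> level_space u t ((a i)[K i := b] ! p - \<delta> / 2)"
      proof (rule good_point_exists[OF _ p(1)])
        show "minima_near u \<epsilon> t ((a i)[K i := b])" using near[OF t] by (simp add: b_def)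
        show "\<delta> \<le> \<bar>(a i)[K i := b] ! j - (a i)[K i := b] ! p\<bar>" if "j < CARD('n)" "j \<noteq> p" for j
          using that p b gap_iff[of j p] by (auto simp: nth)
      qed (use eps delta in auto)
      then obtain x where x: "x \<in> integer_points" "L_point u x t \<le> a i ! p + \<epsilon>"
        "x \<notin> level_space u t (a i ! p - \<delta> / 2)"
        using p by (auto simp: nth)
      have "x \<notin> level_space u (sum_list (a i)) (a i ! p - \<delta> / 2)"
        by (rule not_in_level_space_backwards[OF p(1,2) t _ x]) (use b in \<open>simp add: b_def\<close>)
      then have "x \<in> A m" using x by (simp add: A_def t_def p(3) switch_number_def)
      then show ?thesis by blast
    qed
  qed
  then obtain x where x: "\<And>m. x \<in> A m" by blast
  have bound: "L_point u x t \<le> v + \<epsilon>" for t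
  proof -
    obtain m :: nat where "t - \<tau> \<le> real m" using real_arch_simple by blast
    then have "L_point u x t \<le> L_point u x (\<tau> + real m)" by (intro L_point_mono) simp
    also have "\<dots> \<le> v + \<epsilon>" using x[of m] by (simp add: A_def)
    finally show ?thesis .
  qed
  then have "x \<in> good i v" using x[of 0] by (simp add: good_def A_def)
  then show ?thesis by blast
qed

text \<open>At the end of the stage the moving coordinate is the inserted height, a value of the
  next tuple other than \<open>v\<close> and so at distance at least \<delta> from it;
  \<open>not_in_level_space_backwards\<close> applies.\<close>

lemma good_Suc_subset:
  assumes i: "enat (i + 1) < s" and v: "v \<in> set (omit (k i) (a i))"
  shows "good (i + 1) v \<subseteq> good i v"
proof
  fix x assume x: "x \<in> good (i + 1) v"
  have i0: "enat i < s" using Suc_lt_s[OF i] .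
  interpret segment u \<epsilon> \<delta> "a i" "K i" "times i" by (rule segment[OF i0])
  obtain p where p: "p < CARD('n)" "p \<noteq> K i" "v = a i ! p" using omit_value[OF i0 v] .
  have "v \<in> set (omit (Suc (L (i + 1))) (a (i + 1)))"
    using v omit_eq[OF i] k_eq[OF i0] by simp
  then obtain p' where p': "p' < CARD('n)" "p' \<noteq> L (i + 1)" "v = a (i + 1) ! p'"
    using set_omit[of "L (i + 1)" "a (i + 1)"] distinct_a[OF i] L_lt[OF i]
      approximated_canvas.length_a[OF approximated_canvas_axioms i] by auto
  have "\<delta> \<le> \<bar>a (i + 1) ! L (i + 1) - v\<bar>"
    using approximated_canvas.gap[OF approximated_canvas_axioms i, of p' "L (i + 1)"]
      approximated_canvas.gap[OF approximated_canvas_axioms i, of "L (i + 1)" p'] p' L_lt[OF i]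
    by (cases p' "L (i + 1)" rule: linorder_cases) auto
  moreover have "a (i + 1) ! L (i + 1) = a i ! K i + q (i + 1) - sum_list (a i)"
    using q_Suc[OF i] by (simp add: switch_number_def)
  ultimately have b: "\<delta> \<le> \<bar>a i ! K i + q (i + 1) - sum_list (a i) - a i ! p\<bar>" by (simp add: p(3))
  have t: "q (i + 1) \<in> times i" using q_Suc_ge[OF i] delta_pos by (simp add: times_def)
  have "x \<notin> level_space u (sum_list (a i)) (a i ! p - \<delta> / 2)"
    by (rule not_in_level_space_backwards[OF p(1,2) t b]) (use x p(3) in \<open>auto simp: good_def\<close>)
  moreover have "L_point u x (q i) \<le> L_point u x (q (i + 1))"
    using q_Suc_ge[OF i] delta_pos by (intro L_point_mono) simp
  ultimately show "x \<in> good i v" using x i p(3) by (auto simp: good_def switch_number_def)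
qed

text \<open>Only stages before \<open>j\<close> are restricted, so \<open>survives i i v\<close>
  always holds.\<close>

definition survives :: "nat \<Rightarrow> nat \<Rightarrow> real \<Rightarrow> bool" where
  "survives i j v \<longleftrightarrow> (\<forall>r. i \<le> r \<and> r < j \<longrightarrow> enat (r + 1) < s \<and> v \<in> set (omit (k r) (a r)))"

definition best :: "nat \<Rightarrow> real \<Rightarrow> (real, 'n) vec set" where
  "best i v = {x. \<forall>j \<ge> i. survives i j v \<longrightarrow> x \<in> good j v}"

lemma survivor_mem:
  assumes "enat (i + 1) < s" "v \<in> set (omit (k i) (a i))"
  shows "v \<in> set (a (i + 1))"
proof -
  have "v \<in> set (omit (Suc (L (i + 1))) (a (i + 1)))"
    using assms omit_eq k_eq[OF Suc_lt_s] by simp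
  then show ?thesis by (auto simp: omit_Suc dest: in_set_takeD in_set_dropD)
qed

text \<open>\<open>B m\<close> collects the conditions of the stages up to \<open>i + m\<close>.
  Good sets decrease while \<open>v\<close> survives, so \<open>B m\<close> contains the good set of
  the last stage reached by \<open>v\<close>, which is nonempty.\<close>

lemma best_nonempty:
  assumes i: "enat i < s" and v: "v \<in> set (a i)"
  shows "best i v \<noteq> {}"
proof -
  define B where "B m = {x. \<forall>j. i \<le> j \<and> j \<le> i + m \<and> survives i j v \<longrightarrow> x \<in> good j v}" for m
  \<comment> \<open>\<open>j\<close> is the last stage up to \<open>i + m\<close> that
    \<open>v\<close> reaches; it stops growing when the survival ends.\<close>
  have ex: "\<exists>j. enat j < s \<and> v \<in> set (a j) \<and> good j v \<subseteq> B m \<and> (survives i (i + m) v \<longrightarrow> j = i + m)" for m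
  proof (induction m)
    case 0
    have "good i v \<subseteq> B 0" by (auto simp: B_def)
    then show ?case using i v by (intro exI[of _ i]) simp
  next
    case (Suc m)
    then obtain j where j: "enat j < s" "v \<in> set (a j)" "good j v \<subseteq> B m"
      "survives i (i + m) v \<longrightarrow> j = i + m" by blast
    show ?case
    proof (cases "survives i (i + Suc m) v")
      case True
      then have "survives i (i + m) v" by (simp add: survives_def)
      then have jm: "j = i + m" using j(4) by simp
      have step: "enat (j + 1) < s" "v \<in> set (omit (k j) (a j))"
        using True by (auto simp: survives_def jm)
      have "good (j + 1) v \<subseteq> B (Suc m)"
      proof
        fix x assume x: "x \<in> good (j + 1) v"
        then have "x \<in> B m" using good_Suc_subset[OF step] j(3) by blast
        then show "x \<in> B (Suc m)" using x by (auto simp: B_def jm le_Suc_eq)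
      qed
      then show ?thesis
        using step(1) survivor_mem[OF step] by (intro exI[of _ "j + 1"]) (auto simp: jm)
    next
      case False
      then have "B (Suc m) = B m" by (auto simp: B_def le_Suc_eq)
      then show ?thesis using j False by (intro exI[of _ j]) auto
    qed
  qed
  have "\<exists>x. \<forall>m. x \<in> B m"
  proof (rule nested_finite_nonempty)
    show "B (Suc m) \<subseteq> B m" for m by (auto simp: B_def)
    have "B 0 \<subseteq> good i v" by (auto simp: B_def survives_def)
    then show "finite (B 0)" using finite_good finite_subset by blast
    show "B m \<noteq> {}" for m using ex[of m] good_nonempty by blast
  qed
  then obtain x where x: "\<And>m. x \<in> B m" by blast
  have "x \<in> best i v"
    unfolding best_def
  proof (intro CollectI allI impI)
    fix j assume "i \<le> j" "survives i j v"
    then show "x \<in> good j v" using x[of "j - i"] by (simp add: B_def)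
  qed
  then show ?thesis by blast
qed

lemma best_subset_good: "best i v \<subseteq> good i v"
  by (auto simp: best_def survives_def)

text \<open>The stage \<open>i\<close> adds a condition to those of the later stages, but
  \<open>good_Suc_subset\<close> makes it a consequence of the condition at stage
  \<open>i + 1\<close>.\<close>

lemma best_Suc:
  assumes "enat (i + 1) < s" "v \<in> set (omit (k i) (a i))"
  shows "best i v = best (i + 1) v"
proof -
  have surv: "survives i j v \<longleftrightarrow> survives (i + 1) j v" if "i + 1 \<le> j" for j
    unfolding survives_def using assms by (metis Suc_eq_plus1 Suc_leD Suc_leI le_neq_implies_less)
  show ?thesis
  proof
    show "best i v \<subseteq> best (i + 1) v" using surv by (auto simp: best_def)
    show "best (i + 1) v \<subseteq> best i v"
    proof
      fix x assume x: "x \<in> best (i + 1) v"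
      then have "x \<in> good i v" using best_subset_good good_Suc_subset[OF assms] by blast
      moreover have "x \<in> good j v" if "i < j" "survives i j v" for j
        using x surv[of j] that by (auto simp: best_def)
      ultimately show "x \<in> best i v" by (auto simp: best_def le_less)
    qed
  qed
qed

text \<open>The choice depends only on the set \<open>best i v\<close>, so consecutive stages with
  equal sets select the same point.\<close>

definition pt :: "nat \<Rightarrow> real \<Rightarrow> (real, 'n) vec" where
  "pt i v = (SOME x. x \<in> best i v)"

definition pts :: "nat \<Rightarrow> (real, 'n) vec list" where
  "pts i = map (pt i) (a i)"

lemma pt_Suc: "enat (i + 1) < s \<Longrightarrow> v \<in> set (omit (k i) (a i)) \<Longrightarrow> pt i v = pt (i + 1) v"
  by (simp add: pt_def best_Suc)

lemma omit_pts:
  assumes "enat (i + 1) < s"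
  shows "omit (k i) (pts i) = omit (l (i + 1)) (pts (i + 1))"
proof -
  have "omit (k i) (pts i) = map (pt i) (omit (k i) (a i))" by (simp add: pts_def map_omit)
  also have "\<dots> = map (pt (i + 1)) (omit (k i) (a i))"
    using pt_Suc[OF assms] by (intro map_cong) auto
  also have "omit (k i) (a i) = omit (l (i + 1)) (a (i + 1))"
    using omit_eq[OF assms] k_eq[OF Suc_lt_s[OF assms]] l_eq[OF assms] by simp
  finally show ?thesis by (simp add: pts_def map_omit)
qed

lemma pt_good: "enat i < s \<Longrightarrow> v \<in> set (a i) \<Longrightarrow> pt i v \<in> good i v"
  using best_nonempty[of i v] best_subset_good[of i v] unfolding pt_def
  by (metis someI_ex ex_in_conv subsetD)

end


section \<open>The points attached to a canvas\<close>

context approximated_canvas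
begin

definition x :: "nat \<Rightarrow> nat \<Rightarrow> (real, 'n) vec" where
  "x i p = pt i (a i ! p)"

lemma length_pts: "enat i < s \<Longrightarrow> length (pts i) = CARD('n)"
  by (simp add: pts_def length_a)

lemma nth_pts: "enat i < s \<Longrightarrow> p < CARD('n) \<Longrightarrow> pts i ! p = x i p"
  by (simp add: pts_def x_def length_a)

lemma set_take_pts: "enat i < s \<Longrightarrow> m \<le> CARD('n) \<Longrightarrow> set (take m (pts i)) = x i ` {..<m}"
  using nth_image[of m "pts i"] length_pts[of i] nth_pts[of i]
  by (metis (no_types, lifting) atLeast0LessThan image_cong lessThan_iff order_less_le_trans)

lemma set_pts: "enat i < s \<Longrightarrow> set (pts i) = x i ` {..<CARD('n)}"
  using set_take_pts[of i "CARD('n)"] by (simp add: length_pts)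

lemma x_good:
  assumes "enat i < s" "p < CARD('n)"
  shows "x i p \<in> integer_points" "L_point u (x i p) (q i) \<le> a i ! p + \<epsilon>"
    "x i p \<notin> level_space u (q i) (a i ! p - \<delta> / 2)"
  using pt_good[of i "a i ! p"] assms by (auto simp: x_def good_def length_a)

text \<open>The point of index \<open>m\<close> avoids a level space that contains all points of
  smaller index.\<close>

lemma x_independent:
  assumes i: "enat i < s" and m: "m \<le> CARD('n)"
  shows "inj_on (x i) {..<m} \<and> independent (x i ` {..<m})"
  using m
proof (induction m)
  case 0
  then show ?case by (simp add: independent_empty)
next
  case (Suc m)
  have "x i ` {..<m} \<subseteq> level_space u (q i) (a i ! m - \<delta> / 2)"
  proof (rule image_subsetI)
    fix p assume p: "p \<in> {..<m}"
    then have "a i ! p + \<epsilon> \<le> a i ! m - \<delta> / 2"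
      using gap[OF i, of p m] Suc.prems delta_12 eps by auto
    then show "x i p \<in> level_space u (q i) (a i ! m - \<delta> / 2)"
      using x_good(1,2)[OF i, of p] p Suc.prems by (intro level_space_base) auto
  qed
  then have "span (x i ` {..<m}) \<subseteq> level_space u (q i) (a i ! m - \<delta> / 2)"
    by (rule span_minimal) (rule subspace_level_space)
  then have notin: "x i m \<notin> span (x i ` {..<m})"
    using x_good(3)[OF i, of m] Suc.prems by auto
  then have "x i m \<notin> x i ` {..<m}" using span_superset by (meson subsetD)
  moreover have "inj_on (x i) {..<m}" "independent (x i ` {..<m})" using Suc by simp_all
  ultimately show ?case
    using independent_insertI[OF notin] unfolding lessThan_Suc image_insert
    by (simp add: inj_on_insert)
qed

lemma lin_indep_pts: "enat i < s \<Longrightarrow> lin_indep_tuple (pts i)"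
  unfolding lin_indep_tuple_def distinct_conv_nth set_pts
  using x_independent[of i "CARD('n)"] nth_pts[of i] length_pts[of i]
  by (metis inj_onD lessThan_iff order_refl)

lemma span_pts: "enat i < s \<Longrightarrow> span (x i ` {..<CARD('n)}) = UNIV"
  using x_independent[of i "CARD('n)"] 
  by (intro span_independent_eq) (simp_all add: card_image)

lemma x_nonzero: "enat i < s \<Longrightarrow> p < CARD('n) \<Longrightarrow> x i p \<noteq> 0"
  using x_independent[of i "CARD('n)"] dependent_zero[of "x i ` {..<CARD('n)}"]
  by (metis imageI lessThan_iff order_refl)

lemma omit_a_iff:
  assumes i: "enat i < s" and p: "p < CARD('n)"
  shows "a i ! p \<in> set (omit (k i) (a i)) \<longleftrightarrow> p \<noteq> K i"
  using set_omit[of "K i" "a i"] distinct_a[OF i] K_lt[OF i] length_a[OF i] k_eq[OF i] p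
    nth_eq_iff_index_eq[OF distinct_a[OF i]] by auto

text \<open>The point of a surviving height is also its point at the next stage, where it is good;
  monotonicity carries the bound back. In the last stage the extra clause of \<open>good\<close> is
  used.\<close>

lemma x_stays:
  assumes i: "enat i < s" and p: "p < CARD('n)" "p \<noteq> K i" and t: "t \<in> times i"
  shows "L_point u (x i p) t \<le> a i ! p + \<epsilon>"
proof (cases "enat (i + 1) < s")
  case True
  have v: "a i ! p \<in> set (omit (k i) (a i))" using omit_a_iff[OF i p(1)] p(2) by simp
  have "pt (i + 1) (a i ! p) \<in> good (i + 1) (a i ! p)"
    by (rule pt_good[OF True survivor_mem[OF True v]])
  then have "L_point u (x i p) (q (i + 1)) \<le> a i ! p + \<epsilon>"
    using pt_Suc[OF True v] by (simp add: good_def x_def)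
  moreover have "L_point u (x i p) t \<le> L_point u (x i p) (q (i + 1))"
    using t True by (intro L_point_mono) (simp add: times_def)
  ultimately show ?thesis by linarith
next
  case False
  then show ?thesis
    using pt_good[OF i, of "a i ! p"] omit_a_iff[OF i p(1)] p length_a[OF i] t
    by (auto simp: good_def x_def times_def)
qed

lemma x_moves:
  assumes i: "enat i < s" and p: "p < CARD('n)" and t: "t \<in> times i"
  shows "L_point u (x i p) t \<le> (a i)[K i := a i ! K i + t - q i] ! p + \<epsilon>"
proof (cases "p = K i")
  case True
  have "L_point u (x i p) t \<le> L_point u (x i p) (q i) + (t - q i)"
    using t by (intro L_point_slope) (simp add: times_def)
  then show ?thesis using x_good(2)[OF i p] True p length_a[OF i] by simp
next
  case False
  then show ?thesis using x_stays[OF i p False t] by simp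
qed

text \<open>From above each trajectory is bounded by its own slot. From below no independent integer
  system beats the minima, which are within \<epsilon> of the sorted heights.\<close>

lemma approximates:
  assumes i: "enat i < s" and t: "t \<in> times i"
  shows "linf_dist (P t) (sort (map (\<lambda>y. L_point u y t) (pts i))) \<le> \<epsilon>"
proof -
  define vs where "vs = (a i)[K i := a i ! K i + t - q i]"
  define ys where "ys = map (\<lambda>y. L_point u y t) (pts i)"
  have P: "P t = sort vs" using P_eq[OF i t] by (simp add: vs_def)
  have len: "length vs = CARD('n)" "length ys = CARD('n)"
    using length_a[OF i] length_pts[OF i] by (simp_all add: vs_def ys_def)
  have "\<bar>sort vs ! j - sort ys ! j\<bar> \<le> \<epsilon>" if j: "j < CARD('n)" for j
  proof -
    have "sort ys ! j \<le> sort vs ! j + \<epsilon>"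
    proof (rule sort_nth_le_add)
      fix p assume "p < length ys"
      then show "ys ! p \<le> vs ! p + \<epsilon>"
        using x_moves[OF i _ t, of p] len by (simp add: ys_def vs_def length_pts[OF i] nth_pts[OF i])
    qed (use len j in auto)
    moreover have "L_min u (Suc j) t \<le> sort ys ! j"
      unfolding ys_def
    proof (rule L_min_le_sort)
      show "set (pts i) \<subseteq> integer_points" using x_good(1)[OF i] by (auto simp: set_pts[OF i])
    qed (use lin_indep_pts[OF i] length_pts[OF i] j in \<open>auto simp: lin_indep_tuple_def\<close>)
    moreover have "\<bar>sort vs ! j - L_min u (Suc j) t\<bar> \<le> \<epsilon>"
      using near[OF i t] j by (simp add: minima_near_def vs_def)
    ultimately show ?thesis by linarith
  qed
  then show ?thesis
    unfolding P ys_def[symmetric] using len by (subst linf_dist_le_iff) (auto simp flip: length_0_conv)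
qed

lemma q_times: "enat i < s \<Longrightarrow> q i \<in> times i"
  using q_Suc_ge[of i] delta_pos by (auto simp: times_def)

lemma L_min_start:
  assumes i: "enat i < s" and p: "p < CARD('n)"
  shows "a i ! p - \<epsilon> \<le> L_min u (Suc p) (q i)"
proof -
  have "minima_near u \<epsilon> (q i) (a i)" using near[OF i q_times[OF i]] by simp
  moreover have "sort (a i) = a i" using sorted_a[OF i] by (rule sorted_sort_id)
  ultimately have "\<bar>a i ! p - L_min u (Suc p) (q i)\<bar> \<le> \<epsilon>" using p by (simp add: minima_near_def)
  then show ?thesis by linarith
qed

text \<open>If the point of index \<open>p\<close> were shorter, then together with the points of
  smaller index, lower by almost \<delta>, it would force the minimum of index \<open>p + 1\<close>
  below \<open>a i ! p - \<epsilon>\<close>.\<close>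

lemma x_start_ge:
  assumes i: "enat i < s" and p: "p < CARD('n)"
  shows "a i ! p - \<epsilon> \<le> L_point u (x i p) (q i)"
proof (rule ccontr)
  assume less: "\<not> ?thesis"
  define c where "c = max (a i ! p - \<delta> + \<epsilon>) (L_point u (x i p) (q i))"
  have "short_system u (Suc p) (q i) c"
    unfolding short_system_def
  proof (intro exI[of _ "x i ` {..<Suc p}"] conjI)
    show "x i ` {..<Suc p} \<subseteq> integer_points" using x_good(1)[OF i] p by auto
    show "independent (x i ` {..<Suc p})" "card (x i ` {..<Suc p}) = Suc p"
      using x_independent[OF i, of "Suc p"] p by (simp_all add: card_image)
    show "\<forall>y\<in>x i ` {..<Suc p}. L_point u y (q i) \<le> c"
    proof (rule ballI, elim imageE)
      fix y p' assume y: "y = x i p'" "p' \<in> {..<Suc p}"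
      show "L_point u y (q i) \<le> c"
      proof (cases "p' = p")
        case False
        then have "L_point u y (q i) \<le> a i ! p - \<delta> + \<epsilon>"
          using y x_good(2)[OF i, of p'] gap[OF i, of p' p] p by auto
        then show ?thesis by (simp add: c_def)
      qed (simp add: c_def y)
    qed
  qed
  then have "L_min u (Suc p) (q i) \<le> c" using p by (intro L_min_le) auto
  moreover have "c < a i ! p - \<epsilon>" using less delta_12 eps by (simp add: c_def)
  ultimately show False using L_min_start[OF i p] by linarith
qed

lemma ln_norm_x_le:
  assumes i: "enat i < s" and p: "p < CARD('n)"
  shows "ln (norm (x i p)) \<le> a i ! p + \<epsilon>"
  using x_good(2)[OF i p] ln_norm_le_L_point order_trans by blast

text \<open>The lower bound holds for the trajectory at \<open>q i\<close>, so it must be shown to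
  come from the norm. A stationary point on its rising branch would rise by \<delta> within the
  stage. The moving point is inherited from the previous stage because \<open>K i < L i\<close>, and
  its trajectory had the same lower bound there.\<close>

lemma ln_norm_x_ge:
  assumes i: "enat i < s" and i1: "1 \<le> i" and p: "p < CARD('n)"
  shows "a i ! p - \<epsilon> \<le> ln (norm (x i p))"
proof (cases "ln (norm (x i p)) < L_point u (x i p) (q i)")
  case False
  then show ?thesis using x_start_ge[OF i p] by linarith
next
  case rising: True
  show ?thesis
  proof (cases "p = K i")
    case False
    obtain t where t: "t \<in> times i" "q i + \<delta> \<le> t" using later_time[OF i] by blast
    have "L_point u (x i p) t = L_point u (x i p) (q i) + (t - q i)"
      by (rule L_point_rising[OF rising]) (use t delta_pos in simp)
    then have False
      using x_stays[OF i p False t(1)] x_start_ge[OF i p] t(2) delta_12 eps by linarith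
    then show ?thesis ..
  next
    case True
    define i' where "i' = i - 1"
    have i': "i = i' + 1" using i1 by (simp add: i'_def)
    have s': "enat (i' + 1) < s" using i i' by simp
    note s0 = Suc_lt_s[OF s']
    have "p \<noteq> L i" using True K_less_L[OF i i1] by simp
    then have "a i ! p \<in> set (omit (Suc (L i)) (a i))"
      using set_omit[of "L i" "a i"] distinct_a[OF i] L_lt[OF i] length_a[OF i] p by auto
    then have v: "a i ! p \<in> set (omit (k i') (a i'))"
      using omit_eq[OF s'] k_eq[OF s0] i' by simp
    obtain p' where p': "p' < CARD('n)" "p' \<noteq> K i'" "a i ! p = a i' ! p'"
      using omit_value[OF s0 v] .
    have "x i p = x i' p'" using pt_Suc[OF s' v] p'(3) i' by (simp add: x_def)
    then have "a i ! p - \<epsilon> \<le> L_point u (x i p) (q i')"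
      using x_start_ge[OF s0 p'(1)] p'(3) by simp
    also have "\<dots> = max (ln (norm (x i p))) (L_point u (x i p) (q i) - (q i - q i'))"
      by (rule L_point_before_rising[OF rising]) (use q_Suc_ge[OF s'] delta_pos i' in simp)
    \<comment> \<open>Following the slope back over a time of at least \<delta> leads below
      \<open>a i ! p - \<epsilon>\<close>, so the maximum is the logarithm of the norm.\<close>
    finally show ?thesis
      using x_good(2)[OF i p] q_Suc_ge[OF s'] delta_12 eps unfolding i'[symmetric]
      by (auto simp: max_def split: if_splits)
  qed
qed

lemma P_start: "enat i < s \<Longrightarrow> P (q i) = a i"
  using P_eq[OF _ q_times, of i] sorted_a[of i] by (simp add: sorted_sort_id)

text \<open>Otherwise, with \<open>m = L (i + 1)\<close>, the new point and the \<open>m + 1\<close>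
  lowest old ones would be \<open>m + 2\<close> independent points of height about
  \<open>a (i + 1) ! m\<close> at time \<open>q i\<close>. But the corresponding minimum is near
  \<open>a i ! Suc m\<close>, which the switch leaves unchanged and which is higher by
  \<delta>.\<close>

lemma new_point_in_span:
  assumes i': "enat (i + 1) < s"
  shows "x (i + 1) (L (i + 1)) \<in> span (x i ` {..<Suc (L (i + 1))})"
proof (rule ccontr)
  define m where "m = L (i + 1)"
  define z where "z = x (i + 1) m"
  assume "x (i + 1) (L (i + 1)) \<notin> span (x i ` {..<Suc (L (i + 1))})"
  then have notin: "z \<notin> span (x i ` {..<Suc m})" by (simp add: z_def m_def)
  note i = Suc_lt_s[OF i']
  have m: "m < CARD('n)" using L_lt[OF i'] by (simp add: m_def)
  show False
  proof (cases "Suc m = CARD('n)")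
    case True
    then show False using notin span_pts[OF i] by simp
  next
    case False
    then have m': "Suc m < CARD('n)" using m by simp
    define c where "c = a (i + 1) ! m + \<epsilon>"
    have "short_system u (Suc (Suc m)) (q i) c"
      unfolding short_system_def
    proof (intro exI[of _ "insert z (x i ` {..<Suc m})"] conjI)
      have ind: "inj_on (x i) {..<Suc m}" "independent (x i ` {..<Suc m})"
        using x_independent[OF i, of "Suc m"] m' by simp_all
      show "independent (insert z (x i ` {..<Suc m}))"
        using ind(2) notin by (simp add: independent_insertI)
      have "z \<notin> x i ` {..<Suc m}" using notin span_superset by (meson subsetD)
      then show "card (insert z (x i ` {..<Suc m})) = Suc (Suc m)"
        using ind(1) by (simp add: card_image del: lessThan_Suc_eq_insert_0)
      have z: "z \<in> integer_points" "L_point u z (q (i + 1)) \<le> c"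
        using x_good(1,2)[OF i' m] by (simp_all add: z_def c_def)
      then show "insert z (x i ` {..<Suc m}) \<subseteq> integer_points"
        using x_good(1)[OF i] m' by auto
      have "L_point u z (q i) \<le> L_point u z (q (i + 1))"
        using q_Suc_ge[OF i'] delta_pos by (intro L_point_mono) simp
      then have 1: "L_point u z (q i) \<le> c" using z(2) by linarith
      have 2: "L_point u (x i p) (q i) \<le> c" if "p < Suc m" for p
      proof -
        have "a i ! p \<le> a i ! m"
          using gap[OF i, of p m] that m delta_pos by (cases "p = m") auto
        moreover have "a i ! m + \<delta> \<le> a (i + 1) ! m" using jump[OF i'] by (simp add: m_def)
        ultimately show ?thesis
          using x_good(2)[OF i, of p] that m delta_pos by (simp add: c_def)
      qed
      show "\<forall>y\<in>insert z (x i ` {..<Suc m}). L_point u y (q i) \<le> c"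
        using 1 2 by blast
    qed
    then have "L_min u (Suc (Suc m)) (q i) \<le> c" using m' by (intro L_min_le) auto
    moreover have "a i ! Suc m = a (i + 1) ! Suc m"
      using m' by (intro above_eq[OF i']) (simp_all add: m_def)
    moreover have "a (i + 1) ! m + \<delta> \<le> a (i + 1) ! Suc m" using m' by (intro gap[OF i']) auto
    ultimately show False
      using L_min_start[OF i m'] delta_12 eps by (simp add: c_def)
  qed
qed

definition row_of :: "nat \<Rightarrow> 'n \<Rightarrow> (real, 'n) vec" where
  "row_of i j = x i (pos j)"

lemma tuple_det_pts: "enat i < s \<Longrightarrow> tuple_det (pts i) = det_rows (row_of i)"
  unfolding tuple_det_eq row_of_def by (simp add: nth_pts pos_lt_CARD)

lemma sum_pos: "(\<Sum>j\<in>(UNIV :: 'n set). f (pos j)) = (\<Sum>m<CARD('n). f m)" for f :: "nat \<Rightarrow> real"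
  by (rule sum.reindex_bij_betw[OF bij_betw_pos])

lemma sum_a: "enat i < s \<Longrightarrow> (\<Sum>j\<in>(UNIV :: 'n set). a i ! pos j + \<epsilon>) = q i + real CARD('n) * \<epsilon>"
  unfolding sum_pos[of "\<lambda>m. a i ! m + \<epsilon>"]
  by (simp add: sum.distrib switch_number_def sum_list_sum_nth length_a atLeast0LessThan)

lemma norm_row_le: "enat i < s \<Longrightarrow> norm (row_of i j) \<le> exp (a i ! pos j + \<epsilon>)"
  unfolding row_of_def by (rule norm_le_exp_L_point[OF x_good(2)]) (auto simp: pos_lt_CARD)

lemma det_pts_ge_1:
  assumes i: "enat i < s"
  shows "1 \<le> \<bar>tuple_det (pts i)\<bar>"
  unfolding tuple_det_pts[OF i]
proof (rule det_rows_integer)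
  show "row_of i j \<in> integer_points" for j
    unfolding row_of_def by (rule x_good(1)[OF i pos_lt_CARD])
  have "range (row_of i) = x i ` {..<CARD('n)}"
    using bij_betw_pos[where 'n = 'n] unfolding row_of_def bij_betw_def by (metis image_image)
  then show "span (range (row_of i)) = UNIV" using span_pts[OF i] by simp
qed

text \<open>At time \<open>q i\<close> the heights sum to the time, so each of the \<open>n\<close>
  terms of the expansion is at most \<open>exp (n * \<epsilon>)\<close>.\<close>

lemma det_pts_le:
  assumes i: "enat i < s"
  shows "\<bar>tuple_det (pts i)\<bar> \<le> real CARD('n) * exp (real CARD('n) * \<epsilon>)"
proof -
  have "tuple_det (pts i) = (\<Sum>j\<in>UNIV. (row_of i j \<bullet> u) * det_rows ((row_of i)(j := u)))"
    unfolding tuple_det_pts[OF i] using det_rows_perp[OF u, of UNIV "row_of i"] by simp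
  also have "\<bar>\<dots>\<bar> \<le> (\<Sum>j\<in>UNIV. \<bar>(row_of i j \<bullet> u) * det_rows ((row_of i)(j := u))\<bar>)"
    by (rule sum_abs)
  also have "\<dots> \<le> real CARD('n) * exp (real CARD('n) * \<epsilon>)"
  proof (rule sum_bounded_above)
    fix j :: 'n
    have "\<bar>(row_of i j \<bullet> u) * det_rows ((row_of i)(j := u))\<bar> \<le>
        exp ((\<Sum>m\<in>(UNIV :: 'n set). a i ! pos m + \<epsilon>) - q i)"
    proof (rule det_rows_term_le[OF u, where \<alpha> = "\<lambda>m. a i ! pos m + \<epsilon>", OF norm_row_le[OF i]])
      show "\<bar>row_of i j \<bullet> u\<bar> \<le> exp (a i ! pos j + \<epsilon> - q i)"
        unfolding row_of_def by (rule inner_le_exp_L_point[OF x_good(2)[OF i pos_lt_CARD]])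
    qed
    then show "\<bar>(row_of i j \<bullet> u) * det_rows ((row_of i)(j := u))\<bar> \<le> exp (real CARD('n) * \<epsilon>)"
      by (simp add: sum_a[OF i])
  qed
  finally show ?thesis .
qed

lemma ln_det_pts:
  assumes i: "enat i < s"
  shows "0 \<le> ln \<bar>tuple_det (pts i)\<bar>"
    and "ln \<bar>tuple_det (pts i)\<bar> \<le> real CARD('n) * \<epsilon> + ln (real CARD('n))"
proof -
  note ge = det_pts_ge_1[OF i]
  then show "0 \<le> ln \<bar>tuple_det (pts i)\<bar>" by simp
  have "ln \<bar>tuple_det (pts i)\<bar> \<le> ln (real CARD('n) * exp (real CARD('n) * \<epsilon>))"
    using ge det_pts_le[OF i] by (intro ln_mono) auto
  also have "\<dots> = real CARD('n) * \<epsilon> + ln (real CARD('n))"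
    by (simp add: ln_mult)
  finally show "ln \<bar>tuple_det (pts i)\<bar> \<le> real CARD('n) * \<epsilon> + ln (real CARD('n))" .
qed

text \<open>Until \<open>q (i + 1)\<close> only the \<open>k i\<close>-th point moves, so at a late time its term dominates
  the expansion of the determinant along \<open>u\<close>.\<close>

lemma norm_wedge_ge:
  assumes i: "enat i < s"
  shows "exp (q i - a i ! K i - \<epsilon>) / 2 \<le> norm (wedge_list (omit (k i) (pts i)))"
proof -
  define h where "h = (at_pos (K i) :: 'n)"
  have h: "pos h = K i" unfolding h_def by (rule pos_at_pos[OF K_lt[OF i]])
  define e where "e j = (row_of i j \<bullet> u) * det_rows ((row_of i)(j := u))" for j
  obtain t where t: "t \<in> times i" "q i + \<delta> \<le> t" using later_time[OF i] by blast
  \<comment> \<open>Stationary points keep their heights up to \<open>t\<close>, so their inner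
    products with \<open>u\<close> gain a factor \<open>exp (- \<delta>)\<close> over the bound at
    \<open>q i\<close>.\<close>
  have "\<bar>\<Sum>j\<in>- {h}. e j\<bar> < 1 / 2"
  proof (rule sum_abs_less_half[OF _ _ small])
    fix j assume j: "j \<in> - {h}"
    have "pos j \<noteq> K i" using j h by (metis ComplD at_pos_pos singletonI)
    then have "\<bar>row_of i j \<bullet> u\<bar> \<le> exp (a i ! pos j + \<epsilon> - t)"
      unfolding row_of_def by (intro inner_le_exp_L_point x_stays[OF i pos_lt_CARD _ t(1)])
    then have "\<bar>e j\<bar> \<le> exp ((\<Sum>m\<in>(UNIV :: 'n set). a i ! pos m + \<epsilon>) - t)"
      unfolding e_def by (rule det_rows_term_le[OF u, where \<alpha> = "\<lambda>m. a i ! pos m + \<epsilon>", OF norm_row_le[OF i]])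
    also have "\<dots> \<le> exp (real CARD('n) * \<epsilon> - \<delta>)" using t(2) by (simp add: sum_a[OF i])
    finally show "\<bar>e j\<bar> \<le> exp (real CARD('n) * \<epsilon> - \<delta>)" .
  qed simp
  moreover have "tuple_det (pts i) = e h + (\<Sum>j\<in>- {h}. e j)"
  proof -
    have "tuple_det (pts i) = (\<Sum>j\<in>UNIV. e j)"
      unfolding tuple_det_pts[OF i] e_def using det_rows_perp[OF u, of UNIV "row_of i"] by simp
    then show ?thesis by (simp only: sum.remove[OF finite UNIV_I, of _ h] Compl_eq_Diff_UNIV)
  qed
  ultimately have "1 / 2 \<le> \<bar>e h\<bar>" using det_pts_ge_1[OF i] by linarith
  also have "\<bar>e h\<bar> = \<bar>row_of i h \<bullet> u\<bar> * \<bar>det_rows ((row_of i)(h := u))\<bar>"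
    by (simp only: e_def abs_mult)
  also have "\<dots> \<le> exp (a i ! K i + \<epsilon> - q i) * norm (wedge_list (omit (k i) (pts i)))"
  proof (rule mult_mono)
    \<comment> \<open>The inner product does not depend on the time, so for the moving point the
      bound at the start of the stage is used.\<close>
    show "\<bar>row_of i h \<bullet> u\<bar> \<le> exp (a i ! K i + \<epsilon> - q i)"
      unfolding row_of_def h by (rule inner_le_exp_L_point[OF x_good(2)[OF i K_lt[OF i]]])
    have "(row_of i)(h := u) = (\<lambda>j. (pts i)[K i := u] ! pos j)"
    proof
      fix j
      have "pos j = K i \<longleftrightarrow> j = h" using h by (metis at_pos_pos)
      then show "((row_of i)(h := u)) j = (pts i)[K i := u] ! pos j"
        using pos_lt_CARD[of j] by (auto simp: row_of_def nth_list_update length_pts[OF i] nth_pts[OF i])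
    qed
    then have "det_rows ((row_of i)(h := u)) = tuple_det ((pts i)[K i := u])"
      by (simp only: tuple_det_eq)
    also have "\<bar>\<dots>\<bar> \<le> norm u * norm (wedge_list (take (K i) (pts i) @ drop (Suc (K i)) (pts i)))"
      by (rule wedge_list_top_upd[OF length_pts[OF i] K_lt[OF i]])
    finally show "\<bar>det_rows ((row_of i)(h := u))\<bar> \<le> norm (wedge_list (omit (k i) (pts i)))"
      by (simp add: u omit_Suc k_eq[OF i])
  qed auto
  finally have "1 / 2 * exp (- (a i ! K i + \<epsilon> - q i)) \<le>
      exp (a i ! K i + \<epsilon> - q i) * norm (wedge_list (omit (k i) (pts i))) * exp (- (a i ! K i + \<epsilon> - q i))"
    by (rule mult_right_mono) simp
  also have "\<dots> = (exp (a i ! K i + \<epsilon> - q i) * exp (- (a i ! K i + \<epsilon> - q i))) *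
      norm (wedge_list (omit (k i) (pts i)))"
    by (simp only: mult_ac)
  also have "\<dots> = norm (wedge_list (omit (k i) (pts i)))"
    by (simp only: exp_minus_inverse mult_1_left)
  also have "- (a i ! K i + \<epsilon> - q i) = q i - a i ! K i - \<epsilon>" by simp
  finally show ?thesis by simp
qed

lemma prod_list_gt_0: "(\<And>r. r \<in> set rs \<Longrightarrow> 0 < r) \<Longrightarrow> 0 < prod_list rs" for rs :: "real list"
  by (induction rs) auto

lemma ln_prod_list: "(\<And>r. r \<in> set rs \<Longrightarrow> 0 < r) \<Longrightarrow> ln (prod_list rs) = sum_list (map ln rs)" for rs :: "real list"
proof (induction rs)
  case (Cons r rs)
  have "0 < prod_list rs" using Cons.prems by (intro prod_list_gt_0) auto
  then show ?case 
    using Cons.IH Cons.prems[of r] Cons.prems by (simp add: ln_mult less_imp_neq[symmetric])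
qed simp

text \<open>The upper bound loses powers of the square root of \<open>n\<close> from
  \<open>norm_wedge_list_le\<close>. The lower bound compares \<open>norm_wedge_ge\<close> with the
  heights other than that of \<open>K i\<close>, whose sum is \<open>q i - a i ! K i\<close>, and
  loses \<open>ln 2\<close>. Both losses fit into \<open>2 * c1\<close>.\<close>

lemma almost_orthogonal:
  assumes i: "enat i < s"
  shows "\<bar>ln (norm (wedge_list (omit (k i) (pts i))))
      - (\<Sum>j \<in> {1..CARD('n)} - {k i}. ln (norm (coord (pts i) j)))\<bar> \<le> real CARD('n) * \<epsilon> + 2 * c1"
proof -
  define w where "w = norm (wedge_list (omit (k i) (pts i)))"
  define S where "S = (\<Sum>j \<in> {1..CARD('n)} - {k i}. ln (norm (coord (pts i) j)))"
  have w: "exp (q i - a i ! K i - \<epsilon>) / 2 \<le> w" unfolding w_def by (rule norm_wedge_ge[OF i])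
  then have w0: "0 < w" using exp_gt_zero[of "q i - a i ! K i - \<epsilon>"] by linarith
  have S: "S = sum_list (map (\<lambda>y. ln (norm y)) (omit (k i) (pts i)))"
    using sum_list_omit[of "K i" "pts i" "\<lambda>y. ln (norm y)"] K_lt[OF i]
    by (simp add: S_def length_pts[OF i] k_eq[OF i])
  have mem: "set (omit (k i) (pts i)) \<subseteq> set (pts i)"
    by (auto simp: omit_def dest: in_set_takeD in_set_dropD)
  have pos: "0 < norm y" if "y \<in> set (pts i)" for y
    using that x_nonzero[OF i] by (auto simp: set_pts[OF i])
  have "ln w \<le> real CARD('n) * \<epsilon> + 2 * c1 + S"
  proof -
    define N where "N = prod_list (map norm (omit (k i) (pts i)))"
    have N: "0 < N" unfolding N_def using pos mem by (intro prod_list_gt_0) auto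
    have "w \<le> sqrt (real CARD('n)) ^ length (omit (k i) (pts i)) * N"
      unfolding w_def N_def by (rule norm_wedge_list_le)
    then have "ln w \<le> ln (sqrt (real CARD('n)) ^ length (omit (k i) (pts i)) * N)"
      using w0 by (intro ln_mono) auto
    also have "\<dots> = real (length (omit (k i) (pts i))) * ln (sqrt (real CARD('n))) + ln N"
      using N by (simp add: ln_mult ln_realpow)
    also have "ln N = S"
      unfolding N_def S using pos mem by (subst ln_prod_list) (auto simp: comp_def)
    also have "real (length (omit (k i) (pts i))) * ln (sqrt (real CARD('n))) \<le> real CARD('n) * ln (real CARD('n))"
    proof (rule mult_mono)
      show "real (length (omit (k i) (pts i))) \<le> real CARD('n)"
        using length_omit[of "K i" "pts i"] K_lt[OF i] by (simp add: k_eq[OF i] length_pts[OF i])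
      have "0 \<le> ln (real CARD('n))" using dim_ge_2 by simp
      then show "ln (sqrt (real CARD('n))) \<le> ln (real CARD('n))" by (simp add: ln_sqrt)
    qed (use dim_ge_2 in auto)
    finally have "ln w \<le> real CARD('n) * ln (real CARD('n)) + S" by simp
    moreover have "0 \<le> real CARD('n) * \<epsilon>" using eps by simp
    ultimately show ?thesis using c1_ge(2) c1_pos by linarith
  qed
  moreover have "S - (real CARD('n) * \<epsilon> + 2 * c1) \<le> ln w"
  proof -
    have "S = (\<Sum>m\<in>{..<CARD('n)} - {K i}. ln (norm (x i m)))"
      unfolding S_def
      by (rule sum.reindex_bij_witness[of _ Suc "\<lambda>j. j - 1"])
        (auto simp: k_eq[OF i] nth_pts[OF i])
    also have "\<dots> \<le> (\<Sum>m\<in>{..<CARD('n)} - {K i}. a i ! m + \<epsilon>)"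
      using ln_norm_x_le[OF i] by (intro sum_mono) auto
    also have "\<dots> = (\<Sum>m<CARD('n). a i ! m + \<epsilon>) - (a i ! K i + \<epsilon>)"
      using K_lt[OF i] by (simp add: sum.remove[of "{..<CARD('n)}" "K i"])
    also have "(\<Sum>m<CARD('n). a i ! m + \<epsilon>) = q i + real CARD('n) * \<epsilon>"
      using sum_a[OF i] unfolding sum_pos[of "\<lambda>m. a i ! m + \<epsilon>"] .
    finally have "S \<le> q i + real CARD('n) * \<epsilon> - (a i ! K i + \<epsilon>)" .
    moreover have "q i - a i ! K i - \<epsilon> - ln 2 \<le> ln w"
    proof -
      have "ln (exp (q i - a i ! K i - \<epsilon>) / 2) \<le> ln w" using w by (intro ln_mono) auto
      then show ?thesis by (simp add: ln_div)
    qed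
    ultimately show ?thesis using ln_2_le c1_ge(1) c1_pos by linarith
  qed
  ultimately show ?thesis unfolding w_def[symmetric] S_def[symmetric] by linarith
qed

end

theorem theorem3p1:
  fixes n :: nat and c1 \<delta> \<epsilon> :: real
    and s :: enat and a :: "nat \<Rightarrow> real list" and k l :: "nat \<Rightarrow> nat"
    and P :: "real \<Rightarrow> real list" and q :: "nat \<Rightarrow> real"
    and u :: "real^'n::{finite,linorder}"
  assumes "n = CARD('n)" and "n \<ge> 2"
    and "c1 = 2 ^ n * real n * ln (real n)"
    and "\<delta> > 0" and "\<epsilon> > 0" and "\<delta> \<ge> 6 * (real n * \<epsilon> + c1)"
    and "canvas n \<delta> s a k l"
    and "attached_system s a k P"
    and "q = switch_number a"
    and "norm u = 1"
    and "\<forall>t \<ge> q 0. linf_dist (P t) (L_map u t) \<le> \<epsilon>"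
  shows "\<exists>x :: nat \<Rightarrow> (real^'n::{finite,linorder}) list. \<forall>i. enat i < s \<longrightarrow>
    length (x i) = n \<and> set (x i) \<subseteq> integer_points \<and> lin_indep_tuple (x i) \<and>
    (\<forall>t \<in> switch_interval s a i.
       linf_dist (P t) (sort (map (\<lambda>y. L_point u y t) (x i))) \<le> \<epsilon>) \<and>
    (enat (i + 1) < s \<longrightarrow> omit (k i) (x i) = omit (l (i + 1)) (x (i + 1))) \<and>
    (i \<ge> 1 \<longrightarrow>
       (\<forall>j \<in> {1..n}. \<bar>ln (norm (coord (x i) j)) - coord (P (q i)) j\<bar> \<le> \<epsilon>)) \<and>
    (enat (i + 1) < s \<longrightarrow>
       coord (x (i + 1)) (l (i + 1)) \<in> span (set (take (l (i + 1)) (x i)))) \<and>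
    0 \<le> ln \<bar>tuple_det (x i)\<bar> \<and> ln \<bar>tuple_det (x i)\<bar> \<le> real n * \<epsilon> + ln (real n) \<and>
    (i \<ge> 1 \<longrightarrow>
       \<bar>ln (norm (wedge_list (omit (k i) (x i))))
          - (\<Sum>j \<in> {1..n} - {k i}. ln (norm (coord (x i) j)))\<bar> \<le> real n * \<epsilon> + 2 * c1)"
proof -
  interpret approximated_canvas u c1 \<epsilon> \<delta> s a k l P
    by unfold_locales (use assms in auto)
  show ?thesis
  proof (intro exI[of _ pts] allI impI conjI ballI)
    fix i assume i: "enat i < s"
    show "length (pts i) = n" using length_pts[OF i] assms(1) by simp
    show "set (pts i) \<subseteq> integer_points" using x_good(1)[OF i] by (auto simp: set_pts[OF i])
    show "lin_indep_tuple (pts i)" by (rule lin_indep_pts[OF i])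
    show "linf_dist (P t) (sort (map (\<lambda>y. L_point u y t) (pts i))) \<le> \<epsilon>"
      if "t \<in> switch_interval s a i" for t
      by (rule approximates[OF i]) (use that in \<open>auto simp: switch_interval_def times_def\<close>)
    show "omit (k i) (pts i) = omit (l (i + 1)) (pts (i + 1))" if "enat (i + 1) < s"
      by (rule omit_pts[OF that])
    show "\<bar>ln (norm (coord (pts i) j)) - coord (P (q i)) j\<bar> \<le> \<epsilon>" if "1 \<le> i" "j \<in> {1..n}" for j
    proof -
      have j: "j - 1 < CARD('n)" using that(2) assms(1) by auto
      show ?thesis
        unfolding assms(9) P_start[OF i] nth_pts[OF i j]
        using ln_norm_x_le[OF i j] ln_norm_x_ge[OF i that(1) j] by linarith
    qed
    show "coord (pts (i + 1)) (l (i + 1)) \<in> span (set (take (l (i + 1)) (pts i)))"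
      if i': "enat (i + 1) < s"
      using new_point_in_span[OF i'] L_lt[OF i']
      by (simp only: l_eq[OF i'] diff_Suc_1 nth_pts[OF i'] set_take_pts[OF i] Suc_le_eq)
    show "0 \<le> ln \<bar>tuple_det (pts i)\<bar>" by (rule ln_det_pts(1)[OF i])
    show "ln \<bar>tuple_det (pts i)\<bar> \<le> real n * \<epsilon> + ln (real n)"
      using ln_det_pts(2)[OF i] assms(1) by simp
    show "\<bar>ln (norm (wedge_list (omit (k i) (pts i))))
          - (\<Sum>j \<in> {1..n} - {k i}. ln (norm (coord (pts i) j)))\<bar> \<le> real n * \<epsilon> + 2 * c1"
      using almost_orthogonal[OF i] assms(1) by simp
  qed
qed

end
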